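(* Let $-1<\rho<1$. For each $N\ge 1$ let $X$ be an $N\times N$ real Gaussian elliptic random matrix with parameter $\rho$, let $W=\frac{1}{N^2}X^2X^{*2}$, and let $F_N(x)$ be the expected spectral distribution function of $W$. Then the limit $\lim_{N\to\infty}F_N(x)=F(x)$ exists, and this distribution function $F(x)$ is uniquely determined by its moments $$M_k(\rho)=\int_{-\infty}^{\infty}x^k\,dF(x).$$ The sequence of moments is $M_k(\rho)=U_{2k}(\rho)$, where the polynomials $U_k(\rho)$ (together with auxiliary polynomials $V_k(\rho)$) satisfy, for all integers $k\ge 0$, the recurrence relations $$U_{k+1}(\rho)=\sum_{i=0}^{\lfloor\frac{k-1}{2}\rfloor}U_{k-2i-1}(\rho)V_{2i+1}(\rho)+\rho\sum_{i=0}^{\lfloor\frac{k}{2}\rfloor}V_{2i}(\rho)U_{k-2i}(\rho),$$ $$V_{k+1}(\rho)=\sum_{i=0}^{\lfloor\frac{k}{2}\rfloor}U_{2i}(\rho)V_{k-2i}(\rho)+\rho\sum_{i=0}^{\lfloor\frac{k-1}{2}\rfloor}U_{2i+1}(\rho)V_{k-2i-1}(\rho),$$ with initial conditions $U_0(\rho)=V_0(\rho)=1$.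
   Context: A real Gaussian elliptic random matrix with parameter $\rho\in(-1,1)$ of size $N\times N$ is the matrix $X=(X_{ij})_{1\le i,j\le N}$ built from a family of mutually independent real Gaussian vectors $(X_{ij},X_{ji})$, $1\le i\le j$, such that $\mathbb{E}X_{ij}=\mathbb{E}X_{ji}=0$, $\mathbb{E}X_{ij}^2=\mathbb{E}X_{ji}^2=1$, and $\mathbb{E}X_{ij}X_{ji}=\rho$ for any $i\ne j$. $X^*$ is the (conjugate) transpose of $X$, and $X^{*2}=(X^* )^2$. If $\lambda_1\le\dots\le\lambda_N$ are the eigenvalues of $W=\frac{1}{N^2}X^2X^{*2}$, the empirical spectral distribution function is $\mathcal{F}_N(x)=\frac1N\#\{i:\lambda_i\le x\}$, and the expected spectral distribution function is $F_N(x)=\mathbb{E}\mathcal{F}_N(x)$. Empty sums (e.g. sums with upper limit $-1$) are zero. *)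

theory Defs
  imports "HOL-Probability.Probability" "Jordan_Normal_Form.Char_Poly"
begin

(* A degenerate (almost surely constant) variable counts as Gaussian.  This is needed for
   vectors (Y, Y), as on the diagonal of the random matrix. *)
definition gaussian_rv :: "'a measure \<Rightarrow> ('a \<Rightarrow> real) \<Rightarrow> bool" where
  "gaussian_rv M Y \<longleftrightarrow> Y \<in> borel_measurable M \<and>
     ((\<exists>\<mu> \<sigma>. 0 < \<sigma> \<and> distributed M lborel Y (normal_density \<mu> \<sigma>)) \<or>
      (\<exists>c. AE \<omega> in M. Y \<omega> = c))"

definition gaussian_vector2 :: "'a measure \<Rightarrow> ('a \<Rightarrow> real \<times> real) \<Rightarrow> bool" where
  "gaussian_vector2 M V \<longleftrightarrow> V \<in> borel_measurable M \<and>
     (\<forall>a b. gaussian_rv M (\<lambda>\<omega>. a * fst (V \<omega>) + b * snd (V \<omega>)))"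

(* Matrix indices run over {0..<N}. *)
definition gaussian_elliptic :: "'a measure \<Rightarrow> nat \<Rightarrow> real \<Rightarrow> ('a \<Rightarrow> real mat) \<Rightarrow> bool" where
  "gaussian_elliptic M N \<rho> X \<longleftrightarrow>
     prob_space M \<and>
     (\<forall>\<omega>\<in>space M. X \<omega> \<in> carrier_mat N N) \<and>
     (\<forall>i j. i \<le> j \<and> j < N \<longrightarrow> gaussian_vector2 M (\<lambda>\<omega>. (X \<omega> $$ (i, j), X \<omega> $$ (j, i)))) \<and>
     prob_space.indep_vars M (\<lambda>_. borel)
       (\<lambda>(i, j) \<omega>. (X \<omega> $$ (i, j), X \<omega> $$ (j, i))) {(i, j). i \<le> j \<and> j < N} \<and>
     (\<forall>i j. i < N \<and> j < N \<longrightarrow>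
        prob_space.expectation M (\<lambda>\<omega>. X \<omega> $$ (i, j)) = 0 \<and>
        prob_space.expectation M (\<lambda>\<omega>. (X \<omega> $$ (i, j))\<^sup>2) = 1) \<and>
     (\<forall>i j. i < N \<and> j < N \<and> i \<noteq> j \<longrightarrow>
        prob_space.expectation M (\<lambda>\<omega>. X \<omega> $$ (i, j) * X \<omega> $$ (j, i)) = \<rho>)"

definition W_mat :: "nat \<Rightarrow> real mat \<Rightarrow> real mat" where
  "W_mat N X = (1 / (real N)\<^sup>2) \<cdot>\<^sub>m (X ^\<^sub>m 2 * (transpose_mat X) ^\<^sub>m 2)"

(* Eigenvalues are counted with algebraic multiplicity.  Only real eigenvalues are seen, which
   are all of them for the symmetric matrices considered here. *)
definition esd :: "real mat \<Rightarrow> real \<Rightarrow> real" where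
  "esd A x = real (size {# l \<in># proots (char_poly A). l \<le> x #}) / real (dim_row A)"

definition expected_esd :: "'a measure \<Rightarrow> ('a \<Rightarrow> real mat) \<Rightarrow> real \<Rightarrow> real" where
  "expected_esd M A x = prob_space.expectation M (\<lambda>\<omega>. esd (A \<omega>) x)"

(* The polynomials are elements of real poly in the indeterminate [:0, 1:], which plays the role
   of rho.  The index set {i. 2 * i + 1 \<le> k} is the range from 0 to floor ((k - 1) / 2), which
   is empty for k = 0. *)
function U_poly :: "nat \<Rightarrow> real poly" and V_poly :: "nat \<Rightarrow> real poly" where
  "U_poly 0 = 1"
| "U_poly (Suc k) =
     (\<Sum>i | 2 * i + 1 \<le> k. U_poly (k - 2 * i - 1) * V_poly (2 * i + 1)) +
     [:0, 1:] * (\<Sum>i | 2 * i \<le> k. V_poly (2 * i) * U_poly (k - 2 * i))"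
| "V_poly 0 = 1"
| "V_poly (Suc k) =
     (\<Sum>i | 2 * i \<le> k. U_poly (2 * i) * V_poly (k - 2 * i)) +
     [:0, 1:] * (\<Sum>i | 2 * i + 1 \<le> k. U_poly (2 * i + 1) * V_poly (k - 2 * i - 1))"
  by pat_completeness auto
termination
  by (relation "Wellfounded.measure (case_sum id id)") auto

end

(* The normalised mean traces of W^k are computed with the Wick formula.  Writing a mean trace as
   a sum over labelled graphs, one Wick contraction deletes two edges and identifies their end
   points; a graph with e edges and c components contributes at most O(N^(e/2 + c)).  For a union
   of cycles only the contractions that split a cycle survive in the limit, which leaves a weighted
   count of noncrossing pairings of the word X X X* X* X X X* X* ..., and splitting off the pair of
   the first letter gives the recurrences for U and V.  As |U_k| <= 2 * 4^k, the method of moments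
   yields a compactly supported limit law, determined by its moments.

   Convergence at every x needs a limit without atoms.  The recurrences make m(w) = sum_k U_2k w^k
   a root of m^2 (1 - (1 + rho)^2 w m^2) (1 - (1 - rho)^2 w m^2) = 1.  With w = 1/z this extends by
   analytic continuation to z G(z) on the upper half plane, G being the Stieltjes transform, and
   contradicts the growth of G that an atom would cause. *)

theory Submission
  imports Defs "HOL-Complex_Analysis.Complex_Analysis" "Jordan_Normal_Form.Schur_Decomposition"
begin

text \<open>A contraction identifies vertices arbitrarily and so leaves the class of cycles at once.
  The vertex set is therefore kept fixed, and identifications accumulate as equations between
  labels. The exponent e/2 + c then needs no planarity argument: a contraction removes two edges,
  but its new equations reconnect the ends of one of them through the other, so at most one
  component is gained. A contraction that gains none is smaller by a factor N. A split turns one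
  cycle into two, so the limit is proved for families of cycles, where it is a product.

  The degree 6 term of the equation for G is (1 - \<rho>^2)^2 z^4 G^6; its coefficient is nonzero
  for |\<rho>| < 1 and z \<noteq> 0. The point 0 needs separate care: the dominant balance there
  makes G of order z^(-2/3), so G is unbounded without an atom, and only the comparison with the
  rate 1/z of an atom decides.\<close>

subsection \<open>Graph sums\<close>

text \<open>The last term corrects the diagonal entries, whose variance is 1 and not 1 + \<rho>.\<close>

definition elliptic_cov :: "real \<Rightarrow> nat \<times> nat \<Rightarrow> nat \<times> nat \<Rightarrow> real" where
  "elliptic_cov \<rho> = (\<lambda>(a, b) (c, d).
     of_bool (a = c \<and> b = d) + \<rho> * of_bool (a = d \<and> b = c) - \<rho> * of_bool (a = b \<and> a = c \<and> a = d))"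

definition orient :: "bool \<Rightarrow> 'v \<Rightarrow> 'v \<Rightarrow> 'v \<times> 'v" where
  "orient l u v = (if l then (u, v) else (v, u))"

text \<open>The covariance of two letters whose steps a closed walk traverses in opposite
  directions: equal letters then read transposed entries, with covariance \<rho>, and different
  letters read the same entry, with variance 1.\<close>

definition pair_weight :: "real \<Rightarrow> bool \<Rightarrow> bool \<Rightarrow> real" where
  "pair_weight \<rho> l l' = (if l = l' then \<rho> else 1)"

text \<open>Relative to the walk, the two ways to match index pairs are antiparallel (a with d, b
  with c) and parallel (a with c, b with d). Transposing one letter exchanges them, hence the
  negated letter in the second weight.\<close>

lemma elliptic_cov_orient:
  "elliptic_cov \<rho> (orient l a b) (orient l' c d) =
     pair_weight \<rho> l l' * of_bool (a = d \<and> b = c) + pair_weight \<rho> l (\<not> l') * of_bool (a = c \<and> b = d)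
     - \<rho> * of_bool (a = b \<and> a = c \<and> a = d)"
  by (cases l; cases l') (auto simp: elliptic_cov_def orient_def pair_weight_def)

lemma map_prod_orient: "map_prod f f (orient l u v) = orient l (f u) (f v)"
  by (simp add: orient_def)

definition constrained :: "nat \<Rightarrow> 'v set \<Rightarrow> ('v \<times> 'v) set \<Rightarrow> ('v \<Rightarrow> nat) set" where
  "constrained N V Q = {f \<in> V \<rightarrow>\<^sub>E {..<N}. \<forall>(x, y)\<in>Q. f x = f y}"

lemma finite_constrained: "finite V \<Longrightarrow> finite (constrained N V Q)"
  unfolding constrained_def by (intro finite_Collect_conjI disjI1) (auto simp: finite_PiE)

section \<open>Components of a graph and the number of admissible labellings\<close>

definition connectivity :: "('v \<times> 'v) set \<Rightarrow> ('v \<times> 'v) set" where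
  "connectivity A = (A \<union> A\<inverse>)\<^sup>*"

text \<open>The graph with vertex set V and edge set A has at most m components.\<close>

definition covered :: "'v set \<Rightarrow> ('v \<times> 'v) set \<Rightarrow> nat \<Rightarrow> bool" where
  "covered V A m \<longleftrightarrow> (\<exists>R\<subseteq>V. card R \<le> m \<and> (\<forall>v\<in>V. \<exists>r\<in>R. (v, r) \<in> connectivity A))"

lemma connectivity_sym: "(x, y) \<in> connectivity A \<Longrightarrow> (y, x) \<in> connectivity A"
proof -
  have "sym ((A \<union> A\<inverse>)\<^sup>*)" by (intro sym_rtrancl) (auto simp: sym_def)
  then show "(x, y) \<in> connectivity A \<Longrightarrow> (y, x) \<in> connectivity A"
    unfolding connectivity_def by (rule symD)
qed

lemma connectivity_trans: "(x, y) \<in> connectivity A \<Longrightarrow> (y, z) \<in> connectivity A \<Longrightarrow> (x, z) \<in> connectivity A"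
  unfolding connectivity_def by (rule rtrancl_trans)

lemma connectivity_refl [simp]: "(x, x) \<in> connectivity A"
  unfolding connectivity_def by simp

lemma connectivity_base: "(x, y) \<in> A \<Longrightarrow> (x, y) \<in> connectivity A"
  unfolding connectivity_def by auto

lemma connectivity_le:
  assumes "A \<subseteq> connectivity B" shows "connectivity A \<subseteq> connectivity B"
proof -
  have "A \<union> A\<inverse> \<subseteq> (B \<union> B\<inverse>)\<^sup>*"
    using assms connectivity_sym[of _ _ B] unfolding connectivity_def by auto
  then show ?thesis unfolding connectivity_def using rtrancl_subset_rtrancl by blast
qed

lemma connectivity_mono: "A \<subseteq> B \<Longrightarrow> connectivity A \<subseteq> connectivity B"
  by (intro connectivity_le) (auto intro: connectivity_base)

lemma covered_mono:
  assumes "covered V A m" "A \<subseteq> connectivity B" shows "covered V B m"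
  using assms(1) connectivity_le[OF assms(2)] unfolding covered_def by (meson subsetD)

text \<open>Up to its first use of the new edge, a walk stays in \<open>A\<close>; there it has
  reached \<open>p\<close> or \<open>q\<close>.\<close>

lemma connectivity_insertD:
  assumes "(x, y) \<in> connectivity (insert (p, q) A)"
  shows "(x, y) \<in> connectivity A \<or> (x, p) \<in> connectivity A \<or> (x, q) \<in> connectivity A"
  using assms unfolding connectivity_def
proof (induction rule: converse_rtrancl_induct)
  case base
  then show ?case by simp
next
  case (step x z)
  show ?case
  proof (cases "(x, z) \<in> A \<union> A\<inverse>")
    case True
    then show ?thesis using step.IH by (meson converse_rtrancl_into_rtrancl)
  next
    case False
    then have "x = p \<or> x = q" using step.hyps by auto
    then show ?thesis by auto
  qed
qed

lemma connectivity_insert_iff: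
  "connectivity (insert (p, q) A) = connectivity A \<union>
    {(x, y). (x, p) \<in> connectivity A \<and> (q, y) \<in> connectivity A} \<union>
    {(x, y). (x, q) \<in> connectivity A \<and> (p, y) \<in> connectivity A}" (is "?L = ?R")
proof
  show "?R \<subseteq> ?L"
  proof -
    have m: "connectivity A \<subseteq> ?L" by (rule connectivity_mono) auto
    have pq: "(p, q) \<in> ?L" "(q, p) \<in> ?L"
      by (auto intro: connectivity_base connectivity_sym)
    show ?thesis using m pq by (auto intro: connectivity_trans)
  qed
  show "?L \<subseteq> ?R"
  proof (rule subrelI, rule ccontr)
    fix x y
    assume a: "(x, y) \<in> connectivity (insert (p, q) A)" and "(x, y) \<notin> ?R"
    then have n2: "\<not> ((x, q) \<in> connectivity A \<and> (p, y) \<in> connectivity A)" and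
      n1: "\<not> ((x, p) \<in> connectivity A \<and> (q, y) \<in> connectivity A)" and
      n3: "(x, y) \<notin> connectivity A" by auto
    have x: "(x, p) \<in> connectivity A \<or> (x, q) \<in> connectivity A"
      using connectivity_insertD[OF a] n3 by auto
    have y: "(y, p) \<in> connectivity A \<or> (y, q) \<in> connectivity A"
      using connectivity_insertD[OF connectivity_sym[OF a]] n3 connectivity_sym by metis
    show False using x y n1 n2 n3 connectivity_sym connectivity_trans by metis
  qed
qed

text \<open>Only the component of the edge can break, and into at most two parts. The old
  representatives serve the part of one end point; the other end point becomes the additional
  representative.\<close>

lemma covered_delete_edge:
  assumes "covered V (insert (p, q) A) m" "finite V" "p \<in> V" "q \<in> V"
  shows "covered V A (Suc m)"
proof -
  from assms obtain R where R: "R \<subseteq> V" "card R \<le> m"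
    and c: "\<And>v. v \<in> V \<Longrightarrow> \<exists>r\<in>R. (v, r) \<in> connectivity (insert (p, q) A)"
    unfolding covered_def by blast
  have fR: "finite R" using R assms finite_subset by blast
  \<comment> \<open>\<open>p'\<close> is the end point that may have lost its representative,
    \<open>q'\<close> the one that keeps it; either end of the edge can play either role.\<close>
  have *: "covered V A (Suc m)" if pq: "p' \<in> V" "q' \<in> V" "{p', q'} = {p, q}"
    and q: "\<exists>r\<in>R. (q', r) \<in> connectivity A" for p' q'
    unfolding covered_def
  proof (intro exI[of _ "insert p' R"] conjI ballI)
    show "insert p' R \<subseteq> V" using R that by auto
    show "card (insert p' R) \<le> Suc m" using R fR by (simp add: card_insert_if)
    fix v assume "v \<in> V"
    then obtain r where r: "r \<in> R" "(v, r) \<in> connectivity (insert (p, q) A)" using c by blast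
    then have "(v, r) \<in> connectivity A \<or> (v, p') \<in> connectivity A \<or> (v, q') \<in> connectivity A"
      using connectivity_insertD[OF r(2)] pq(3) by (auto simp: doubleton_eq_iff)
    then show "\<exists>r\<in>insert p' R. (v, r) \<in> connectivity A"
      using r q connectivity_trans by (metis insertCI)
  qed
  obtain r where r: "r \<in> R" "(q, r) \<in> connectivity (insert (p, q) A)" using c assms by blast
  then have "(q, r) \<in> connectivity A \<or> (p, r) \<in> connectivity A"
    unfolding connectivity_insert_iff by auto
  then show ?thesis using *[of p q] *[of q p] r assms by auto
qed

text \<open>An admissible labelling is constant on components, hence determined by its values on the
  representatives.\<close>

lemma card_constrained_le:
  assumes "finite V" "covered V Q m" "Q \<subseteq> V \<times> V" "N \<ge> 1"
  shows "card (constrained N V Q) \<le> N ^ m"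
proof -
  from assms obtain R where R: "R \<subseteq> V" "card R \<le> m"
    and c: "\<And>v. v \<in> V \<Longrightarrow> \<exists>r\<in>R. (v, r) \<in> connectivity Q"
    unfolding covered_def by blast
  have fR: "finite R" using R assms finite_subset by blast
  have const: "f x = f y" if "f \<in> constrained N V Q" "(x, y) \<in> connectivity Q" for f x y
    using that(2) unfolding connectivity_def
    by (induction rule: rtrancl_induct) (use that(1) in \<open>auto simp: constrained_def\<close>)
  have inj: "inj_on (\<lambda>f. restrict f R) (constrained N V Q)"
  proof (rule inj_onI)
    fix f g assume fg: "f \<in> constrained N V Q" "g \<in> constrained N V Q" "restrict f R = restrict g R"
    have "f v = g v" if "v \<in> V" for v
    proof -
      obtain r where r: "r \<in> R" "(v, r) \<in> connectivity Q" using c[OF \<open>v \<in> V\<close>] by blast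
      have "f v = f r" "g v = g r" using const fg r by auto
      moreover have "f r = g r" using fg(3) r(1) by (metis restrict_apply')
      ultimately show ?thesis by simp
    qed
    then show "f = g" using fg(1,2) unfolding constrained_def
      by (intro PiE_ext[where k=V and s="\<lambda>_. {..<N}"]) auto
  qed
  have "card (constrained N V Q) = card ((\<lambda>f. restrict f R) ` constrained N V Q)"
    using card_image[OF inj] by simp
  also have "\<dots> \<le> card (R \<rightarrow>\<^sub>E {..<N})"
    using R by (intro card_mono finite_PiE) (auto simp: constrained_def fR PiE_iff)
  also have "\<dots> = N ^ card R" using fR by (simp add: card_PiE)
  also have "\<dots> \<le> N ^ m" using R assms by (intro power_increasing) auto
  finally show ?thesis .
qed

section \<open>Contraction of one edge and the bound on graph sums\<close>

lemma sum_sum_mset_swap: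
  "(\<Sum>f\<in>A. \<Sum>k\<in>#M. g f k) = (\<Sum>k\<in>#M. \<Sum>f\<in>A. g f k :: real)"
  by (induction M) (auto simp: sum.distrib)

lemma abs_sum_mset_le: "\<bar>\<Sum>k\<in>#M. g k\<bar> \<le> (\<Sum>k\<in>#M. \<bar>g k :: real\<bar>)"
  by (induction M) (auto intro: order.trans[OF abs_triangle_ineq])

text \<open>\<open>EE N es\<close> stands for the mean of the product of the matrix entries listed
  in \<open>es\<close>. Its recursion over the partner of one factor is all that the combinatorics
  uses of the Gaussian law.\<close>

locale wick_functional =
  fixes \<rho> :: real and EE :: "nat \<Rightarrow> (nat \<times> nat) multiset \<Rightarrow> real"
  assumes EE_empty: "N \<ge> 1 \<Longrightarrow> EE N {#} = 1"
    and EE_add: "\<lbrakk>N \<ge> 1; e \<in> {..<N} \<times> {..<N}; set_mset es \<subseteq> {..<N} \<times> {..<N}\<rbrakk> \<Longrightarrow>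
      EE N (add_mset e es) = (\<Sum>e'\<in>#es. elliptic_cov \<rho> e e' * EE N (es - {#e'#}))"
begin

definition graph_sum :: "nat \<Rightarrow> 'v set \<Rightarrow> ('v \<times> 'v) set \<Rightarrow> ('v \<times> 'v) multiset \<Rightarrow> real" where
  "graph_sum N V Q es = (\<Sum>f\<in>constrained N V Q. EE N (image_mset (map_prod f f) es))"

lemma graph_sum_cong:
  assumes "\<And>f. f \<in> V \<rightarrow>\<^sub>E {..<N} \<Longrightarrow> (\<forall>(x, y)\<in>Q. f x = f y) \<longleftrightarrow> (\<forall>(x, y)\<in>Q'. f x = f y)"
  shows "graph_sum N V Q es = graph_sum N V Q' es"
proof -
  have "constrained N V Q = constrained N V Q'"
    unfolding constrained_def using assms by blast
  then show ?thesis by (simp add: graph_sum_def)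
qed

text \<open>Every delta in the covariance only restricts the labellings by further equations, so a
  contraction of a graph sum is again a combination of graph sums. The functions \<open>l'\<close>,
  \<open>c\<close>, \<open>d\<close> allow each partner to be read in either direction.\<close>

lemma graph_sum_step:
  assumes V: "finite V" "N \<ge> 1" "a \<in> V" "b \<in> V" "set_mset es \<subseteq> V \<times> V"
    and k: "\<And>k. k \<in># es \<Longrightarrow> k = orient (l' k) (c k) (d k)"
  shows "graph_sum N V Q (add_mset (orient l a b) es) =
    (\<Sum>k\<in>#es. pair_weight \<rho> l (l' k) * graph_sum N V (Q \<union> {(a, d k), (b, c k)}) (es - {#k#})
      + pair_weight \<rho> l (\<not> l' k) * graph_sum N V (Q \<union> {(a, c k), (b, d k)}) (es - {#k#})
      - \<rho> * graph_sum N V (Q \<union> {(a, b), (a, c k), (a, d k)}) (es - {#k#}))"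
proof -
  let ?C = "constrained N V Q"
  have fin: "finite ?C" using V finite_constrained by auto
  let ?e = "\<lambda>f k. EE N (image_mset (map_prod f f) (es - {#k#}))"
  have sumc: "graph_sum N V (Q \<union> Q') M = (\<Sum>f\<in>?C. of_bool (\<forall>(x,y)\<in>Q'. f x = f y) * EE N (image_mset (map_prod f f) M))"
    for Q' M
  proof -
    have "constrained N V (Q \<union> Q') = {f\<in>?C. \<forall>(x,y)\<in>Q'. f x = f y}"
      unfolding constrained_def by auto
    then show ?thesis unfolding graph_sum_def
      by (simp only:) (rule sum.mono_neutral_cong_left, use fin in auto)
  qed
  have "graph_sum N V Q (add_mset (orient l a b) es) =
    (\<Sum>f\<in>?C. \<Sum>k\<in>#es. elliptic_cov \<rho> (map_prod f f (orient l a b)) (map_prod f f k) * ?e f k)"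
    unfolding graph_sum_def
  proof (intro sum.cong refl)
    fix f assume f: "f \<in> ?C"
    then have fV: "\<And>x. x \<in> V \<Longrightarrow> f x < N" unfolding constrained_def by auto
    have "EE N (add_mset (map_prod f f (orient l a b)) (image_mset (map_prod f f) es)) =
      (\<Sum>e'\<in>#image_mset (map_prod f f) es. elliptic_cov \<rho> (map_prod f f (orient l a b)) e' *
         EE N (image_mset (map_prod f f) es - {#e'#}))"
      by (rule EE_add) (use V fV in \<open>auto simp: map_prod_orient orient_def\<close>)
    also have "\<dots> = (\<Sum>k\<in>#es. elliptic_cov \<rho> (map_prod f f (orient l a b)) (map_prod f f k) * ?e f k)"
      unfolding image_mset.compositionality o_def
      by (intro arg_cong[of _ _ sum_mset] image_mset_cong) (simp add: image_mset_Diff)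
    finally show "EE N (image_mset (map_prod f f) (add_mset (orient l a b) es)) = \<dots>" by simp
  qed
  also have "\<dots> = (\<Sum>k\<in>#es. \<Sum>f\<in>?C. elliptic_cov \<rho> (map_prod f f (orient l a b)) (map_prod f f k) * ?e f k)"
    by (rule sum_sum_mset_swap)
  also have "\<dots> = (\<Sum>k\<in>#es. pair_weight \<rho> l (l' k) * graph_sum N V (Q \<union> {(a, d k), (b, c k)}) (es - {#k#})
      + pair_weight \<rho> l (\<not> l' k) * graph_sum N V (Q \<union> {(a, c k), (b, d k)}) (es - {#k#})
      - \<rho> * graph_sum N V (Q \<union> {(a, b), (a, c k), (a, d k)}) (es - {#k#}))"
  proof (intro arg_cong[of _ _ sum_mset] image_mset_cong)
    fix k assume "k \<in># es"
    then have kk: "map_prod f f k = orient (l' k) (f (c k)) (f (d k))" for f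
      using k map_prod_orient by metis
    show "(\<Sum>f\<in>?C. elliptic_cov \<rho> (map_prod f f (orient l a b)) (map_prod f f k) * ?e f k) =
       pair_weight \<rho> l (l' k) * graph_sum N V (Q \<union> {(a, d k), (b, c k)}) (es - {#k#})
      + pair_weight \<rho> l (\<not> l' k) * graph_sum N V (Q \<union> {(a, c k), (b, d k)}) (es - {#k#})
      - \<rho> * graph_sum N V (Q \<union> {(a, b), (a, c k), (a, d k)}) (es - {#k#})"
      unfolding sumc kk map_prod_orient elliptic_cov_orient sum_distrib_left
        sum.distrib[symmetric] sum_subtractf[symmetric]
      by (intro sum.cong refl) (auto simp: algebra_simps)
  qed
  finally show ?thesis .
qed

text \<open>Equations in \<open>Q\<close> connect vertices just as edges do, so \<open>m\<close>
  bounds the components of both together. Once no edge is left, the sum merely counts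
  labellings.\<close>

lemma graph_sum_bound:
  assumes "finite V" "set_mset es \<subseteq> V \<times> V" "Q \<subseteq> V \<times> V" "covered V (Q \<union> set_mset es) m"
  shows "\<exists>C. \<forall>N\<ge>1. \<bar>graph_sum N V Q es\<bar> \<le> C * real N powr (size es / 2 + m)"
  using assms
proof (induction "size es" arbitrary: es Q m rule: less_induct)
  case (less es Q m)
  note V = \<open>finite V\<close>
  show ?case
  proof (cases es)
    case empty
    have "\<bar>graph_sum N V Q es\<bar> \<le> 1 * real N powr (size es / 2 + m)" if "N \<ge> 1" for N
    proof -
      have "\<bar>graph_sum N V Q es\<bar> = card (constrained N V Q)"
        using empty that by (simp add: graph_sum_def EE_empty)
      also have "\<dots> \<le> real N ^ m"
        using card_constrained_le[of V Q m N] less.prems empty that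
        by (simp flip: of_nat_power)
      finally show ?thesis using empty that by (simp add: powr_realpow)
    qed
    then show ?thesis by blast
  next
    case (add e es')
    obtain a b where e: "e = (a, b)" by force
    have ab: "a \<in> V" "b \<in> V" and es': "set_mset es' \<subseteq> V \<times> V" using less.prems add e by auto
    \<comment> \<open>The assumption on \<open>Q'\<close> says that restoring the single edge (a, b)
      also reconnects the ends of \<open>k\<close>. Hence the removal of both edges costs one
      component, which the loss of two edges in the exponent pays for.\<close>
    have aux: "\<exists>C. \<forall>N\<ge>1. \<bar>graph_sum N V (Q \<union> Q') (es' - {#k#})\<bar> \<le> C * real N powr (size es / 2 + m)"
      if k: "k \<in># es'" and Q': "Q' \<subseteq> V \<times> V" "k \<in> connectivity (insert (a, b) Q')" for k Q'
    proof -
      let ?A = "Q \<union> Q' \<union> set_mset (es' - {#k#})"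
      have "Q \<union> set_mset es \<subseteq> connectivity (insert (a, b) ?A)"
      proof
        fix x assume "x \<in> Q \<union> set_mset es"
        then consider "x \<in> Q" | "x = (a, b)" | "x = k" | "x \<in># es' - {#k#}"
          using add e by (auto dest: in_diffD) (metis insert_DiffM insert_noteq_member k)
        then show "x \<in> connectivity (insert (a, b) ?A)"
        proof cases
          case 3
          have "connectivity (insert (a, b) Q') \<subseteq> connectivity (insert (a, b) ?A)"
            by (rule connectivity_mono) auto
          then show ?thesis using 3 Q' by auto
        qed (cases x; auto intro!: connectivity_base)+
      qed
      then have "covered V (insert (a, b) ?A) m" using covered_mono less.prems by blast
      then have cov: "covered V ?A (Suc m)" by (rule covered_delete_edge[OF _ V ab])
      have sz: "size es = size (es' - {#k#}) + 2"
        using add k by (metis add_2_eq_Suc' insert_DiffM size_add_mset)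
      have "\<exists>C. \<forall>N\<ge>1. \<bar>graph_sum N V (Q \<union> Q') (es' - {#k#})\<bar>
           \<le> C * real N powr (size (es' - {#k#}) / 2 + Suc m)"
        by (rule less.hyps) (use sz V cov less.prems Q' es' in \<open>auto dest: in_diffD\<close>)
      then show ?thesis using sz by (auto simp: algebra_simps add_divide_distrib)
    qed
    define t where "t N k =
       pair_weight \<rho> True True * graph_sum N V (Q \<union> {(a, snd k), (b, fst k)}) (es' - {#k#})
      + pair_weight \<rho> True False * graph_sum N V (Q \<union> {(a, fst k), (b, snd k)}) (es' - {#k#})
      - \<rho> * graph_sum N V (Q \<union> {(a, b), (a, fst k), (a, snd k)}) (es' - {#k#})" for N k
    have "\<forall>k\<in>#es'. \<exists>C. \<forall>N\<ge>1. \<bar>t N k\<bar> \<le> C * real N powr (size es / 2 + m)"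
    proof
      fix k assume k: "k \<in># es'"
      obtain c d where kcd: "k = (c, d)" by force
      have cd: "c \<in> V" "d \<in> V" using k kcd es' by auto
      have 1: "k \<in> connectivity (insert (a, b) {(a, d), (b, c)})"
        unfolding kcd
        by (meson connectivity_base connectivity_sym connectivity_trans insertCI)
      have 2: "k \<in> connectivity (insert (a, b) {(a, c), (b, d)})"
        unfolding kcd
        by (meson connectivity_base connectivity_sym connectivity_trans insertCI)
      have 3: "k \<in> connectivity (insert (a, b) {(a, b), (a, c), (a, d)})"
        unfolding kcd
        by (meson connectivity_base connectivity_sym connectivity_trans insertCI)
      obtain C1 C2 C3 where
        C: "\<And>N. N \<ge> 1 \<Longrightarrow> \<bar>graph_sum N V (Q \<union> {(a, d), (b, c)}) (es' - {#k#})\<bar> \<le> C1 * real N powr (size es / 2 + m)"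
        "\<And>N. N \<ge> 1 \<Longrightarrow> \<bar>graph_sum N V (Q \<union> {(a, c), (b, d)}) (es' - {#k#})\<bar> \<le> C2 * real N powr (size es / 2 + m)"
        "\<And>N. N \<ge> 1 \<Longrightarrow> \<bar>graph_sum N V (Q \<union> {(a, b), (a, c), (a, d)}) (es' - {#k#})\<bar> \<le> C3 * real N powr (size es / 2 + m)"
        using aux[OF k _ 1] aux[OF k _ 2] aux[OF k _ 3] ab cd by auto
      show "\<exists>C. \<forall>N\<ge>1. \<bar>t N k\<bar> \<le> C * real N powr (size es / 2 + m)"
      proof (intro exI[of _ "\<bar>\<rho>\<bar> * C1 + C2 + \<bar>\<rho>\<bar> * C3"] allI impI)
        fix N :: nat assume N: "N \<ge> 1"
        have "\<bar>t N k\<bar> \<le> \<bar>\<rho>\<bar> * \<bar>graph_sum N V (Q \<union> {(a, d), (b, c)}) (es' - {#k#})\<bar> +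
          \<bar>graph_sum N V (Q \<union> {(a, c), (b, d)}) (es' - {#k#})\<bar> +
          \<bar>\<rho>\<bar> * \<bar>graph_sum N V (Q \<union> {(a, b), (a, c), (a, d)}) (es' - {#k#})\<bar>"
          unfolding t_def kcd fst_conv snd_conv pair_weight_def abs_mult[symmetric] by simp
        also have "\<dots> \<le> \<bar>\<rho>\<bar> * (C1 * real N powr (size es / 2 + m)) + C2 * real N powr (size es / 2 + m) + \<bar>\<rho>\<bar> * (C3 * real N powr (size es / 2 + m))"
          by (intro add_mono mult_left_mono C N) auto
        finally show "\<bar>t N k\<bar> \<le> (\<bar>\<rho>\<bar> * C1 + C2 + \<bar>\<rho>\<bar> * C3) * real N powr (size es / 2 + m)"
          by (simp add: algebra_simps)
      qed
    qed
    then obtain C where C: "\<forall>k\<in>#es'. \<forall>N\<ge>1. \<bar>t N k\<bar> \<le> C k * real N powr (size es / 2 + m)"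
      by (auto dest!: bchoice)
    show ?thesis
    proof (intro exI[of _ "\<Sum>k\<in>#es'. C k"] allI impI)
      fix N :: nat assume N: "N \<ge> 1"
      have "graph_sum N V Q es = (\<Sum>k\<in>#es'. t N k)"
        unfolding add e t_def
        using graph_sum_step[OF V N ab es', where l=True and l'="\<lambda>_. True" and c=fst and d=snd]
        by (simp add: orient_def)
      also have "\<bar>\<dots>\<bar> \<le> (\<Sum>k\<in>#es'. \<bar>t N k\<bar>)"
        by (rule abs_sum_mset_le)
      also have "\<dots> \<le> (\<Sum>k\<in>#es'. C k * real N powr (size es / 2 + m))"
        using C N by (intro sum_mset_mono) blast
      finally show "\<bar>graph_sum N V Q es\<bar> \<le> (\<Sum>k\<in>#es'. C k) * real N powr (size es / 2 + m)"
        by (simp add: sum_mset_distrib_right)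
    qed
  qed
qed

end

subsection \<open>Cycles\<close>

text \<open>In a word, True stands for X and False for the transpose of X, whose edges are traversed backwards.\<close>

fun path_edges :: "'v list \<Rightarrow> bool list \<Rightarrow> ('v \<times> 'v) multiset" where
  "path_edges (u # v # p) (l # w) = add_mset (orient l u v) (path_edges (v # p) w)"
| "path_edges _ _ = {#}"

lemma path_edges_Nil [simp]: "path_edges p [] = {#}"
  by (cases p; cases "tl p") auto

lemma path_edges_Cons:
  "p \<noteq> [] \<Longrightarrow> path_edges (u # p) (l # w) = add_mset (orient l u (hd p)) (path_edges p w)"
  by (cases p) auto

lemma size_path_edges: "length p = Suc (length w) \<Longrightarrow> size (path_edges p w) = length w"
  by (induction p w rule: path_edges.induct) auto

lemma path_edges_subset: "set_mset (path_edges p w) \<subseteq> set p \<times> set p"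
  by (induction p w rule: path_edges.induct) (auto simp: orient_def)

lemma path_edges_append:
  assumes "length p1 = Suc (length w1)" "p2 \<noteq> []"
  shows "path_edges (p1 @ p2) (w1 @ l # w2) =
    add_mset (orient l (last p1) (hd p2)) (path_edges p1 w1 + path_edges p2 w2)"
  using assms
proof (induction w1 arbitrary: p1)
  case Nil
  then obtain u where "p1 = [u]" by (cases p1) auto
  then show ?case using Nil by (simp add: path_edges_Cons)
next
  case (Cons m w1)
  then obtain u p where p1: "p1 = u # p" "length p = Suc (length w1)" by (cases p1) auto
  then have "p \<noteq> []" by auto
  then show ?case using Cons.IH[OF p1(2)] Cons.prems p1 by (simp add: path_edges_Cons)
qed

lemma path_edges_split:
  assumes "length p = Suc (length w)" "i < length w"
  shows "path_edges p w = add_mset (orient (w ! i) (p ! i) (p ! Suc i))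
    (path_edges (take (Suc i) p) (take i w) + path_edges (drop (Suc i) p) (drop (Suc i) w))"
proof -
  have "path_edges (take (Suc i) p @ drop (Suc i) p) (take i w @ w ! i # drop (Suc i) w) =
    add_mset (orient (w ! i) (last (take (Suc i) p)) (hd (drop (Suc i) p)))
    (path_edges (take (Suc i) p) (take i w) + path_edges (drop (Suc i) p) (drop (Suc i) w))"
    by (rule path_edges_append) (use assms in auto)
  moreover have "take i w @ w ! i # drop (Suc i) w = w" using assms by (simp add: id_take_nth_drop[symmetric])
  moreover have "last (take (Suc i) p) = p ! i" using assms by (simp add: take_Suc_conv_app_nth)
  moreover have "hd (drop (Suc i) p) = p ! Suc i" using assms by (simp add: hd_drop_conv_nth)
  ultimately show ?thesis by simp
qed

lemma sum_path_edges:
  assumes "length p = Suc (length w)"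
  shows "(\<Sum>k\<in>#path_edges p w. g k) = (\<Sum>i<length w. g (orient (w ! i) (p ! i) (p ! Suc i)) :: real)"
  using assms
  by (induction p w rule: path_edges.induct) (auto simp: sum.lessThan_Suc_shift simp del: sum.lessThan_Suc)

lemma path_edges_nthE:
  assumes "length p = Suc (length w)" "k \<in># path_edges p w"
  obtains i where "i < length w" "k = orient (w ! i) (p ! i) (p ! Suc i)"
proof -
  have "\<exists>i<length w. k = orient (w ! i) (p ! i) (p ! Suc i)"
    using assms
  proof (induction p w rule: path_edges.induct)
    case (1 u v p l w)
    then consider "k = orient l u v" | "k \<in># path_edges (v # p) w" by auto
    then show ?case
    proof cases
      case 1
      then show ?thesis by (intro exI[of _ 0]) auto
    next
      case 2
      then obtain i where "i < length w" "k = orient (w ! i) ((v # p) ! i) ((v # p) ! Suc i)"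
        using 1 by auto
      then show ?thesis by (intro exI[of _ "Suc i"]) auto
    qed
  qed auto
  then show ?thesis using that by blast
qed

lemma path_connected_hd:
  assumes "length p = Suc (length w)" "v \<in> set p" "set_mset (path_edges p w) \<subseteq> A"
  shows "(v, hd p) \<in> connectivity A"
  using assms
proof (induction p w rule: path_edges.induct)
  case (1 x y p l w)
  have "(x, y) \<in> connectivity A"
    using 1(4) connectivity_base[of x y A] connectivity_sym[OF connectivity_base[of y x A]]
    by (auto simp: orient_def split: if_splits)
  moreover have "v \<in> set (y # p) \<Longrightarrow> (v, y) \<in> connectivity A" using 1 by simp
  ultimately show ?case using 1 by (auto intro: connectivity_trans connectivity_sym)
qed (auto simp: length_Suc_conv)

lemma path_connected:
  assumes "length p = Suc (length w)" "u \<in> set p" "v \<in> set p" "set_mset (path_edges p w) \<subseteq> A"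
  shows "(u, v) \<in> connectivity A"
  using assms path_connected_hd connectivity_sym connectivity_trans by metis

text \<open>A cycle survives the loss of one edge: the two remaining arcs still meet through the
  closing equation between \<open>hd p\<close> and \<open>last p\<close>.\<close>

lemma loop_connected_delete_edge:
  assumes p: "length p = Suc (length w)" and v: "v \<in> set p" and eq: "(hd p, last p) \<in> A"
    and A: "set_mset (path_edges p w - {#k#}) \<subseteq> A"
  shows "(v, hd p) \<in> connectivity A"
proof (cases "k \<in># path_edges p w")
  case False
  then show ?thesis using path_connected_hd[OF p v] A by (simp add: diff_single_trivial)
next
  case True
  then obtain i where i: "i < length w" "k = orient (w ! i) (p ! i) (p ! Suc i)"
    using path_edges_nthE p by metis
  let ?p1 = "take (Suc i) p" and ?w1 = "take i w" and ?p2 = "drop (Suc i) p" and ?w2 = "drop (Suc i) w"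
  have "path_edges p w - {#k#} = path_edges ?p1 ?w1 + path_edges ?p2 ?w2"
    using path_edges_split[OF p i(1)] i by simp
  then have A12: "set_mset (path_edges ?p1 ?w1) \<subseteq> A" "set_mset (path_edges ?p2 ?w2) \<subseteq> A"
    using A by auto
  have len: "length ?p1 = Suc (length ?w1)" "length ?p2 = Suc (length ?w2)" using p i by auto
  have ne: "?p2 \<noteq> []" "p \<noteq> []" using len by auto
  have "set p = set ?p1 \<union> set ?p2" by (metis append_take_drop_id set_append)
  then consider "v \<in> set ?p1" | "v \<in> set ?p2" using v by auto
  then show ?thesis
  proof cases
    case 1
    have "hd ?p1 = hd p" using ne by (cases p) auto
    then show ?thesis using path_connected_hd[OF len(1) 1 A12(1)] by simp
  next
    case 2
    have "last p = last ?p2" using ne by (metis append_take_drop_id last_append)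
    then have "(v, last p) \<in> connectivity A"
      using path_connected[OF len(2) 2 _ A12(2)] ne last_in_set by metis
    then show ?thesis using eq connectivity_base connectivity_sym connectivity_trans by metis
  qed
qed

text \<open>Noncrossing pairings of a word, weighted by \<rho> for every pair of equal letters.  The sum runs over
  the partner of the first letter.\<close>

function nc_weight :: "real \<Rightarrow> bool list \<Rightarrow> real" where
  "nc_weight \<rho> [] = 1"
| "nc_weight \<rho> (l # w) =
     (\<Sum>i<length w. pair_weight \<rho> l (w ! i) * nc_weight \<rho> (take i w) * nc_weight \<rho> (drop (Suc i) w))"
  by pat_completeness auto
termination by (relation "Wellfounded.measure (\<lambda>(\<rho>, w). length w)") auto

text \<open>A word of length n is carried by a path on n + 1 distinct vertices.  It is closed up by the
  constraint that its two ends have the same value, not by a repeated vertex.\<close>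

type_synonym 'v loops = "('v list \<times> bool list) list"

definition loop_verts :: "'v loops \<Rightarrow> 'v set" where
  "loop_verts Ls = set (concat (map fst Ls))"

definition loop_eqs :: "'v loops \<Rightarrow> ('v \<times> 'v) set" where
  "loop_eqs Ls = (\<lambda>(p, w). (hd p, last p)) ` set Ls"

definition loop_edges :: "'v loops \<Rightarrow> ('v \<times> 'v) multiset" where
  "loop_edges Ls = (\<Sum>(p, w)\<leftarrow>Ls. path_edges p w)"

definition valid_loops :: "'v loops \<Rightarrow> bool" where
  "valid_loops Ls \<longleftrightarrow> (\<forall>(p, w)\<in>set Ls. length p = Suc (length w)) \<and> distinct (concat (map fst Ls))"

lemma loop_edges_Cons: "loop_edges ((p, w) # Ls) = path_edges p w + loop_edges Ls"
  by (simp add: loop_edges_def)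

lemma loop_eqs_Cons: "loop_eqs ((p, w) # Ls) = insert (hd p, last p) (loop_eqs Ls)"
  by (simp add: loop_eqs_def)

lemma loop_verts_Cons: "loop_verts ((p, w) # Ls) = set p \<union> loop_verts Ls"
  by (simp add: loop_verts_def)

lemma valid_loops_Cons:
  "valid_loops ((p, w) # Ls) \<longleftrightarrow> length p = Suc (length w) \<and> distinct p \<and>
     set p \<inter> loop_verts Ls = {} \<and> valid_loops Ls"
  by (auto simp: valid_loops_def loop_verts_def)

lemma finite_loop_verts [simp]: "finite (loop_verts Ls)"
  by (simp add: loop_verts_def)

lemma loop_edges_subset: "set_mset (loop_edges Ls) \<subseteq> loop_verts Ls \<times> loop_verts Ls"
proof (induction Ls)
  case Nil
  then show ?case by (simp add: loop_edges_def)
next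
  case (Cons a Ls)
  then show ?case using path_edges_subset[of "fst a" "snd a"]
    by (cases a) (auto simp: loop_edges_Cons loop_verts_Cons)
qed

lemma path_edges_subset_loop_edges: "(p, w) \<in> set Ls \<Longrightarrow> path_edges p w \<subseteq># loop_edges Ls"
  by (induction Ls) (auto simp: loop_edges_Cons subset_mset.add_increasing)

lemma loop_eqs_subset:
  assumes "valid_loops Ls" shows "loop_eqs Ls \<subseteq> loop_verts Ls \<times> loop_verts Ls"
proof -
  have "hd p \<in> set p" "last p \<in> set p" if "(p, w) \<in> set Ls" for p w
  proof -
    have "p \<noteq> []" using assms that by (auto simp: valid_loops_def)
    then show "hd p \<in> set p" "last p \<in> set p" by auto
  qed
  then have "hd p \<in> loop_verts Ls \<and> last p \<in> loop_verts Ls" if "(p, w) \<in> set Ls" for p w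
    using that unfolding loop_verts_def by (force intro: bexI[of _ "(p, w)"])
  then show ?thesis unfolding loop_eqs_def by auto
qed

text \<open>The heads of the loops are the representatives. This is the component count of a
  contraction that has not split any loop.\<close>

lemma covered_loops:
  assumes "valid_loops Ls"
    and "\<And>p w v. (p, w) \<in> set Ls \<Longrightarrow> v \<in> set p \<Longrightarrow> (v, hd p) \<in> connectivity A"
  shows "covered (loop_verts Ls) A (length Ls)"
  unfolding covered_def
proof (intro exI[of _ "set (map (hd \<circ> fst) Ls)"] conjI ballI)
  have ne: "p \<noteq> []" if "(p, w) \<in> set Ls" for p w using assms(1) that by (auto simp: valid_loops_def)
  show "set (map (hd \<circ> fst) Ls) \<subseteq> loop_verts Ls"
  proof
    fix x assume "x \<in> set (map (hd \<circ> fst) Ls)"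
    then obtain p w where pw: "(p, w) \<in> set Ls" "x = hd p" by auto
    then have "x \<in> set p" using ne by auto
    then show "x \<in> loop_verts Ls" using pw(1) by (force simp: loop_verts_def)
  qed
  show "card (set (map (hd \<circ> fst) Ls)) \<le> length Ls"
    using card_length[of "map (hd \<circ> fst) Ls"] by simp
  fix v assume "v \<in> loop_verts Ls"
  then obtain p w where "(p, w) \<in> set Ls" "v \<in> set p" unfolding loop_verts_def by auto
  then show "\<exists>r\<in>set (map (hd \<circ> fst) Ls). (v, r) \<in> connectivity A"
    using assms(2) by (intro bexI[of _ "hd p"]) force+
qed

context wick_functional
begin

text \<open>The vertex \<open>x\<close> carries no edge and its label is dictated by that of
  \<open>u\<close>, so restriction and extension of labellings are inverse to each other.\<close>

lemma graph_sum_delete_vertex: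
  assumes "x \<notin> V" "u \<in> V" "Q \<subseteq> V \<times> V" "set_mset es \<subseteq> V \<times> V"
  shows "graph_sum N (insert x V) (insert (x, u) Q) es = graph_sum N V Q es"
  unfolding graph_sum_def
proof (rule sum.reindex_bij_witness[where j = "\<lambda>f. restrict f V" and i = "\<lambda>f. f(x := f u)"])
  fix f assume f: "f \<in> constrained N (insert x V) (insert (x, u) Q)"
  then have fx: "f x = f u" and fE: "f \<in> insert x V \<rightarrow>\<^sub>E {..<N}" by (auto simp: constrained_def)
  show "(restrict f V)(x := restrict f V u) = f"
    using fx fE assms by (auto simp: fun_eq_iff restrict_def PiE_iff extensional_def)
  show "restrict f V \<in> constrained N V Q"
    using f assms by (fastforce simp: constrained_def)
  have "image_mset (map_prod (restrict f V) (restrict f V)) es = image_mset (map_prod f f) es"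
    using assms by (intro image_mset_cong) auto
  then show "EE N (image_mset (map_prod (restrict f V) (restrict f V)) es) = EE N (image_mset (map_prod f f) es)"
    by simp
next
  fix f assume f: "f \<in> constrained N V Q"
  show "restrict (f(x := f u)) V = f"
    using f assms by (auto simp: fun_eq_iff restrict_def constrained_def PiE_iff extensional_def)
  have "\<forall>(y, z)\<in>insert (x, u) Q. (f(x := f u)) y = (f(x := f u)) z"
  proof safe
    show "(f(x := f u)) x = (f(x := f u)) u" using assms by auto
    fix y z assume yz: "(y, z) \<in> Q"
    then have "y \<noteq> x" "z \<noteq> x" using assms by auto
    then show "(f(x := f u)) y = (f(x := f u)) z" using f yz by (auto simp: constrained_def)
  qed
  then show "f(x := f u) \<in> constrained N (insert x V) (insert (x, u) Q)"
    using f assms by (auto simp: constrained_def PiE_iff extensional_def)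
qed

text \<open>The normalisation exceeds the general bound by exactly one power of N, the amount that a
  contraction loses when it creates no new component.\<close>

lemma graph_sum_negligible:
  assumes "finite V" "set_mset es \<subseteq> V \<times> V" "Q \<subseteq> V \<times> V" "covered V (Q \<union> set_mset es) m"
    and "e = size es / 2 + m + 1"
  shows "(\<lambda>N. graph_sum N V Q es / real N powr e) \<longlonglongrightarrow> 0"
proof -
  obtain C where C: "\<And>N. N \<ge> 1 \<Longrightarrow> \<bar>graph_sum N V Q es\<bar> \<le> C * real N powr (size es / 2 + m)"
    using graph_sum_bound[OF assms(1-4)] by blast
  have "(\<lambda>N. C * inverse (real N)) \<longlonglongrightarrow> C * 0"
    by (intro tendsto_intros LIMSEQ_inverse_real_of_nat[THEN LIMSEQ_imp_Suc])
  then have lim: "(\<lambda>N. C * inverse (real N)) \<longlonglongrightarrow> 0" by simp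
  show ?thesis
  proof (rule Lim_null_comparison[OF _ lim])
    show "\<forall>\<^sub>F N in sequentially. norm (graph_sum N V Q es / real N powr e) \<le> C * inverse (real N)"
      using eventually_ge_at_top[of 1]
    proof eventually_elim
      case (elim N)
      have "norm (graph_sum N V Q es / real N powr e) \<le> C * real N powr (size es / 2 + m) / real N powr e"
        using C[OF elim] elim by (simp add: divide_right_mono)
      also have "\<dots> = C * real N powr (size es / 2 + m - e)" by (simp add: powr_diff)
      also have "\<dots> = C * inverse (real N)" using elim unfolding assms(5) by (simp add: powr_minus)
      finally show ?case .
    qed
  qed
qed

definition loop_sum :: "nat \<Rightarrow> 'v loops \<Rightarrow> real" where
  "loop_sum N Ls = graph_sum N (loop_verts Ls) (loop_eqs Ls) (loop_edges Ls)"

text \<open>The crossing identification splits the first loop in two and makes its first vertex redundant.\<close>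

lemma graph_sum_split_loop:
  assumes "valid_loops ((u # p1 @ p2, l # w1 @ l' # w2) # Ls)" "length p1 = Suc (length w1)"
  shows "graph_sum N (loop_verts ((u # p1 @ p2, l # w1 @ l' # w2) # Ls))
      (loop_eqs ((u # p1 @ p2, l # w1 @ l' # w2) # Ls) \<union> {(u, hd p2), (hd p1, last p1)})
      (path_edges p1 w1 + path_edges p2 w2 + loop_edges Ls) =
    loop_sum N ((p1, w1) # (p2, w2) # Ls)"
proof -
  let ?L = "(p1, w1) # (p2, w2) # Ls"
  have len: "length p2 = Suc (length w2)" and d: "distinct (u # p1 @ p2)"
    "set (u # p1 @ p2) \<inter> loop_verts Ls = {}" and vL: "valid_loops Ls"
    using assms by (auto simp: valid_loops_Cons)
  then have ne: "p2 \<noteq> []" by auto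
  have v: "valid_loops ?L" using assms len d vL by (auto simp: valid_loops_Cons loop_verts_Cons)
  have u: "u \<notin> loop_verts ?L" using d by (auto simp: loop_verts_Cons)
  have V: "loop_verts ((u # p1 @ p2, l # w1 @ l' # w2) # Ls) = insert u (loop_verts ?L)"
    by (auto simp: loop_verts_Cons)
  \<comment> \<open>The old closing equation is u = last p2. Together with u = hd p2 it closes the
    second piece, while hd p1 = last p1 closes the first.\<close>
  have "graph_sum N (insert u (loop_verts ?L))
      (loop_eqs ((u # p1 @ p2, l # w1 @ l' # w2) # Ls) \<union> {(u, hd p2), (hd p1, last p1)}) (loop_edges ?L)
    = graph_sum N (insert u (loop_verts ?L)) (insert (u, hd p2) (loop_eqs ?L)) (loop_edges ?L)"
    by (rule graph_sum_cong) (use ne in \<open>auto simp: loop_eqs_Cons\<close>)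
  also have "\<dots> = loop_sum N ?L"
    unfolding loop_sum_def
    by (rule graph_sum_delete_vertex[OF u])
      (use ne loop_eqs_subset[OF v] loop_edges_subset[of ?L] in \<open>auto simp: loop_verts_Cons\<close>)
  finally show ?thesis unfolding V by (simp add: loop_edges_Cons add_ac)
qed


text \<open>The first edge of some nontrivial loop is contracted with every other edge. For a
  partner in another loop, and for a parallel or diagonal match, all old loops remain connected and
  a factor N is lost. The antiparallel match within the loop splits it and reproduces the recursion
  of \<open>nc_weight\<close>.\<close>

lemma loop_sum_limit:
  assumes "valid_loops Ls"
  shows "(\<lambda>N. loop_sum N Ls / real N powr (size (loop_edges Ls) / 2 + length Ls))
    \<longlonglongrightarrow> (\<Prod>(p, w)\<leftarrow>Ls. nc_weight \<rho> w)"
  using assms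
proof (induction "size (loop_edges Ls)" arbitrary: Ls rule: less_induct)
  case (less Ls0)
  show ?case
  proof (cases "\<forall>(p, w)\<in>set Ls0. w = []")
    case True
    define C where "C = concat (map fst Ls0)"
    have w: "w = []" and p: "hd p = last p" "length p = 1" if "(p, w) \<in> set Ls0" for p w
    proof -
      show "w = []" using True that by auto
      then show "length p = 1" using less.prems that by (auto simp: valid_loops_def)
      then show "hd p = last p" by (cases p) auto
    qed
    have e: "loop_edges Ls0 = {#}"
      using True unfolding loop_edges_def by (induction Ls0) auto
    have "length C = length Ls0"
      unfolding C_def using p(2) by (induction Ls0) (auto, metis One_nat_def Suc_eq_plus1_left add.commute)
    moreover have "distinct C" using less.prems by (simp add: valid_loops_def C_def)
    ultimately have card: "card (loop_verts Ls0) = length Ls0"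
      unfolding loop_verts_def C_def[symmetric] by (simp add: distinct_card)
    have "loop_sum N Ls0 = real N powr (length Ls0)" if "N \<ge> 1" for N
    proof -
      have "loop_sum N Ls0 = graph_sum N (loop_verts Ls0) {} {#}"
        unfolding loop_sum_def e by (rule graph_sum_cong) (use p(1) in \<open>auto simp: loop_eqs_def\<close>)
      also have "\<dots> = real (card (loop_verts Ls0 \<rightarrow>\<^sub>E {..<N}))"
        using that by (simp add: graph_sum_def constrained_def EE_empty)
      also have "\<dots> = real N ^ length Ls0" by (simp add: card_PiE card)
      finally show ?thesis using that by (simp add: powr_realpow)
    qed
    then have "\<forall>\<^sub>F N in sequentially. loop_sum N Ls0 / real N powr (size (loop_edges Ls0) / 2 + length Ls0) = 1"
      by (intro eventually_mono[OF eventually_ge_at_top[of 1]]) (simp add: e)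
    moreover have "(\<Prod>(p, w)\<leftarrow>Ls0. nc_weight \<rho> w) = 1"
      using True by (induction Ls0) auto
    ultimately show ?thesis by (simp add: tendsto_eventually)
  next
    case False
    then obtain p0 w0 where "(p0, w0) \<in> set Ls0" "w0 \<noteq> []" by auto
    then obtain L1 L2 l w where Ls0: "Ls0 = L1 @ (p0, l # w) # L2"
      by (metis neq_Nil_conv split_list)
    have "length p0 = Suc (Suc (length w))" using less.prems Ls0 by (auto simp: valid_loops_def)
    then obtain u p where p0: "p0 = u # p" and lenp: "length p = Suc (length w)" by (cases p0) auto
    \<comment> \<open>The chosen loop is moved to the front; vertices, equations, edges and the
      product of weights do not depend on the order of the loops.\<close>
    define Ls where "Ls = L1 @ L2"
    let ?L = "(u # p, l # w) # Ls"
    let ?V = "loop_verts ?L" and ?Q = "loop_eqs ?L" and ?R = "loop_edges Ls"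
    have valid: "valid_loops ?L"
      using less.prems unfolding Ls0 p0 Ls_def valid_loops_def by auto
    have vLs: "valid_loops Ls" using valid by (simp add: valid_loops_Cons)
    have eq: "loop_verts Ls0 = ?V" "loop_eqs Ls0 = ?Q" "loop_edges Ls0 = loop_edges ?L"
      unfolding Ls0 p0 Ls_def by (auto simp: loop_verts_def loop_eqs_def loop_edges_def)
    have len_eq: "length Ls0 = length ?L" unfolding Ls0 Ls_def by simp
    have prod_eq: "(\<Prod>(p, w)\<leftarrow>Ls0. nc_weight \<rho> w) = (\<Prod>(p, w)\<leftarrow>?L. nc_weight \<rho> w)"
      unfolding Ls0 Ls_def by simp
    define P where "P = (\<Prod>(p, w)\<leftarrow>Ls. nc_weight \<rho> w)"
    define es where "es = path_edges p w + ?R"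
    define e where "e = size (loop_edges ?L) / 2 + real (length ?L)"
    have pne: "p \<noteq> []" using lenp by auto
    have edges: "loop_edges ?L = add_mset (orient l u (hd p)) es"
      using pne by (simp add: loop_edges_Cons path_edges_Cons es_def)
    have V: "finite ?V" "u \<in> ?V" "hd p \<in> ?V" "set_mset es \<subseteq> ?V \<times> ?V"
      using loop_edges_subset[of ?L] pne by (auto simp: loop_verts_Cons edges)
    have Q: "?Q \<subseteq> ?V \<times> ?V" by (rule loop_eqs_subset[OF valid])
    have pV: "set p \<subseteq> ?V" by (auto simp: loop_verts_Cons)
    define t where "t N k =
      pair_weight \<rho> l True * graph_sum N ?V (?Q \<union> {(u, snd k), (hd p, fst k)}) (es - {#k#})
      + pair_weight \<rho> l False * graph_sum N ?V (?Q \<union> {(u, fst k), (hd p, snd k)}) (es - {#k#})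
      - \<rho> * graph_sum N ?V (?Q \<union> {(u, hd p), (u, fst k), (u, snd k)}) (es - {#k#})" for N k
    \<comment> \<open>\<open>t\<close> reads every edge as it is stored. Reading it along the walk
      instead at most exchanges the first two terms, since the diagonal term is symmetric in the end
      points.\<close>
    have t_orient: "t N (orient l' c d) =
      pair_weight \<rho> l l' * graph_sum N ?V (?Q \<union> {(u, d), (hd p, c)}) (es - {#orient l' c d#})
      + pair_weight \<rho> l (\<not> l') * graph_sum N ?V (?Q \<union> {(u, c), (hd p, d)}) (es - {#orient l' c d#})
      - \<rho> * graph_sum N ?V (?Q \<union> {(u, hd p), (u, c), (u, d)}) (es - {#orient l' c d#})" for N l' c d
    proof (cases l')
      case True
      then show ?thesis unfolding t_def orient_def by simp
    next
      case False
      have "{(u, hd p), (u, d), (u, c)} = {(u, hd p), (u, c), (u, d)}" by auto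
      then show ?thesis using False unfolding t_def orient_def by simp
    qed
    \<comment> \<open>A surviving term needs one component more than there are old loops, because
      the two deleted edges lower the exponent by one.\<close>
    have negl: "(\<lambda>N. graph_sum N ?V (?Q \<union> Q') (es - {#k#}) / real N powr e) \<longlonglongrightarrow> 0"
      if k: "k \<in># es" and Q': "Q' \<subseteq> ?V \<times> ?V"
        and con: "\<And>p' w' v. (p', w') \<in> set ?L \<Longrightarrow> v \<in> set p' \<Longrightarrow>
          (v, hd p') \<in> connectivity (?Q \<union> Q' \<union> set_mset (es - {#k#}))" for k Q'
    proof (rule graph_sum_negligible)
      show "covered ?V (?Q \<union> Q' \<union> set_mset (es - {#k#})) (length ?L)"
        by (rule covered_loops[OF valid con])
      have "size es = Suc (size (es - {#k#}))" using k by (metis insert_DiffM size_add_mset)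
      then show "e = size (es - {#k#}) / 2 + length ?L + 1"
        unfolding e_def edges by simp
    qed (use V Q Q' in \<open>auto dest: in_diffD\<close>)
    \<comment> \<open>Each of the two loops involved loses a single edge and stays connected,
      whatever is identified; hence \<open>con\<close> for arbitrary \<open>Q'\<close>.\<close>
    have lim_R: "(\<lambda>N. t N k / real N powr e) \<longlonglongrightarrow> 0" if k: "k \<in># ?R" for k
    proof -
      have kes: "k \<in># es" using k by (simp add: es_def)
      have kV: "fst k \<in> ?V" "snd k \<in> ?V" using V(4) kes by auto
      have con: "(v, hd p') \<in> connectivity (?Q \<union> Q' \<union> set_mset (es - {#k#}))"
        if pw: "(p', w') \<in> set ?L" and v: "v \<in> set p'" for p' w' v Q'
      proof -
        have eq': "(hd p', last p') \<in> ?Q" using pw by (force simp: loop_eqs_def)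
        have len': "length p' = Suc (length w')" using valid pw by (auto simp: valid_loops_def)
        have "\<exists>k'. set_mset (path_edges p' w' - {#k'#}) \<subseteq> set_mset (es - {#k#})"
        proof (cases "(p', w') \<in> set Ls")
          case True
          then have "path_edges p' w' - {#k#} \<subseteq># ?R - {#k#}"
            using path_edges_subset_loop_edges[OF True] by (simp add: subseteq_mset_def diff_le_mono)
          moreover have "?R - {#k#} \<subseteq># es - {#k#}"
            unfolding es_def by (simp add: subseteq_mset_def diff_le_mono)
          ultimately show ?thesis by (meson set_mset_mono subset_mset.order_trans)
        next
          case False
          then have "p' = u # p" "w' = l # w" using pw by auto
          then have "path_edges p' w' - {#orient l u (hd p)#} = path_edges p w"
            using pne by (simp add: path_edges_Cons)
          moreover have "path_edges p w \<subseteq># es - {#k#}"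
            unfolding es_def diff_union_single_conv[OF k] by simp
          ultimately show ?thesis by (metis set_mset_mono)
        qed
        then obtain k' where "set_mset (path_edges p' w' - {#k'#}) \<subseteq> set_mset (es - {#k#})" by blast
        then show ?thesis by (intro loop_connected_delete_edge[OF len' v]) (use eq' in auto)
      qed
      have "(\<lambda>N. pair_weight \<rho> l True * (graph_sum N ?V (?Q \<union> {(u, snd k), (hd p, fst k)}) (es - {#k#}) / real N powr e)
        + pair_weight \<rho> l False * (graph_sum N ?V (?Q \<union> {(u, fst k), (hd p, snd k)}) (es - {#k#}) / real N powr e)
        - \<rho> * (graph_sum N ?V (?Q \<union> {(u, hd p), (u, fst k), (u, snd k)}) (es - {#k#}) / real N powr e))
        \<longlonglongrightarrow> pair_weight \<rho> l True * 0 + pair_weight \<rho> l False * 0 - \<rho> * 0"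
        by (intro tendsto_intros negl kes con) (use V kV in auto)
      then show ?thesis by (simp add: t_def add_divide_distrib diff_divide_distrib)
    qed
    have lim_p: "(\<lambda>N. t N (orient (w ! i) (p ! i) (p ! Suc i)) / real N powr e) \<longlonglongrightarrow>
        pair_weight \<rho> l (w ! i) * nc_weight \<rho> (take i w) * nc_weight \<rho> (drop (Suc i) w) * P"
      if i: "i < length w" for i
    proof -
      define k where "k = orient (w ! i) (p ! i) (p ! Suc i)"
      define p1 w1 p2 w2 where pw: "p1 = take (Suc i) p" "w1 = take i w" "p2 = drop (Suc i) p" "w2 = drop (Suc i) w"
      have len: "length p1 = Suc (length w1)" "length p2 = Suc (length w2)" using lenp i by (auto simp: pw)
      have p12: "p = p1 @ p2" by (simp add: pw)
      have w12: "w = w1 @ w ! i # w2" using i by (simp add: pw id_take_nth_drop[symmetric])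
      have ne: "p1 \<noteq> []" "p2 \<noteq> []" using len by auto
      have c: "p ! i = last p1" using i lenp by (simp add: pw take_Suc_conv_app_nth)
      have d: "p ! Suc i = hd p2" using i lenp by (simp add: pw hd_drop_conv_nth)
      have b: "hd p = hd p1" using p12 ne by simp
      have split: "path_edges p w = add_mset k (path_edges p1 w1 + path_edges p2 w2)"
        using path_edges_split[OF lenp i] unfolding pw k_def .
      then have kes: "k \<in># es" and esk: "es - {#k#} = path_edges p1 w1 + path_edges p2 w2 + ?R"
        by (auto simp: es_def)
      have vert: "last p1 \<in> ?V" "hd p2 \<in> ?V" "hd p1 \<in> ?V"
        using ne pV unfolding p12 by auto
      \<comment> \<open>Deleting both edges leaves the pieces \<open>u\<close>, \<open>p1\<close>
        and \<open>p2\<close>, which \<open>Q'\<close> has to tie together. The extra pair (last p1,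
        hd p1) may be used because \<open>p1\<close> is still an unbroken path.\<close>
      have con: "(v, hd p') \<in> connectivity (?Q \<union> Q' \<union> set_mset (es - {#k#}))"
        if pw: "(p', w') \<in> set ?L" and v: "v \<in> set p'"
          and Q': "(hd p2, hd p1) \<in> connectivity Q'" "(hd p1, u) \<in> connectivity (Q' \<union> {(last p1, hd p1)})"
        for p' w' v Q'
      proof (cases "(p', w') \<in> set Ls")
        case True
        have "length p' = Suc (length w')" using valid pw by (auto simp: valid_loops_def)
        moreover have "set_mset (path_edges p' w') \<subseteq> ?Q \<union> Q' \<union> set_mset (es - {#k#})"
          using path_edges_subset_loop_edges[OF True] unfolding esk by (auto dest: mset_subset_eqD)
        ultimately show ?thesis by (rule path_connected_hd[OF _ v])
      next
        case False
        let ?A = "?Q \<union> Q' \<union> set_mset (es - {#k#})"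
        have p': "p' = u # p" using pw False by auto
        have A: "set_mset (path_edges p1 w1) \<subseteq> ?A" "set_mset (path_edges p2 w2) \<subseteq> ?A"
          unfolding esk by auto
        have l1: "(last p1, hd p1) \<in> connectivity ?A"
          using path_connected_hd[OF len(1) _ A(1)] ne by simp
        have Q'A: "connectivity Q' \<subseteq> connectivity ?A" by (rule connectivity_mono) auto
        have "Q' \<union> {(last p1, hd p1)} \<subseteq> connectivity ?A"
          using l1 by (auto intro: connectivity_base)
        then have h1: "(hd p1, u) \<in> connectivity ?A" using Q'(2) connectivity_le by blast
        have h2: "(hd p2, hd p1) \<in> connectivity ?A" using Q'A Q'(1) by blast
        have "v = u \<or> v \<in> set p1 \<or> v \<in> set p2" using v p' p12 by auto
        then show ?thesis
          using path_connected_hd[OF len(1) _ A(1), of v] path_connected_hd[OF len(2) _ A(2), of v] h1 h2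
            connectivity_trans p' by (metis connectivity_refl list.sel(1))
      qed
      \<comment> \<open>The parallel match glues \<open>p1\<close> to \<open>p2\<close> at their
        heads and \<open>u\<close> to the far end of \<open>p1\<close>, so nothing is
        separated.\<close>
      have n1: "(\<lambda>N. graph_sum N ?V (?Q \<union> {(u, last p1), (hd p, hd p2)}) (es - {#k#}) / real N powr e) \<longlonglongrightarrow> 0"
      proof (rule negl[OF kes])
        show "{(u, last p1), (hd p, hd p2)} \<subseteq> ?V \<times> ?V" using vert V b by auto
        fix p' w' v assume "(p', w') \<in> set ?L" "v \<in> set p'"
        then show "(v, hd p') \<in> connectivity (?Q \<union> {(u, last p1), (hd p, hd p2)} \<union> set_mset (es - {#k#}))"
        proof (rule con)
          show "(hd p2, hd p1) \<in> connectivity {(u, last p1), (hd p, hd p2)}"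
            unfolding b by (intro connectivity_sym[OF connectivity_base]) auto
          have "(hd p1, last p1) \<in> connectivity ({(u, last p1), (hd p, hd p2)} \<union> {(last p1, hd p1)})"
            by (intro connectivity_sym[OF connectivity_base]) auto
          moreover have "(last p1, u) \<in> connectivity ({(u, last p1), (hd p, hd p2)} \<union> {(last p1, hd p1)})"
            by (intro connectivity_sym[OF connectivity_base]) auto
          ultimately show "(hd p1, u) \<in> connectivity ({(u, last p1), (hd p, hd p2)} \<union> {(last p1, hd p1)})"
            by (rule connectivity_trans)
        qed
      qed
      have n2: "(\<lambda>N. graph_sum N ?V (?Q \<union> {(u, hd p), (u, last p1), (u, hd p2)}) (es - {#k#}) / real N powr e) \<longlonglongrightarrow> 0"
      proof (rule negl[OF kes])
        show "{(u, hd p), (u, last p1), (u, hd p2)} \<subseteq> ?V \<times> ?V" using vert V b by auto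
        fix p' w' v assume "(p', w') \<in> set ?L" "v \<in> set p'"
        then show "(v, hd p') \<in> connectivity (?Q \<union> {(u, hd p), (u, last p1), (u, hd p2)} \<union> set_mset (es - {#k#}))"
        proof (rule con)
          have "(hd p2, u) \<in> connectivity {(u, hd p), (u, last p1), (u, hd p2)}"
            by (intro connectivity_sym[OF connectivity_base]) auto
          moreover have "(u, hd p1) \<in> connectivity {(u, hd p), (u, last p1), (u, hd p2)}"
            unfolding b by (intro connectivity_base) auto
          ultimately show "(hd p2, hd p1) \<in> connectivity {(u, hd p), (u, last p1), (u, hd p2)}"
            by (rule connectivity_trans)
          show "(hd p1, u) \<in> connectivity ({(u, hd p), (u, last p1), (u, hd p2)} \<union> {(last p1, hd p1)})"
            unfolding b by (intro connectivity_sym[OF connectivity_base]) auto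
        qed
      qed
      let ?L' = "(p1, w1) # (p2, w2) # Ls"
      have vL': "valid_loops ((u # p1 @ p2, l # w1 @ w ! i # w2) # Ls)"
        using valid p12 w12 by simp
      \<comment> \<open>The antiparallel match closes \<open>p1\<close> and \<open>p2\<close>
        separately: one loop more and two edges fewer, so the exponent \<open>e\<close> is
        unchanged.\<close>
      have split_eq: "graph_sum N ?V (?Q \<union> {(u, hd p2), (hd p, last p1)}) (es - {#k#}) = loop_sum N ?L'" for N
        using graph_sum_split_loop[OF vL' len(1)] unfolding b esk p12[symmetric] w12[symmetric] .
      have valid': "valid_loops ?L'"
        using vL' len by (auto simp: valid_loops_Cons loop_verts_Cons)
      have size': "size (loop_edges ?L) = size (loop_edges ?L') + 2"
        unfolding edges es_def split by (simp add: loop_edges_Cons)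
      have e': "e = size (loop_edges ?L') / 2 + length ?L'"
        unfolding e_def size' by simp
      have "size (loop_edges ?L') < size (loop_edges Ls0)" unfolding eq size' by simp
      then have "(\<lambda>N. loop_sum N ?L' / real N powr e) \<longlonglongrightarrow> (\<Prod>(p, w)\<leftarrow>?L'. nc_weight \<rho> w)"
        unfolding e' using less.hyps valid' by blast
      then have main: "(\<lambda>N. graph_sum N ?V (?Q \<union> {(u, hd p2), (hd p, last p1)}) (es - {#k#}) / real N powr e)
          \<longlonglongrightarrow> nc_weight \<rho> w1 * (nc_weight \<rho> w2 * P)"
        unfolding split_eq P_def by simp
      note tk = t_orient[of _ "w ! i" "p ! i" "p ! Suc i", folded k_def, unfolded c d]
      have "(\<lambda>N. pair_weight \<rho> l (w ! i) * (graph_sum N ?V (?Q \<union> {(u, hd p2), (hd p, last p1)}) (es - {#k#}) / real N powr e)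
        + pair_weight \<rho> l (\<not> w ! i) * (graph_sum N ?V (?Q \<union> {(u, last p1), (hd p, hd p2)}) (es - {#k#}) / real N powr e)
        - \<rho> * (graph_sum N ?V (?Q \<union> {(u, hd p), (u, last p1), (u, hd p2)}) (es - {#k#}) / real N powr e))
        \<longlonglongrightarrow> pair_weight \<rho> l (w ! i) * (nc_weight \<rho> w1 * (nc_weight \<rho> w2 * P)) + pair_weight \<rho> l (\<not> w ! i) * 0 - \<rho> * 0"
        by (intro tendsto_intros main n1 n2)
      then show ?thesis
        unfolding k_def[symmetric] tk unfolding pw[symmetric]
        by (simp add: add_divide_distrib diff_divide_distrib mult.assoc)
    qed
    have eq_sum: "loop_sum N Ls0 / real N powr e =
        (\<Sum>i<length w. t N (orient (w ! i) (p ! i) (p ! Suc i)) / real N powr e) + (\<Sum>k\<in>#?R. t N k / real N powr e)"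
      if "N \<ge> 1" for N
    proof -
      have "loop_sum N Ls0 = graph_sum N ?V ?Q (add_mset (orient l u (hd p)) es)"
        unfolding loop_sum_def eq edges ..
      also have "\<dots> = (\<Sum>k\<in>#es. t N k)"
        unfolding t_def
        using graph_sum_step[OF V(1) that V(2-4), where l=l and l'="\<lambda>_. True" and c=fst and d=snd]
        by (simp add: orient_def)
      also have "\<dots> = (\<Sum>i<length w. t N (orient (w ! i) (p ! i) (p ! Suc i))) + (\<Sum>k\<in>#?R. t N k)"
        unfolding es_def by (simp add: sum_path_edges[OF lenp])
      finally show ?thesis
        by (simp add: add_divide_distrib sum_divide_distrib) (simp add: divide_inverse sum_mset_distrib_right)
    qed
    have R0: "(\<lambda>N. \<Sum>k\<in>#M. t N k / real N powr e) \<longlonglongrightarrow> 0" if "set_mset M \<subseteq> set_mset ?R" for M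
      using that
    proof (induction M)
      case (add k M)
      then show ?case using tendsto_add[OF lim_R[of k], of "\<lambda>N. \<Sum>k\<in>#M. t N k / real N powr e" 0] by simp
    qed simp
    have "(\<lambda>N. (\<Sum>i<length w. t N (orient (w ! i) (p ! i) (p ! Suc i)) / real N powr e) + (\<Sum>k\<in>#?R. t N k / real N powr e))
      \<longlonglongrightarrow> (\<Sum>i<length w. pair_weight \<rho> l (w ! i) * nc_weight \<rho> (take i w) * nc_weight \<rho> (drop (Suc i) w) * P) + 0"
      by (intro tendsto_add tendsto_sum lim_p R0) auto
    also have "(\<Sum>i<length w. pair_weight \<rho> l (w ! i) * nc_weight \<rho> (take i w) * nc_weight \<rho> (drop (Suc i) w) * P) + 0
      = (\<Prod>(p, w)\<leftarrow>Ls0. nc_weight \<rho> w)"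
      unfolding prod_eq by (simp add: sum_distrib_right P_def)
    finally have "(\<lambda>N. loop_sum N Ls0 / real N powr e) \<longlonglongrightarrow> (\<Prod>(p, w)\<leftarrow>Ls0. nc_weight \<rho> w)"
      by (rule Lim_transform_eventually)
        (rule eventually_mono[OF eventually_ge_at_top[of 1]], simp add: eq_sum)
    then show ?thesis unfolding e_def eq len_eq .
  qed
qed

end

subsection \<open>The polynomials U and V\<close>

lemma sum_even_odd_split:
  "(\<Sum>j\<le>k. f j) = (\<Sum>i | 2 * i \<le> k. f (2 * i)) + (\<Sum>i | 2 * i + 1 \<le> k. f (2 * i + 1))"
  for f :: "nat \<Rightarrow> 'a::comm_monoid_add"
proof -
  have fin: "finite {i. 2 * i \<le> k}" "finite {i. 2 * i + 1 \<le> k}"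
    by (rule finite_subset[of _ "{..k}"]; auto)+
  have "{..k} = (\<lambda>i. 2 * i) ` {i. 2 * i \<le> k} \<union> (\<lambda>i. 2 * i + 1) ` {i. 2 * i + 1 \<le> k}"
  proof (intro equalityI subsetI)
    fix x assume "x \<in> {..k}"
    then show "x \<in> (\<lambda>i. 2 * i) ` {i. 2 * i \<le> k} \<union> (\<lambda>i. 2 * i + 1) ` {i. 2 * i + 1 \<le> k}"
      by (cases "even x") (auto elim!: evenE oddE)
  qed auto
  then have "(\<Sum>j\<le>k. f j) = sum f ((\<lambda>i. 2 * i) ` {i. 2 * i \<le> k}) + sum f ((\<lambda>i. 2 * i + 1) ` {i. 2 * i + 1 \<le> k})"
    using fin by (simp only:) (rule sum.union_disjoint, auto, presburger)
  then show ?thesis by (simp add: sum.reindex inj_on_def)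
qed

declare U_poly.simps(2) [simp del] V_poly.simps(2) [simp del]

text \<open>Indexed by the degree j of the factor V, the two sums of the recurrence become the odd
  and the even terms of a single convolution. Both the noncrossing recursion and the generating
  functions take this form.\<close>

lemma poly_U_Suc:
  "poly (U_poly (Suc k)) \<rho> =
    (\<Sum>j\<le>k. (if even j then \<rho> else 1) * poly (V_poly j) \<rho> * poly (U_poly (k - j)) \<rho>)"
proof -
  have "(\<Sum>i | 2 * i + 1 \<le> k. poly (U_poly (k - 2 * i - 1)) \<rho> * poly (V_poly (2 * i + 1)) \<rho>) =
     (\<Sum>i | 2 * i + 1 \<le> k. (if even (2 * i + 1) then \<rho> else 1) * poly (V_poly (2 * i + 1)) \<rho> * poly (U_poly (k - (2 * i + 1))) \<rho>)"
    by (intro sum.cong refl) simp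
  moreover have "\<rho> * (\<Sum>i | 2 * i \<le> k. poly (V_poly (2 * i)) \<rho> * poly (U_poly (k - 2 * i)) \<rho>) =
     (\<Sum>i | 2 * i \<le> k. (if even (2 * i) then \<rho> else 1) * poly (V_poly (2 * i)) \<rho> * poly (U_poly (k - 2 * i)) \<rho>)"
    unfolding sum_distrib_left by (intro sum.cong refl) simp
  moreover have "poly (U_poly (Suc k)) \<rho> = (\<Sum>i | 2 * i + 1 \<le> k. poly (U_poly (k - 2 * i - 1)) \<rho> * poly (V_poly (2 * i + 1)) \<rho>) +
     \<rho> * (\<Sum>i | 2 * i \<le> k. poly (V_poly (2 * i)) \<rho> * poly (U_poly (k - 2 * i)) \<rho>)"
    unfolding U_poly.simps(2) poly_add poly_mult poly_sum by simp
  ultimately show ?thesis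
    unfolding sum_even_odd_split by (simp only: add.commute)
qed

lemma poly_V_Suc:
  "poly (V_poly (Suc k)) \<rho> =
    (\<Sum>j\<le>k. (if even j then 1 else \<rho>) * poly (U_poly j) \<rho> * poly (V_poly (k - j)) \<rho>)"
proof -
  have "(\<Sum>i | 2 * i \<le> k. poly (U_poly (2 * i)) \<rho> * poly (V_poly (k - 2 * i)) \<rho>) =
     (\<Sum>i | 2 * i \<le> k. (if even (2 * i) then 1 else \<rho>) * poly (U_poly (2 * i)) \<rho> * poly (V_poly (k - 2 * i)) \<rho>)"
    by (intro sum.cong refl) simp
  moreover have "\<rho> * (\<Sum>i | 2 * i + 1 \<le> k. poly (U_poly (2 * i + 1)) \<rho> * poly (V_poly (k - 2 * i - 1)) \<rho>) =
     (\<Sum>i | 2 * i + 1 \<le> k. (if even (2 * i + 1) then 1 else \<rho>) * poly (U_poly (2 * i + 1)) \<rho> * poly (V_poly (k - (2 * i + 1))) \<rho>)"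
    unfolding sum_distrib_left by (intro sum.cong refl) simp
  moreover have "poly (V_poly (Suc k)) \<rho> = (\<Sum>i | 2 * i \<le> k. poly (U_poly (2 * i)) \<rho> * poly (V_poly (k - 2 * i)) \<rho>) +
     \<rho> * (\<Sum>i | 2 * i + 1 \<le> k. poly (U_poly (2 * i + 1)) \<rho> * poly (V_poly (k - 2 * i - 1)) \<rho>)"
    unfolding V_poly.simps(2) poly_add poly_mult poly_sum by simp
  ultimately show ?thesis
    unfolding sum_even_odd_split by (simp only: add.commute)
qed


section \<open>The words of the traces and their noncrossing pairings\<close>

fun block_word :: "bool \<Rightarrow> nat \<Rightarrow> bool list" where
  "block_word b 0 = []"
| "block_word b (Suc n) = b # b # block_word (\<not> b) n"

text \<open>The alternating block pattern read from the second letter of a block: such words appear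
  between the first letter of a block word and its partner.\<close>

fun shifted_word :: "bool \<Rightarrow> nat \<Rightarrow> bool list" where
  "shifted_word b 0 = []"
| "shifted_word b (Suc n) = b # (\<not> b) # shifted_word (\<not> b) n"

lemma length_block_word [simp]: "length (block_word b n) = 2 * n"
  by (induction b n rule: block_word.induct) auto

lemma length_shifted_word [simp]: "length (shifted_word b n) = 2 * n"
  by (induction b n rule: shifted_word.induct) auto

text \<open>The left side is a block word without its first letter. Its letter at position 2 j, a
  possible partner of that first letter, encloses a shifted word and leaves a block word behind. It
  equals \<open>b\<close> exactly for even j, which is where the factor \<rho> in the recurrence of
  U comes from.\<close>

lemma block_word_split:
  "j \<le> n \<Longrightarrow> b # block_word (\<not> b) n =
    shifted_word b j @ (b = even j) # block_word (b \<noteq> even j) (n - j)"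
proof (induction j arbitrary: b n)
  case (Suc j)
  then obtain m where "n = Suc m" "j \<le> m" by (cases n) auto
  then show ?case using Suc.IH[of m "\<not> b"] by (cases b; cases "even j") auto
qed auto

lemma shifted_word_split:
  "j \<le> n \<Longrightarrow> b # shifted_word b n =
    block_word b j @ (b = even j) # shifted_word (b = even j) (n - j)"
proof (induction j arbitrary: b n)
  case (Suc j)
  then obtain m where "n = Suc m" "j \<le> m" by (cases n) auto
  then show ?case using Suc.IH[of m "\<not> b"] by (cases b; cases "even j") auto
qed auto

text \<open>Without the first letter and its partner an odd word falls into two pieces, exactly one
  of which is odd again.\<close>

lemma nc_weight_odd: "odd (length w) \<Longrightarrow> nc_weight \<rho> w = 0"
proof (induction "length w" arbitrary: w rule: less_induct)
  case (less w)
  then obtain l v where w: "w = l # v" by (cases w) auto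
  have "nc_weight \<rho> (take i v) = 0 \<or> nc_weight \<rho> (drop (Suc i) v) = 0" if "i < length v" for i
  proof (cases "odd i")
    case True
    then have "nc_weight \<rho> (take i v) = 0" using that w by (intro less.hyps) auto
    then show ?thesis ..
  next
    case False
    then have "nc_weight \<rho> (drop (Suc i) v) = 0" using that w less.prems by (intro less.hyps) auto
    then show ?thesis ..
  qed
  then show ?case unfolding w by (auto intro!: sum.neutral)
qed

lemma nc_weight_Cons_odd:
  assumes "length w = 2 * n + 1"
  shows "nc_weight \<rho> (l # w) =
    (\<Sum>j\<le>n. pair_weight \<rho> l (w ! (2 * j)) * nc_weight \<rho> (take (2 * j) w) * nc_weight \<rho> (drop (Suc (2 * j)) w))"
proof -
  define f where "f i = pair_weight \<rho> l (w ! i) * nc_weight \<rho> (take i w) * nc_weight \<rho> (drop (Suc i) w)" for i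
  have "nc_weight \<rho> (l # w) = (\<Sum>i\<le>2 * n. f i)"
    using assms by (simp add: f_def lessThan_Suc_atMost)
  also have "\<dots> = (\<Sum>i | 2 * i \<le> 2 * n. f (2 * i)) + (\<Sum>i | 2 * i + 1 \<le> 2 * n. f (2 * i + 1))"
    by (rule sum_even_odd_split)
  also have "(\<Sum>i | 2 * i + 1 \<le> 2 * n. f (2 * i + 1)) = 0"
    using assms by (intro sum.neutral) (auto simp: f_def nc_weight_odd)
  finally show ?thesis by (simp add: f_def atMost_def)
qed

text \<open>The weights only compare letters, so the initial letter \<open>b\<close> does not
  matter. In a block word the partner of the first letter encloses a shifted word, in a shifted word
  it encloses a block word; therefore both families are treated in one induction.\<close>

lemma nc_weight_words:
  "nc_weight \<rho> (block_word b n) = poly (U_poly n) \<rho> \<and> nc_weight \<rho> (shifted_word b n) = poly (V_poly n) \<rho>"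
proof (induction n arbitrary: b rule: less_induct)
  case (less n b)
  show ?case
  proof (cases n)
    case 0
    then show ?thesis by simp
  next
    case (Suc m)
    have IH: "nc_weight \<rho> (block_word b j) = poly (U_poly j) \<rho>"
      "nc_weight \<rho> (shifted_word b j) = poly (V_poly j) \<rho>" if "j \<le> m" for b j
      using less.IH[of j] that Suc by auto
    have "nc_weight \<rho> (block_word b n) =
      (\<Sum>j\<le>m. (if even j then \<rho> else 1) * poly (V_poly j) \<rho> * poly (U_poly (m - j)) \<rho>)"
      unfolding Suc block_word.simps
    proof (subst nc_weight_Cons_odd[where n=m])
      let ?w = "b # block_word (\<not> b) m"
      show "length ?w = 2 * m + 1" by simp
      have "pair_weight \<rho> b (?w ! (2 * j)) * nc_weight \<rho> (take (2 * j) ?w) * nc_weight \<rho> (drop (Suc (2 * j)) ?w)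
        = (if even j then \<rho> else 1) * poly (V_poly j) \<rho> * poly (U_poly (m - j)) \<rho>" if "j \<le> m" for j
        unfolding block_word_split[OF that]
        using that IH by (auto simp: nth_append pair_weight_def)
      then show "(\<Sum>j\<le>m. pair_weight \<rho> b (?w ! (2 * j)) * nc_weight \<rho> (take (2 * j) ?w) * nc_weight \<rho> (drop (Suc (2 * j)) ?w))
        = (\<Sum>j\<le>m. (if even j then \<rho> else 1) * poly (V_poly j) \<rho> * poly (U_poly (m - j)) \<rho>)"
        by (intro sum.cong) auto
    qed
    moreover have "nc_weight \<rho> (shifted_word b n) =
      (\<Sum>j\<le>m. (if even j then 1 else \<rho>) * poly (U_poly j) \<rho> * poly (V_poly (m - j)) \<rho>)"
      unfolding Suc shifted_word.simps
    proof (subst nc_weight_Cons_odd[where n=m])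
      let ?w = "(\<not> b) # shifted_word (\<not> b) m"
      show "length ?w = 2 * m + 1" by simp
      have "pair_weight \<rho> b (?w ! (2 * j)) * nc_weight \<rho> (take (2 * j) ?w) * nc_weight \<rho> (drop (Suc (2 * j)) ?w)
        = (if even j then 1 else \<rho>) * poly (U_poly j) \<rho> * poly (V_poly (m - j)) \<rho>" if "j \<le> m" for j
        unfolding shifted_word_split[OF that]
        using that IH by (auto simp: nth_append pair_weight_def)
      then show "(\<Sum>j\<le>m. pair_weight \<rho> b (?w ! (2 * j)) * nc_weight \<rho> (take (2 * j) ?w) * nc_weight \<rho> (drop (Suc (2 * j)) ?w))
        = (\<Sum>j\<le>m. (if even j then 1 else \<rho>) * poly (U_poly j) \<rho> * poly (V_poly (m - j)) \<rho>)"
        by (intro sum.cong) auto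
    qed
    ultimately show ?thesis unfolding Suc poly_U_Suc poly_V_Suc by simp
  qed
qed

section \<open>Growth of the coefficients\<close>

lemma sum_convolution_le:
  fixes a b :: "nat \<Rightarrow> real"
  assumes "\<And>i. a i \<ge> 0" "\<And>i. b i \<ge> 0"
  shows "(\<Sum>k\<le>n. \<Sum>j\<le>k. a j * b (k - j)) \<le> (\<Sum>k\<le>n. a k) * (\<Sum>k\<le>n. b k)"
proof -
  have "(\<Sum>k\<le>n. \<Sum>j\<le>k. a j * b (k - j)) = (\<Sum>(i, j)\<in>{(i, j). i + j \<le> n}. a i * b j)"
    by (rule sum.triangle_reindex_eq[symmetric])
  also have "\<dots> \<le> (\<Sum>(i, j)\<in>{..n} \<times> {..n}. a i * b j)"
    using assms by (intro sum_mono2) auto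
  also have "\<dots> = (\<Sum>k\<le>n. a k) * (\<Sum>k\<le>n. b k)"
    by (simp add: sum_product sum.cartesian_product)
  finally show ?thesis .
qed

text \<open>The constants reflect the growth of the Catalan numbers: the generating function at 1/4 is bounded by
  the solution 2 of x = 1 + x^2 / 4.\<close>

lemma sum_UV_le:
  fixes \<rho> :: real
  assumes "\<bar>\<rho>\<bar> \<le> 1"
  shows "(\<Sum>k\<le>n. \<bar>poly (U_poly k) \<rho>\<bar> / 4 ^ k) \<le> 2 \<and> (\<Sum>k\<le>n. \<bar>poly (V_poly k) \<rho>\<bar> / 4 ^ k) \<le> 2"
proof (induction n)
  case (Suc n)
  define u where "u k = \<bar>poly (U_poly k) \<rho>\<bar> / 4 ^ k" for k
  define v where "v k = \<bar>poly (V_poly k) \<rho>\<bar> / 4 ^ k" for k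
  have nonneg: "u k \<ge> 0" "v k \<ge> 0" for k by (auto simp: u_def v_def)
  have step: "(\<Sum>k\<le>Suc n. f k) \<le> 2"
    if "f 0 = 1" "\<And>k. f (Suc k) \<le> (\<Sum>j\<le>k. g j * h (k - j)) / 4" and "\<And>k. g k \<ge> 0" "\<And>k. h k \<ge> 0"
      and "(\<Sum>k\<le>n. g k) \<le> 2" "(\<Sum>k\<le>n. h k) \<le> 2" for f g h :: "nat \<Rightarrow> real"
  proof -
    have "(\<Sum>k\<le>Suc n. f k) = 1 + (\<Sum>k\<le>n. f (Suc k))" by (simp only: sum.atMost_Suc_shift that)
    also have "\<dots> \<le> 1 + (\<Sum>k\<le>n. (\<Sum>j\<le>k. g j * h (k - j)) / 4)"
      by (intro add_left_mono sum_mono that)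
    also have "\<dots> \<le> 1 + (\<Sum>k\<le>n. g k) * (\<Sum>k\<le>n. h k) / 4"
      using sum_convolution_le[of g h n] that by (simp flip: sum_divide_distrib)
    also have "\<dots> \<le> 1 + 2 * 2 / 4"
      using that by (intro add_left_mono divide_right_mono mult_mono sum_nonneg) auto
    finally show ?thesis by simp
  qed
  have "u (Suc k) \<le> (\<Sum>j\<le>k. v j * u (k - j)) / 4" for k
  proof -
    have "u (Suc k) \<le> (\<Sum>j\<le>k. \<bar>(if even j then \<rho> else 1) * poly (V_poly j) \<rho> * poly (U_poly (k - j)) \<rho>\<bar>) / 4 ^ Suc k"
      unfolding u_def poly_U_Suc by (intro divide_right_mono sum_abs) auto
    also have "\<dots> \<le> (\<Sum>j\<le>k. \<bar>poly (V_poly j) \<rho>\<bar> * \<bar>poly (U_poly (k - j)) \<rho>\<bar>) / 4 ^ Suc k"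
      using assms by (intro divide_right_mono sum_mono) (auto simp: abs_mult mult.assoc intro!: mult_left_le_one_le)
    also have "\<dots> = (\<Sum>j\<le>k. v j * u (k - j)) / 4"
      by (simp add: u_def v_def sum_divide_distrib, intro sum.cong refl)
        (simp flip: power_add)
    finally show ?thesis .
  qed
  moreover have "v (Suc k) \<le> (\<Sum>j\<le>k. u j * v (k - j)) / 4" for k
  proof -
    have "v (Suc k) \<le> (\<Sum>j\<le>k. \<bar>(if even j then 1 else \<rho>) * poly (U_poly j) \<rho> * poly (V_poly (k - j)) \<rho>\<bar>) / 4 ^ Suc k"
      unfolding v_def poly_V_Suc by (intro divide_right_mono sum_abs) auto
    also have "\<dots> \<le> (\<Sum>j\<le>k. \<bar>poly (U_poly j) \<rho>\<bar> * \<bar>poly (V_poly (k - j)) \<rho>\<bar>) / 4 ^ Suc k"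
      using assms by (intro divide_right_mono sum_mono) (auto simp: abs_mult mult.assoc intro!: mult_left_le_one_le)
    also have "\<dots> = (\<Sum>j\<le>k. u j * v (k - j)) / 4"
      by (simp add: u_def v_def sum_divide_distrib, intro sum.cong refl)
        (simp flip: power_add)
    finally show ?thesis .
  qed
  ultimately show ?case
    using step[of u v u] step[of v u v] nonneg Suc.IH by (simp add: u_def v_def)
qed auto

lemma abs_poly_U_le: "\<bar>\<rho>\<bar> \<le> 1 \<Longrightarrow> \<bar>poly (U_poly k) \<rho>\<bar> \<le> 2 * 4 ^ k" for \<rho> :: real
proof -
  assume "\<bar>\<rho>\<bar> \<le> 1"
  then have "\<bar>poly (U_poly k) \<rho>\<bar> / 4 ^ k \<le> 2"
    using sum_UV_le[of \<rho> k] member_le_sum[of k "{..k}" "\<lambda>k. \<bar>poly (U_poly k) \<rho>\<bar> / 4 ^ k"] by auto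
  then show ?thesis by (simp add: divide_le_eq)
qed

text \<open>Here a, b and c, d are the even and odd parts of the generating functions of U and V.\<close>

lemma algebraic_relation:
  fixes a b c d z r :: "'a :: field_char_0"
  assumes E: "a + b = 1 + z * (r * c + d) * (a + b)" "a - b = 1 - z * (r * c - d) * (a - b)"
    "c + d = 1 + z * (a + r * b) * (c + d)" "c - d = 1 - z * (a - r * b) * (c - d)"
  shows "a\<^sup>2 * (1 - (1 + r)\<^sup>2 * (z\<^sup>2 * a\<^sup>2)) * (1 - (1 - r)\<^sup>2 * (z\<^sup>2 * a\<^sup>2)) = 1"
proof -
  \<comment> \<open>The equations say that A - B, A + B, C - D, C + D are the reciprocals of a + b,
    a - b, c + d, c - d. Hence a = A / P, b = B / P, c = C / Q, d = D / Q, and everything is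
    expressed through \<open>P\<close>, \<open>Q\<close> and \<open>w\<close>.\<close>
  define A B C D where "A = 1 - z * d" "B = r * z * c" "C = 1 - r * z * b" "D = z * a"
  define P Q w t where "P = A\<^sup>2 - B\<^sup>2" "Q = C\<^sup>2 - D\<^sup>2" "w = z\<^sup>2" "t = P * Q"
  have e: "(a + b) * (A - B) = 1" "(a - b) * (A + B) = 1" "(c + d) * (C - D) = 1" "(c - d) * (C + D) = 1"
  proof -
    have "(a + b) * (A - B) = (a + b) - z * (r * c + d) * (a + b)"
      "(a - b) * (A + B) = (a - b) + z * (r * c - d) * (a - b)"
      "(c + d) * (C - D) = (c + d) - z * (a + r * b) * (c + d)"
      "(c - d) * (C + D) = (c - d) + z * (a - r * b) * (c - d)"
      unfolding A_B_C_D_def by (simp_all add: algebra_simps)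
    moreover have "(a + b) - z * (r * c + d) * (a + b) = 1" "(a - b) + z * (r * c - d) * (a - b) = 1"
      "(c + d) - z * (a + r * b) * (c + d) = 1" "(c - d) + z * (a - r * b) * (c - d) = 1"
      by (subst E, simp)+
    ultimately show "(a + b) * (A - B) = 1" "(a - b) * (A + B) = 1" "(c + d) * (C - D) = 1" "(c - d) * (C + D) = 1"
      by simp_all
  qed
  have "(a + b) * (a - b) * P = 1" 
  proof -
    have "(a + b) * (a - b) * P = ((a + b) * (A - B)) * ((a - b) * (A + B))"
      unfolding P_Q_w_t_def by Groebner_Basis.algebra
    then show ?thesis using e by simp
  qed
  then have P0: "P \<noteq> 0" by auto
  have "(c + d) * (c - d) * Q = 1"
  proof -
    have "(c + d) * (c - d) * Q = ((c + d) * (C - D)) * ((c - d) * (C + D))"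
      unfolding P_Q_w_t_def by Groebner_Basis.algebra
    then show ?thesis using e by simp
  qed
  then have Q0: "Q \<noteq> 0" by auto
  have t0: "t \<noteq> 0" using P0 Q0 by (simp add: P_Q_w_t_def)
  have aP: "a * P = A" "b * P = B" "c * Q = C" "d * Q = D"
    unfolding P_Q_w_t_def using e by Groebner_Basis.algebra+
  \<comment> \<open>Inserting d = D / Q and D = z A / P into A = 1 - z d gives an equation that is
    linear in A and contains P and Q only through their product t. The same happens for C.\<close>
  have At: "A * (t + w) = t"
  proof -
    have "A * Q = Q - z * D" using aP by (simp add: A_B_C_D_def algebra_simps)
    then have "A * Q * P = Q * P - z\<^sup>2 * (a * P)" by (simp add: A_B_C_D_def algebra_simps power2_eq_square)
    then show ?thesis unfolding aP by (simp add: P_Q_w_t_def algebra_simps)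
  qed
  have Ct: "C * (t + r\<^sup>2 * w) = t"
  proof -
    have "C * P = P - r * z * B" using aP by (simp add: A_B_C_D_def algebra_simps)
    then have "C * P * Q = P * Q - r\<^sup>2 * z\<^sup>2 * (c * Q)" by (simp add: A_B_C_D_def algebra_simps power2_eq_square)
    then show ?thesis unfolding aP by (simp add: P_Q_w_t_def algebra_simps)
  qed
  define x y where "x = t + w" "y = t + r\<^sup>2 * w"
  have x0: "x \<noteq> 0" and y0: "y \<noteq> 0" using At Ct t0 by (auto simp: x_y_def)
  have A: "A = t / x" and C: "C = t / y" using At Ct x0 y0 by (auto simp: x_y_def field_simps)
  have Beq: "B * Q = r * z * C" and Deq: "D * P = z * A"
  proof -
    have "B * Q = r * z * (c * Q)" "D * P = z * (a * P)" by (simp_all add: A_B_C_D_def)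
    then show "B * Q = r * z * C" "D * P = z * A" unfolding aP .
  qed
  have BQ: "B = r * z * P / y" and DP: "D = z * Q / x"
  proof -
    have "B = r * z * C / Q" using Beq Q0 by (simp add: field_simps)
    also have "\<dots> = r * z * P / y" unfolding C using Q0 y0 by (simp add: P_Q_w_t_def field_simps)
    finally show "B = r * z * P / y" .
    have "D = z * A / P" using Deq P0 by (simp add: field_simps)
    also have "\<dots> = z * Q / x" unfolding A using P0 x0 by (simp add: P_Q_w_t_def field_simps)
    finally show "D = z * Q / x" .
  qed
  have p1: "P = t\<^sup>2 / x\<^sup>2 - r\<^sup>2 * w * P\<^sup>2 / y\<^sup>2"
  proof -
    have "P = A\<^sup>2 - B\<^sup>2" by (rule P_Q_w_t_def(1))
    also have "\<dots> = t\<^sup>2 / x\<^sup>2 - r\<^sup>2 * w * P\<^sup>2 / y\<^sup>2"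
      unfolding A BQ P_Q_w_t_def(3) by (simp add: power_mult_distrib power_divide)
    finally show ?thesis .
  qed
  have q1: "Q = t\<^sup>2 / y\<^sup>2 - w * Q\<^sup>2 / x\<^sup>2"
  proof -
    have "Q = C\<^sup>2 - D\<^sup>2" by (rule P_Q_w_t_def(2))
    also have "\<dots> = t\<^sup>2 / y\<^sup>2 - w * Q\<^sup>2 / x\<^sup>2"
      unfolding C DP P_Q_w_t_def(3) by (simp add: power_mult_distrib power_divide)
    finally show ?thesis .
  qed
  have Q: "Q = t / P" using P0 by (simp add: P_Q_w_t_def(4))
  \<comment> \<open>The equation for Q, multiplied by (P / t)^2, becomes a formula for P^2. Inserted
    into \<open>p1\<close> it removes the quadratic term and leaves an equation linear in P.\<close>
  have q2: "P\<^sup>2 / y\<^sup>2 = P / t + w / x\<^sup>2"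
  proof -
    have "Q * (P\<^sup>2 / t\<^sup>2) = P\<^sup>2 / y\<^sup>2 - w * (Q * P)\<^sup>2 / (x\<^sup>2 * t\<^sup>2)"
      by (subst q1) (use t0 x0 y0 in \<open>simp add: field_simps power_mult_distrib\<close>)
    moreover have "Q * P = t" by (simp add: P_Q_w_t_def(4))
    moreover have "Q * (P\<^sup>2 / t\<^sup>2) = P / t"
      unfolding Q using P0 t0 by (simp add: power2_eq_square)
    ultimately have "P / t = P\<^sup>2 / y\<^sup>2 - w * t\<^sup>2 / (x\<^sup>2 * t\<^sup>2)" by simp
    also have "w * t\<^sup>2 / (x\<^sup>2 * t\<^sup>2) = w / x\<^sup>2" using t0 by simp
    finally show ?thesis by simp
  qed
  have "P = t\<^sup>2 / x\<^sup>2 - r\<^sup>2 * w * (P / t + w / x\<^sup>2)"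
    unfolding q2[symmetric] using p1 by simp
  then have "P * (1 + r\<^sup>2 * w / t) = (t\<^sup>2 - r\<^sup>2 * w\<^sup>2) / x\<^sup>2"
    by (simp add: field_simps diff_divide_distrib power2_eq_square)
  then have Py0: "P * y = t * (t\<^sup>2 - r\<^sup>2 * w\<^sup>2) / x\<^sup>2"
    using t0 by (simp add: x_y_def field_simps)
  define n where "n = t\<^sup>2 - r\<^sup>2 * w\<^sup>2"
  have Py: "P * y = t * n / x\<^sup>2" using Py0 unfolding n_def .
  have n0: "n \<noteq> 0" using Py P0 y0 x0 by auto
  have ax: "a * n = x * y"
  proof -
    have "a * (P * y) = t / x * y" unfolding mult.assoc[symmetric] aP A ..
    then have "t * (a * n) / x\<^sup>2 = t * (x * y) / x\<^sup>2"
      unfolding Py using x0 by (simp add: power2_eq_square mult_ac)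
    then show ?thesis using t0 x0 by simp
  qed
  \<comment> \<open>P is known by now, so its quadratic equation turns into a relation between t and
    w alone. With \<open>ax\<close> it gives a^2 x y = t.\<close>
  have key: "t * n\<^sup>2 = x ^ 3 * y ^ 3"
  proof -
    have "P\<^sup>2 * x\<^sup>2 * t = y\<^sup>2 * (P * x\<^sup>2 + w * t)"
      using q2 x0 y0 t0 by (simp add: field_simps)
    then have "(P * y)\<^sup>2 * x\<^sup>2 * t = y ^ 3 * ((P * y) * x\<^sup>2 + w * t * y)"
      by Groebner_Basis.algebra
    then have "(t * n / x\<^sup>2)\<^sup>2 * x\<^sup>2 * t = y ^ 3 * (t * n + w * t * y)"
      unfolding Py using x0 by simp
    also have "t * n + w * t * y = t\<^sup>2 * x"
      unfolding x_y_def n_def by Groebner_Basis.algebra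
    also have "(t * n / x\<^sup>2)\<^sup>2 * x\<^sup>2 * t = t ^ 3 * n\<^sup>2 / x\<^sup>2"
      using x0 by (simp add: field_simps power_mult_distrib power2_eq_square power3_eq_cube)
    finally have "t ^ 3 * n\<^sup>2 = y ^ 3 * (t\<^sup>2 * x) * x\<^sup>2"
      using x0 by (simp add: field_simps)
    then have "t\<^sup>2 * (t * n\<^sup>2) = t\<^sup>2 * (x ^ 3 * y ^ 3)"
      by (simp add: power2_eq_square power3_eq_cube mult_ac)
    then show ?thesis using t0 by simp
  qed
  have aw: "w * a\<^sup>2 * (x * y) = t * w"
  proof -
    have "a\<^sup>2 * n\<^sup>2 = x\<^sup>2 * y\<^sup>2"
      using ax by (metis power_mult_distrib)
    then have "a\<^sup>2 * (x ^ 3 * y ^ 3) = t * (x\<^sup>2 * y\<^sup>2)"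
      using key by (metis mult.assoc mult.commute)
    then have "(a\<^sup>2 * (x * y)) * (x\<^sup>2 * y\<^sup>2) = t * (x\<^sup>2 * y\<^sup>2)"
      by (simp add: power2_eq_square power3_eq_cube mult_ac)
    then have "a\<^sup>2 * (x * y) = t" using x0 y0 by simp
    then show ?thesis by (simp add: mult_ac)
  qed
  define s where "s = z\<^sup>2 * a\<^sup>2"
  have s: "s * (x * y) = t * w" using aw by (simp add: s_def P_Q_w_t_def)
  \<comment> \<open>Multiplied by x y, the two factors become (t - r w)^2 and (t + r w)^2, whose
    product is n^2.\<close>
  have "a\<^sup>2 * ((1 - (1 + r)\<^sup>2 * s) * (1 - (1 - r)\<^sup>2 * s)) * (x * y)\<^sup>2
      = a\<^sup>2 * ((x * y - (1 + r)\<^sup>2 * (s * (x * y))) * (x * y - (1 - r)\<^sup>2 * (s * (x * y))))"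
    by Groebner_Basis.algebra
  also have "\<dots> = a\<^sup>2 * n\<^sup>2"
    unfolding s unfolding x_y_def n_def by Groebner_Basis.algebra
  also have "\<dots> = (x * y)\<^sup>2" using ax by (metis power_mult_distrib)
  finally have "a\<^sup>2 * ((1 - (1 + r)\<^sup>2 * s) * (1 - (1 - r)\<^sup>2 * s)) = 1" using x0 y0 by simp
  then show ?thesis unfolding s_def by (simp add: mult.assoc)
qed

section \<open>Generating functions of U and V\<close>

lemma suminf_recurrence:
  fixes f g :: "nat \<Rightarrow> complex"
  assumes "summable (\<lambda>k. norm (f k * z ^ k))" "summable (\<lambda>k. norm (g k * z ^ k))"
    and f0: "f 0 = 1" and fS: "\<And>k. f (Suc k) = (\<Sum>j\<le>k. g j * f (k - j))"
  shows "(\<Sum>k. f k * z ^ k) = 1 + z * (\<Sum>k. g k * z ^ k) * (\<Sum>k. f k * z ^ k)"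
proof -
  have "(\<lambda>k. \<Sum>i\<le>k. (g i * z ^ i) * (f (k - i) * z ^ (k - i))) sums
      ((\<Sum>k. g k * z ^ k) * (\<Sum>k. f k * z ^ k))"
    by (rule Cauchy_product_sums) (use assms in auto)
  moreover have "(\<Sum>i\<le>k. (g i * z ^ i) * (f (k - i) * z ^ (k - i))) = f (Suc k) * z ^ k" for k
  proof -
    have "(g i * z ^ i) * (f (k - i) * z ^ (k - i)) = g i * f (k - i) * z ^ k" if "i \<le> k" for i
    proof -
      have "z ^ k = z ^ i * z ^ (k - i)" using that by (simp flip: power_add)
      then show ?thesis by simp
    qed
    then show ?thesis unfolding fS sum_distrib_right by (intro sum.cong) auto
  qed
  ultimately have s: "(\<lambda>k. f (Suc k) * z ^ k) sums ((\<Sum>k. g k * z ^ k) * (\<Sum>k. f k * z ^ k))" by (simp only:)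
  have "(\<lambda>k. f k * z ^ k) sums (\<Sum>k. f k * z ^ k)"
    by (rule summable_sums[OF summable_norm_cancel[OF assms(1)]])
  then have "(\<lambda>k. f (Suc k) * z ^ Suc k) sums ((\<Sum>k. f k * z ^ k) - f 0 * z ^ 0)"
    by (subst sums_Suc_iff) simp
  moreover have "(\<lambda>k. f (Suc k) * z ^ Suc k) sums (z * ((\<Sum>k. g k * z ^ k) * (\<Sum>k. f k * z ^ k)))"
    using sums_mult[OF s, of z] by (simp add: mult_ac)
  ultimately have "(\<Sum>k. f k * z ^ k) - f 0 * z ^ 0 = z * ((\<Sum>k. g k * z ^ k) * (\<Sum>k. f k * z ^ k))"
    by (rule sums_unique2)
  then show ?thesis using f0 by (simp add: algebra_simps)
qed

text \<open>Weights that depend only on the parity of the index act on the even and odd parts of the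
  function, which are combinations of its values at z and -z.\<close>

lemma sums_even_odd_weights:
  fixes f :: "nat \<Rightarrow> complex"
  assumes "summable (\<lambda>k. f k * z ^ k)" "summable (\<lambda>k. f k * (- z) ^ k)"
  defines "F \<equiv> \<lambda>z. \<Sum>k. f k * z ^ k"
  shows "(\<lambda>k. (if even k then x else y) * f k * z ^ k) sums
    (x * ((F z + F (- z)) / 2) + y * ((F z - F (- z)) / 2))"
proof -
  have "(\<lambda>k. x * ((f k * z ^ k + f k * (- z) ^ k) / 2) + y * ((f k * z ^ k - f k * (- z) ^ k) / 2)) sums
    (x * ((F z + F (- z)) / 2) + y * ((F z - F (- z)) / 2))"
    unfolding F_def by (intro sums_add sums_mult sums_divide sums_diff summable_sums assms)
  moreover have "x * ((f k * z ^ k + f k * (- z) ^ k) / 2) + y * ((f k * z ^ k - f k * (- z) ^ k) / 2)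
    = (if even k then x else y) * f k * z ^ k" for k
    by (cases "even k") (auto simp: power_minus_even power_minus_odd)
  ultimately show ?thesis by (simp only:)
qed

text \<open>The bounded partial sums of \<open>sum_UV_le\<close> include the circle of radius 1/4,
  where the termwise bound 2 * 4^k would not suffice.\<close>

lemma summable_UV:
  fixes \<rho> :: real and z :: complex
  assumes "\<bar>\<rho>\<bar> \<le> 1" "norm z \<le> 1 / 4"
  shows "summable (\<lambda>k. norm (complex_of_real (poly (U_poly k) \<rho>) * z ^ k))"
    and "summable (\<lambda>k. norm (complex_of_real (poly (V_poly k) \<rho>) * z ^ k))"
proof -
  have *: "summable (\<lambda>k. norm (complex_of_real (f k) * z ^ k))" if f: "\<And>n. (\<Sum>k\<le>n. \<bar>f k\<bar> / 4 ^ k) \<le> 2" for f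
  proof (rule summable_comparison_test')
    show "summable (\<lambda>k. \<bar>f k\<bar> / 4 ^ k)"
    proof (rule summableI_nonneg_bounded)
      show "(\<Sum>k<n. \<bar>f k\<bar> / 4 ^ k) \<le> 2" for n
        by (rule order.trans[OF sum_mono2 f[of n]]) auto
    qed auto
    fix k :: nat
    have "norm (complex_of_real (f k) * z ^ k) = \<bar>f k\<bar> * norm z ^ k"
      by (simp add: norm_mult norm_power)
    also have "\<dots> \<le> \<bar>f k\<bar> * (1 / 4) ^ k"
      using assms by (intro mult_left_mono power_mono) auto
    finally show "norm (norm (complex_of_real (f k) * z ^ k)) \<le> \<bar>f k\<bar> / 4 ^ k"
      by (simp add: power_divide)
  qed
  show "summable (\<lambda>k. norm (complex_of_real (poly (U_poly k) \<rho>) * z ^ k))"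
    "summable (\<lambda>k. norm (complex_of_real (poly (V_poly k) \<rho>) * z ^ k))"
    using sum_UV_le[OF assms(1)] by (intro *; blast)+
qed

text \<open>The recurrences of U and V, evaluated at z and at -z, are four equations for the even
  and odd parts of the two generating functions. The even part of that of U is the series with
  coefficients U_{2k} in powers of z^2.\<close>

lemma U_generating_function:
  fixes \<rho> :: real and z :: complex
  assumes \<rho>: "\<bar>\<rho>\<bar> \<le> 1" and z: "norm z \<le> 1 / 4"
  obtains a where "(\<lambda>k. complex_of_real (poly (U_poly (2 * k)) \<rho>) * (z\<^sup>2) ^ k) sums a"
    and "a\<^sup>2 * (1 - of_real ((1 + \<rho>)\<^sup>2) * (z\<^sup>2 * a\<^sup>2)) * (1 - of_real ((1 - \<rho>)\<^sup>2) * (z\<^sup>2 * a\<^sup>2)) = 1"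
proof -
  define u where "u k = complex_of_real (poly (U_poly k) \<rho>)" for k
  define v where "v k = complex_of_real (poly (V_poly k) \<rho>)" for k
  define r where "r = complex_of_real \<rho>"
  define Fu where "Fu z = (\<Sum>k. u k * z ^ k)" for z
  define Fv where "Fv z = (\<Sum>k. v k * z ^ k)" for z
  define a b c d where abcd: "a = (Fu z + Fu (- z)) / 2" "b = (Fu z - Fu (- z)) / 2"
     "c = (Fv z + Fv (- z)) / 2" "d = (Fv z - Fv (- z)) / 2"
  have sm: "summable (\<lambda>k. norm (u k * x ^ k))" "summable (\<lambda>k. norm (v k * x ^ k))" if "norm x \<le> 1 / 4" for x
    using summable_UV[OF \<rho> that] by (auto simp: u_def v_def)
  note sm' = sm[THEN summable_norm_cancel]
  have smw: "summable (\<lambda>k. norm ((if even k then x else y) * f k * t ^ k))"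
    if "summable (\<lambda>k. norm (f k * t ^ k))" "norm x \<le> 1" "norm y \<le> 1" for x y t :: complex and f :: "nat \<Rightarrow> complex"
    by (rule summable_comparison_test'[OF that(1)])
      (use that in \<open>auto simp: norm_mult mult.assoc intro!: mult_left_le_one_le\<close>)
  have r: "norm r \<le> 1" using \<rho> by (simp add: r_def)
  have uS: "u (Suc k) = (\<Sum>j\<le>k. ((if even j then r else 1) * v j) * u (k - j))" for k
    unfolding u_def v_def r_def poly_U_Suc by (auto intro!: sum.cong)
  have vS: "v (Suc k) = (\<Sum>j\<le>k. ((if even j then 1 else r) * u j) * v (k - j))" for k
    unfolding u_def v_def r_def poly_V_Suc by (auto intro!: sum.cong)
  have u0: "u 0 = 1" "v 0 = 1" by (auto simp: u_def v_def)
  have U: "Fu x = 1 + x * (r * ((Fv x + Fv (- x)) / 2) + 1 * ((Fv x - Fv (- x)) / 2)) * Fu x"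
    if "norm x \<le> 1 / 4" for x
  proof -
    have "(\<Sum>k. (if even k then r else 1) * v k * x ^ k) =
        r * ((Fv x + Fv (- x)) / 2) + 1 * ((Fv x - Fv (- x)) / 2)"
      unfolding Fv_def by (rule sums_unique[OF sums_even_odd_weights, symmetric]) (use sm' that in auto)
    moreover have "Fu x = 1 + x * (\<Sum>k. (if even k then r else 1) * v k * x ^ k) * Fu x"
      unfolding Fu_def by (rule suminf_recurrence[OF sm(1) smw[OF sm(2)] u0(1) uS]) (use that r in auto)
    ultimately show ?thesis by (simp only:)
  qed
  have V: "Fv x = 1 + x * (1 * ((Fu x + Fu (- x)) / 2) + r * ((Fu x - Fu (- x)) / 2)) * Fv x"
    if "norm x \<le> 1 / 4" for x
  proof -
    have "(\<Sum>k. (if even k then 1 else r) * u k * x ^ k) =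
        1 * ((Fu x + Fu (- x)) / 2) + r * ((Fu x - Fu (- x)) / 2)"
      unfolding Fu_def by (rule sums_unique[OF sums_even_odd_weights, symmetric]) (use sm' that in auto)
    moreover have "Fv x = 1 + x * (\<Sum>k. (if even k then 1 else r) * u k * x ^ k) * Fv x"
      unfolding Fv_def by (rule suminf_recurrence[OF sm(2) smw[OF sm(1)] u0(2) vS]) (use that r in auto)
    ultimately show ?thesis by (simp only:)
  qed
  have ab: "a + b = Fu z" "a - b = Fu (- z)" "c + d = Fv z" "c - d = Fv (- z)"
    unfolding abcd by (simp_all add: field_simps)
  have E: "a + b = 1 + z * (r * c + d) * (a + b)" "a - b = 1 - z * (r * c - d) * (a - b)"
    "c + d = 1 + z * (a + r * b) * (c + d)" "c - d = 1 - z * (a - r * b) * (c - d)"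
  proof -
    show "a + b = 1 + z * (r * c + d) * (a + b)" using U[OF z] unfolding ab unfolding abcd by simp
    show "c + d = 1 + z * (a + r * b) * (c + d)" using V[OF z] unfolding ab unfolding abcd by simp
    have d': "(Fv (- z) - Fv z) / 2 = - d" "(Fv (- z) + Fv z) / 2 = c"
       "(Fu (- z) - Fu z) / 2 = - b" "(Fu (- z) + Fu z) / 2 = a" unfolding abcd by (simp_all add: field_simps)
    have "Fu (- z) = 1 + - z * (r * c + 1 * - d) * Fu (- z)"
      using U[of "- z"] z unfolding minus_minus d' by simp
    then show "a - b = 1 - z * (r * c - d) * (a - b)" unfolding ab by simp
    have "Fv (- z) = 1 + - z * (1 * a + r * - b) * Fv (- z)"
      using V[of "- z"] z unfolding minus_minus d' by simp
    then show "c - d = 1 - z * (a - r * b) * (c - d)" unfolding ab by simp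
  qed
  have "(\<lambda>k. (if even k then 1 else 0) * u k * z ^ k) sums (1 * a + 0 * b)"
    using sums_even_odd_weights[OF sm'(1) sm'(1), of z 1 0] z unfolding Fu_def[symmetric] abcd by simp
  then have "(\<lambda>k. (if even k then 1 else 0) * u k * z ^ k) sums a" by simp
  then have "(\<lambda>k. (if even (2 * k) then 1 else 0) * u (2 * k) * z ^ (2 * k)) sums a"
    by (subst sums_mono_reindex[of "\<lambda>k. 2 * k"]) (auto simp: strict_mono_def elim: evenE)
  then have "(\<lambda>k. complex_of_real (poly (U_poly (2 * k)) \<rho>) * (z\<^sup>2) ^ k) sums a"
    by (simp add: u_def power_mult)
  moreover have "a\<^sup>2 * (1 - of_real ((1 + \<rho>)\<^sup>2) * (z\<^sup>2 * a\<^sup>2)) * (1 - of_real ((1 - \<rho>)\<^sup>2) * (z\<^sup>2 * a\<^sup>2)) = 1"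
    using algebraic_relation[OF E] by (simp add: r_def)
  ultimately show thesis using that by blast
qed

subsection \<open>Absence of atoms\<close>

context real_distribution
begin

definition stieltjes :: "complex \<Rightarrow> complex" where
  "stieltjes z = (LINT y|M. 1 / (z - complex_of_real y))"

lemma stieltjes_kernel_norm:
  "Im z > 0 \<Longrightarrow> norm (1 / (z - complex_of_real y)) \<le> 1 / Im z"
proof -
  assume z: "Im z > 0"
  have "Im z \<le> norm (z - complex_of_real y)"
    using abs_Im_le_cmod[of "z - complex_of_real y"] z by simp
  then show ?thesis using z by (simp add: norm_divide frac_le)
qed

lemma integrable_stieltjes_kernel: "Im z > 0 \<Longrightarrow> integrable M (\<lambda>y. 1 / (z - complex_of_real y))"
  by (rule integrable_const_bound[where B="1 / Im z"]) (auto simp: stieltjes_kernel_norm)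

text \<open>The difference quotient of the kernel is minus the product of the kernels at the two
  points, so dominated convergence applies.\<close>

lemma stieltjes_has_field_derivative:
  assumes z: "Im z > 0"
  shows "(stieltjes has_field_derivative - (LINT y|M. 1 / (z - complex_of_real y)\<^sup>2)) (at z)"
proof -
  \<comment> \<open>A half-plane neighbourhood of z that stays away from the real axis bounds the
    kernels uniformly.\<close>
  define S where "S = {w. Im w > Im z / 2}"
  have S: "open S" "z \<in> S"
    using z by (simp_all add: S_def open_halfspace_Im_gt del: less_divide_eq_numeral1 divide_less_eq_numeral1)
  have "((\<lambda>w. (stieltjes w - stieltjes z) / (w - z)) \<longlongrightarrow> - (LINT y|M. 1 / (z - complex_of_real y)\<^sup>2)) (at z within S)"
    unfolding tendsto_at_iff_sequentially
  proof (intro allI impI)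
    fix X :: "nat \<Rightarrow> complex" assume X: "\<forall>i. X i \<in> S - {z}" "X \<longlonglongrightarrow> z"
    have ImX: "Im (X i) > Im z / 2" "Im (X i) > 0" "X i \<noteq> z" for i
      using X(1) z unfolding S_def by (auto dest!: spec[of _ i])
    have ne: "w - complex_of_real y \<noteq> 0" if "Im w > 0" for w y using that by (auto simp: complex_eq_iff)
    have eq: "(stieltjes (X i) - stieltjes z) / (X i - z) =
        (LINT y|M. - (1 / (X i - complex_of_real y) * (1 / (z - complex_of_real y))))" for i
    proof -
      have "stieltjes (X i) - stieltjes z = (LINT y|M. 1 / (X i - complex_of_real y) - 1 / (z - complex_of_real y))"
        unfolding stieltjes_def using integrable_stieltjes_kernel ImX z by simp
      also have "\<dots> / (X i - z) = (LINT y|M. (1 / (X i - complex_of_real y) - 1 / (z - complex_of_real y)) / (X i - z))"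
        by simp
      also have "\<dots> = (LINT y|M. - (1 / (X i - complex_of_real y) * (1 / (z - complex_of_real y))))"
      proof (intro Bochner_Integration.integral_cong refl)
        fix y
        show "(1 / (X i - complex_of_real y) - 1 / (z - complex_of_real y)) / (X i - z)
          = - (1 / (X i - complex_of_real y) * (1 / (z - complex_of_real y)))"
        proof -
          have "1 / (X i - complex_of_real y) - 1 / (z - complex_of_real y)
            = (X i - z) * - (1 / (X i - complex_of_real y) * (1 / (z - complex_of_real y)))"
          proof -
            have "1 / A - 1 / B = (A - B) * - (1 / A * (1 / B))" if "A \<noteq> 0" "B \<noteq> 0" for A B :: complex
              using that by (simp add: field_simps)
            from this[OF ne[OF ImX(2), of i y] ne[OF z, of y]] show ?thesis by simp
          qed
          then show ?thesis using ImX(3)[of i] by simp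
        qed
      qed
      finally show ?thesis .
    qed
    have "(\<lambda>i. LINT y|M. - (1 / (X i - complex_of_real y) * (1 / (z - complex_of_real y)))) \<longlonglongrightarrow>
        (LINT y|M. - (1 / (z - complex_of_real y) * (1 / (z - complex_of_real y))))"
    proof (rule integral_dominated_convergence[where w="\<lambda>_. 1 / (Im z / 2) * (1 / Im z)"])
      show "AE y in M. (\<lambda>i. - (1 / (X i - complex_of_real y) * (1 / (z - complex_of_real y))))
          \<longlonglongrightarrow> - (1 / (z - complex_of_real y) * (1 / (z - complex_of_real y)))"
        by (intro AE_I2 tendsto_intros X ne z)
      show "AE y in M. norm (- (1 / (X i - complex_of_real y) * (1 / (z - complex_of_real y)))) \<le> 1 / (Im z / 2) * (1 / Im z)" for i
      proof (intro AE_I2)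
        fix y
        have "norm (1 / (X i - complex_of_real y)) \<le> 1 / (Im z / 2)"
          using stieltjes_kernel_norm[OF ImX(2)[of i], of y] ImX(1)[of i] z
          by (elim order.trans) (intro divide_left_mono, auto)
        then show "norm (- (1 / (X i - complex_of_real y) * (1 / (z - complex_of_real y)))) \<le> 1 / (Im z / 2) * (1 / Im z)"
          unfolding norm_minus_cancel norm_mult
          by (intro mult_mono stieltjes_kernel_norm) (use z in auto)
      qed
    qed auto
    then show "((\<lambda>w. (stieltjes w - stieltjes z) / (w - z)) \<circ> X) \<longlonglongrightarrow> - (LINT y|M. 1 / (z - complex_of_real y)\<^sup>2)"
      unfolding o_def eq by (simp add: power2_eq_square)
  qed
  then show ?thesis
    unfolding has_field_derivative_iff using S at_within_open by metis
qed

lemma stieltjes_holomorphic: "stieltjes holomorphic_on {z. Im z > 0}"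
proof (rule holomorphic_onI)
  fix z assume "z \<in> {z. Im z > 0}"
  then show "stieltjes field_differentiable at z within {z. Im z > 0}"
    using stieltjes_has_field_derivative field_differentiable_def field_differentiable_at_within by blast
qed

text \<open>The geometric series of z / (z - y) converges uniformly on the support when |z| > R, so
  it may be integrated term by term.\<close>

lemma stieltjes_moment_sums:
  assumes bdd: "AE y in M. \<bar>y\<bar> \<le> R" and z: "Im z > 0" "norm z > R" and R: "R \<ge> 0"
  shows "(\<lambda>k. complex_of_real (LINT y|M. y ^ k) * (1 / z) ^ k) sums (z * stieltjes z)"
proof -
  have z0: "z \<noteq> 0" using z by auto
  have int: "integrable M (\<lambda>y. y ^ k)" for k
    by (rule integrable_const_bound[where B="R ^ k"])
      (use bdd in \<open>auto elim!: eventually_mono simp: power_abs intro: power_mono\<close>)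
  have ne: "z - complex_of_real y \<noteq> 0" for y using z by (auto simp: complex_eq_iff)
  define q where "q = R / norm z"
  have q: "0 \<le> q" "q < 1" using z R z0 by (auto simp: q_def)
  have small: "norm (complex_of_real y / z) \<le> q" if "\<bar>y\<bar> \<le> R" for y
    using that z0 by (simp add: q_def norm_divide divide_right_mono)
  have lim: "(\<lambda>n. LINT y|M. (\<Sum>k<n. (complex_of_real y / z) ^ k)) \<longlonglongrightarrow> (LINT y|M. z * (1 / (z - complex_of_real y)))"
  proof (rule integral_dominated_convergence[where w="\<lambda>_. 1 / (1 - q)"])
    show "AE y in M. (\<lambda>n. \<Sum>k<n. (complex_of_real y / z) ^ k) \<longlonglongrightarrow> z * (1 / (z - complex_of_real y))"
      using bdd
    proof eventually_elim
      case (elim y)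
      have "(\<lambda>k. (complex_of_real y / z) ^ k) sums (1 / (1 - complex_of_real y / z))"
        using small[OF elim] q by (intro geometric_sums) linarith
      also have "1 / (1 - complex_of_real y / z) = z * (1 / (z - complex_of_real y))"
        using z0 ne[of y] by (simp add: field_simps)
      finally show ?case by (simp add: sums_def)
    qed
    show "AE y in M. norm (\<Sum>k<n. (complex_of_real y / z) ^ k) \<le> 1 / (1 - q)" for n
      using bdd
    proof eventually_elim
      case (elim y)
      have "norm (\<Sum>k<n. (complex_of_real y / z) ^ k) \<le> (\<Sum>k<n. q ^ k)"
        using small[OF elim] by (intro order.trans[OF norm_sum] sum_mono) (auto simp: norm_power intro!: power_mono)
      also have "\<dots> \<le> 1 / (1 - q)"
        using q by (simp add: sum_gp_strict divide_right_mono)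
      finally show ?case .
    qed
  qed auto
  have "(LINT y|M. (\<Sum>k<n. (complex_of_real y / z) ^ k)) = (\<Sum>k<n. complex_of_real (LINT y|M. y ^ k) * (1 / z) ^ k)" for n
  proof -
    have eq: "(complex_of_real y / z) ^ k = complex_of_real (y ^ k) * (1 / z) ^ k" for y k
      by (simp add: power_divide)
    have "integrable M (\<lambda>y. complex_of_real (y ^ k) * (1 / z) ^ k)" for k
      by (intro integrable_mult_left integrable_of_real int)
    then show ?thesis
      unfolding eq using int
      by (subst Bochner_Integration.integral_sum)
        (auto simp del: of_real_power simp: integral_complex_of_real)
  qed
  then show ?thesis
    using lim unfolding sums_def stieltjes_def integral_mult_right_zero by (simp only:)
qed

text \<open>The function i \<epsilon> / (x + i \<epsilon> - y) has modulus at most 1 and tends to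
  the indicator of y = x.\<close>

lemma atom_as_limit:
  assumes "\<epsilon> \<longlonglongrightarrow> 0" "\<And>n. \<epsilon> n > 0"
  shows "(\<lambda>n. \<i> * of_real (\<epsilon> n) * stieltjes (of_real x + \<i> * of_real (\<epsilon> n))) \<longlonglongrightarrow> of_real (measure M {x})"
proof -
  define z where "z n = of_real x + \<i> * of_real (\<epsilon> n)" for n
  have z: "Im (z n) > 0" "Im (z n) = \<epsilon> n" for n using assms by (auto simp: z_def)
  have "(\<lambda>n. LINT y|M. \<i> * of_real (\<epsilon> n) * (1 / (z n - complex_of_real y))) \<longlonglongrightarrow> (LINT y|M. complex_of_real (indicator {x} y))"
  proof (rule integral_dominated_convergence[where w="\<lambda>_. 1"])
    show "AE y in M. (\<lambda>n. \<i> * of_real (\<epsilon> n) * (1 / (z n - complex_of_real y))) \<longlonglongrightarrow> complex_of_real (indicator {x} y)"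
    proof (intro AE_I2)
      fix y
      show "(\<lambda>n. \<i> * of_real (\<epsilon> n) * (1 / (z n - complex_of_real y))) \<longlonglongrightarrow> complex_of_real (indicator {x} y)"
      proof (cases "y = x")
        case True
        have "\<epsilon> n \<noteq> 0" for n using assms(2)[of n] by simp
        then have "\<i> * of_real (\<epsilon> n) * (1 / (z n - complex_of_real y)) = 1" for n using True by (simp add: z_def)
        then show ?thesis using True by simp
      next
        case False
        have "z \<longlonglongrightarrow> of_real x + \<i> * of_real 0"
          unfolding z_def by (intro tendsto_intros assms)
        then have "(\<lambda>n. \<i> * of_real (\<epsilon> n) * (1 / (z n - complex_of_real y))) \<longlonglongrightarrow> \<i> * of_real 0 * (1 / ((of_real x + \<i> * of_real 0) - complex_of_real y))"
          by (intro tendsto_intros assms) (use False in auto)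
        then show ?thesis using False by simp
      qed
    qed
    show "AE y in M. norm (\<i> * of_real (\<epsilon> n) * (1 / (z n - complex_of_real y))) \<le> 1" for n
    proof (intro AE_I2)
      fix y
      show "norm (\<i> * of_real (\<epsilon> n) * (1 / (z n - complex_of_real y))) \<le> 1"
        using mult_left_mono[OF stieltjes_kernel_norm[OF z(1), of n y], of "\<epsilon> n"] assms(2)[of n] z(2)[of n]
        unfolding norm_mult by simp
    qed
  qed auto
  moreover have "(LINT y|M. complex_of_real (indicator {x} y)) = of_real (measure M {x})"
    by simp
  moreover have "(LINT y|M. \<i> * of_real (\<epsilon> n) * (1 / (z n - complex_of_real y))) = \<i> * of_real (\<epsilon> n) * stieltjes (z n)" for n
    unfolding stieltjes_def by (rule integral_mult_right_zero)
  ultimately show ?thesis unfolding z_def by simp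
qed

text \<open>Let p be the mass at x. For x \<noteq> 0 the equation for G at x + i \<epsilon>,
  multiplied by \<epsilon>^6, keeps only the term of degree 6 in the limit, a nonzero multiple of
  p^6, against 0 on the other side. At x = 0 the coefficient z^4 vanishes too, and \<epsilon>^2 is
  the right factor.\<close>

lemma atomless_of_moments:
  fixes \<rho> :: real
  assumes bdd: "AE y in M. \<bar>y\<bar> \<le> R" and R: "R \<ge> 16" and \<rho>: "\<bar>\<rho>\<bar> < 1"
    and mom: "\<And>k. (LINT y|M. y ^ k) = poly (U_poly (2 * k)) \<rho>"
  shows "measure M {x} = 0"
proof -
  define \<alpha> \<beta> where "\<alpha> = complex_of_real ((1 + \<rho>)\<^sup>2)" "\<beta> = complex_of_real ((1 - \<rho>)\<^sup>2)"
  \<comment> \<open>The strict bound on |\<rho>| keeps the leading coefficient of the equation from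
    vanishing.\<close>
  have nz: "\<alpha> \<noteq> 0" "\<beta> \<noteq> 0" unfolding \<alpha>_\<beta>_def of_real_eq_0_iff using \<rho> by auto
  define \<Phi> where "\<Phi> z = z\<^sup>2 * (stieltjes z)\<^sup>2 * (1 - \<alpha> * (z * (stieltjes z)\<^sup>2)) * (1 - \<beta> * (z * (stieltjes z)\<^sup>2)) - 1" for z
  define H where "H = {z::complex. Im z > 0}"
  define U where "U = {z::complex. Im z > 0} \<inter> {z. norm z > R}"
  have far: "\<Phi> z = 0" if "z \<in> U" for z
  proof -
    have z: "Im z > 0" "norm z > R" and z0: "z \<noteq> 0" using that R by (auto simp: U_def)
    \<comment> \<open>The generating function lives in the variable whose square is 1 / z. Since |z|
      > 16, this root has modulus at most 1/4 and lies in the region of convergence.\<close>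
    define \<zeta> where "\<zeta> = csqrt (1 / z)"
    have \<zeta>2: "\<zeta>\<^sup>2 = 1 / z" by (simp add: \<zeta>_def)
    have "norm \<zeta> ^ 2 \<le> (1 / 4) ^ 2"
      using \<zeta>2 z R by (simp flip: norm_power) (use z R in \<open>auto simp: norm_divide divide_le_eq power2_eq_square\<close>)
    then have "norm \<zeta> \<le> 1 / 4" by (rule power2_le_imp_le) simp
    then obtain a where a: "(\<lambda>k. complex_of_real (poly (U_poly (2 * k)) \<rho>) * (\<zeta>\<^sup>2) ^ k) sums a"
      "a\<^sup>2 * (1 - \<alpha> * (\<zeta>\<^sup>2 * a\<^sup>2)) * (1 - \<beta> * (\<zeta>\<^sup>2 * a\<^sup>2)) = 1"
      using U_generating_function[of \<rho> \<zeta>] \<rho> unfolding \<alpha>_\<beta>_def by force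
    have a_eq: "a = z * stieltjes z"
      using stieltjes_moment_sums[OF bdd z] a(1) R unfolding mom \<zeta>2 by (auto dest: sums_unique2)
    then have "\<zeta>\<^sup>2 * a\<^sup>2 = z * (stieltjes z)\<^sup>2"
      using \<zeta>2 z0 by (simp add: power_mult_distrib power2_eq_square)
    from a(2)[unfolded this] show ?thesis unfolding a_eq \<Phi>_def by (simp add: power_mult_distrib)
  qed
  have H: "open H" "connected H"
    unfolding H_def by (simp add: open_halfspace_Im_gt, simp add: convex_halfspace_Im_gt convex_connected)
  have hol: "\<Phi> holomorphic_on H"
    unfolding \<Phi>_def H_def by (intro holomorphic_intros stieltjes_holomorphic)
  have UH: "U \<subseteq> H" by (auto simp: U_def H_def)
  have \<xi>: "\<i> * of_real (R + 1) \<in> U" using R by (auto simp: U_def norm_mult)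
  have "open U" unfolding U_def
    by (intro open_Int open_halfspace_Im_gt open_Collect_less continuous_intros)
  then have "\<i> * of_real (R + 1) islimpt U" using \<xi> by (intro interior_limit_point) (simp add: interior_open)
  then have zero: "\<Phi> z = 0" if "z \<in> H" for z
    using analytic_continuation[OF hol H UH _ _ far that] \<xi> UH by blast
  define \<epsilon> where "\<epsilon> n = 1 / real (Suc n)" for n
  have \<epsilon>: "\<epsilon> \<longlonglongrightarrow> 0" "\<epsilon> n > 0" for n
    using LIMSEQ_inverse_real_of_nat by (simp_all add: \<epsilon>_def[abs_def] inverse_eq_divide)
  define z where "z n = of_real x + \<i> * of_real (\<epsilon> n)" for n
  define K where "K n = \<i> * of_real (\<epsilon> n) * stieltjes (z n)" for n
  define e where "e n = complex_of_real (\<epsilon> n)" for n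
  define p where "p = complex_of_real (measure M {x})"
  have K: "K \<longlonglongrightarrow> p"
    unfolding K_def z_def p_def by (rule atom_as_limit[OF \<epsilon>])
  have e: "e \<longlonglongrightarrow> 0" unfolding e_def using tendsto_of_real[OF \<epsilon>(1), where 'a=complex] by simp
  have e0: "e n \<noteq> 0" for n using \<epsilon>(2)[of n] by (simp add: e_def)
  \<comment> \<open>The equation times \<open>e n ^ 6\<close>: each of its three factors absorbs
    e^2, which turns e^2 G^2 into -K^2.\<close>
  have rel: "- (z n)\<^sup>2 * (K n)\<^sup>2 * ((e n)\<^sup>2 + \<alpha> * (z n * (K n)\<^sup>2)) * ((e n)\<^sup>2 + \<beta> * (z n * (K n)\<^sup>2)) = e n ^ 6" for n
  proof -
    have "z n \<in> H" using \<epsilon>(2) by (simp add: H_def z_def)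
    then have "(z n)\<^sup>2 * (stieltjes (z n))\<^sup>2 * (1 - \<alpha> * (z n * (stieltjes (z n))\<^sup>2)) * (1 - \<beta> * (z n * (stieltjes (z n))\<^sup>2)) = 1"
      using zero unfolding \<Phi>_def by auto
    note one = this
    have K2: "(K n)\<^sup>2 = - ((e n)\<^sup>2 * (stieltjes (z n))\<^sup>2)" by (simp add: K_def e_def power_mult_distrib)
    have "- Z\<^sup>2 * (- (E\<^sup>2 * G)) * (E\<^sup>2 + \<alpha> * (Z * (- (E\<^sup>2 * G)))) * (E\<^sup>2 + \<beta> * (Z * (- (E\<^sup>2 * G))))
      = E ^ 6 * (Z\<^sup>2 * G * (1 - \<alpha> * (Z * G)) * (1 - \<beta> * (Z * G)))" for Z E G :: complex
      by Groebner_Basis.algebra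
    then show ?thesis unfolding K2 using one by (simp only: mult_1_right)
  qed
  have "p = 0"
  proof (cases "x = 0")
    case False
    have "z \<longlonglongrightarrow> of_real x + \<i> * of_real 0" unfolding z_def by (intro tendsto_intros \<epsilon>)
    then have z: "z \<longlonglongrightarrow> of_real x" by simp
    have "(\<lambda>n. - (z n)\<^sup>2 * (K n)\<^sup>2 * ((e n)\<^sup>2 + \<alpha> * (z n * (K n)\<^sup>2)) * ((e n)\<^sup>2 + \<beta> * (z n * (K n)\<^sup>2)))
      \<longlonglongrightarrow> - (of_real x)\<^sup>2 * p\<^sup>2 * (0\<^sup>2 + \<alpha> * (of_real x * p\<^sup>2)) * (0\<^sup>2 + \<beta> * (of_real x * p\<^sup>2))"
      by (intro tendsto_intros z K e)
    moreover have "(\<lambda>n. e n ^ 6) \<longlonglongrightarrow> 0 ^ 6" by (intro tendsto_intros e)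
    ultimately have "- (of_real x)\<^sup>2 * p\<^sup>2 * (0\<^sup>2 + \<alpha> * (of_real x * p\<^sup>2)) * (0\<^sup>2 + \<beta> * (of_real x * p\<^sup>2)) = 0 ^ 6"
      unfolding rel by (rule LIMSEQ_unique)
    then show ?thesis using False nz by simp
  next
    case True
    then have z: "z n = \<i> * e n" for n by (simp add: z_def e_def)
    \<comment> \<open>Here z = i e tends to 0 as well and the limit of \<open>rel\<close> is
      trivial. A factor e^4 can be cancelled first.\<close>
    have rel': "(K n)\<^sup>2 * (e n + \<alpha> * (\<i> * (K n)\<^sup>2)) * (e n + \<beta> * (\<i> * (K n)\<^sup>2)) = (e n)\<^sup>2" for n
    proof -
      have "e n ^ 4 * ((K n)\<^sup>2 * (e n + \<alpha> * (\<i> * (K n)\<^sup>2)) * (e n + \<beta> * (\<i> * (K n)\<^sup>2)))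
        = - (\<i> * e n)\<^sup>2 * (K n)\<^sup>2 * ((e n)\<^sup>2 + \<alpha> * (\<i> * e n * (K n)\<^sup>2)) * ((e n)\<^sup>2 + \<beta> * (\<i> * e n * (K n)\<^sup>2))"
        by (simp add: power_mult_distrib algebra_simps power2_eq_square power4_eq_xxxx)
      also have "\<dots> = e n ^ 4 * (e n)\<^sup>2" using rel[of n] unfolding z by (simp flip: power_add)
      finally show ?thesis using e0[of n] by (metis mult_left_cancel power_not_zero)
    qed
    have "(\<lambda>n. (K n)\<^sup>2 * (e n + \<alpha> * (\<i> * (K n)\<^sup>2)) * (e n + \<beta> * (\<i> * (K n)\<^sup>2))) \<longlonglongrightarrow>
      p\<^sup>2 * (0 + \<alpha> * (\<i> * p\<^sup>2)) * (0 + \<beta> * (\<i> * p\<^sup>2))"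
      by (intro tendsto_intros K e)
    moreover have "(\<lambda>n. (e n)\<^sup>2) \<longlonglongrightarrow> 0\<^sup>2" by (intro tendsto_intros e)
    ultimately have "p\<^sup>2 * (0 + \<alpha> * (\<i> * p\<^sup>2)) * (0 + \<beta> * (\<i> * p\<^sup>2)) = 0\<^sup>2"
      unfolding rel' by (rule LIMSEQ_unique)
    then show ?thesis using nz by simp
  qed
  then show ?thesis by (simp add: p_def)
qed

end

subsection \<open>The method of moments\<close>

context real_distribution
begin

text \<open>Markov's inequality for the power 2 k bounds the mass outside (-R, R) by A (B / R)^(2k),
  which tends to 0.\<close>

lemma AE_bounded_of_moments:
  assumes int: "\<And>k. integrable M (\<lambda>x. x ^ (2 * k))"
    and le: "\<And>k. (LINT x|M. x ^ (2 * k)) \<le> A * B ^ (2 * k)" and B: "0 \<le> B" "B < R"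
  shows "AE x in M. \<bar>x\<bar> \<le> R"
proof -
  define S where "S = {x\<in>space M. R \<le> \<bar>x\<bar>}"
  have R: "R > 0" using B by simp
  have "measure M S \<le> A * (B / R) ^ (2 * k)" for k
  proof -
    have "S \<subseteq> {x\<in>space M. R ^ (2 * k) \<le> x ^ (2 * k)}"
    proof
      fix x assume "x \<in> S"
      then have "x \<in> space M" "R ^ (2 * k) \<le> \<bar>x\<bar> ^ (2 * k)"
        unfolding S_def using R by (auto intro: power_mono)
      then show "x \<in> {x\<in>space M. R ^ (2 * k) \<le> x ^ (2 * k)}" by (simp add: power_mult)
    qed
    then have "measure M S \<le> measure M {x\<in>space M. R ^ (2 * k) \<le> x ^ (2 * k)}"
      by (intro finite_measure_mono) auto
    also have "\<dots> \<le> (LINT x|M. x ^ (2 * k)) / R ^ (2 * k)"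
      by (rule integral_Markov_inequality_measure[where A="space M"]) (use int R in auto)
    also have "\<dots> \<le> A * B ^ (2 * k) / R ^ (2 * k)"
      using le R by (intro divide_right_mono) auto
    finally show ?thesis by (simp add: power_divide)
  qed
  moreover have "(\<lambda>k. A * (B / R) ^ (2 * k)) \<longlonglongrightarrow> A * 0"
  proof -
    have "(B / R)\<^sup>2 < 1" using B R by (simp add: power_divide power_strict_mono)
    then have "(\<lambda>k. ((B / R)\<^sup>2) ^ k) \<longlonglongrightarrow> 0" by (intro LIMSEQ_realpow_zero) auto
    then show ?thesis by (intro tendsto_mult tendsto_const) (simp add: power_mult)
  qed
  ultimately have "measure M S \<le> 0"
    using LIMSEQ_le_const[of "\<lambda>k. A * (B / R) ^ (2 * k)" 0 "measure M S"] by auto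
  then have "emeasure M S = 0"
    by (simp add: emeasure_eq_measure measure_le_0_iff)
  moreover have "S \<in> sets M" unfolding S_def by auto
  ultimately have "AE x in M. x \<notin> S" by (intro AE_not_in) (auto simp: null_sets_def)
  then show ?thesis by eventually_elim (auto simp: S_def)
qed

lemma integrable_power_of_AE_bounded:
  assumes "AE x in M. \<bar>x\<bar> \<le> R" shows "integrable M (\<lambda>x. x ^ k)"
proof (rule integrable_const_bound[where B="\<bar>R\<bar> ^ k"])
  show "AE x in M. norm (x ^ k) \<le> \<bar>R\<bar> ^ k"
    using assms by eventually_elim (auto simp: power_abs intro!: power_mono)
qed auto

text \<open>On bounded support the exponential series is dominated by exp(|t| |R|) and may be
  integrated term by term. Moments thus determine the characteristic function, hence the
  law.\<close>

lemma char_sums_moments: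
  assumes bdd: "AE x in M. \<bar>x\<bar> \<le> R"
  shows "(\<lambda>k. (\<i> * of_real t) ^ k / of_real (fact k) * of_real (LINT x|M. x ^ k)) sums char M t"
proof -
  have int: "integrable M (\<lambda>x. x ^ k)" for k by (rule integrable_power_of_AE_bounded[OF bdd])
  have lim: "(\<lambda>n. LINT x|M. (\<Sum>k<n. (\<i> * of_real (t * x)) ^ k /\<^sub>R fact k)) \<longlonglongrightarrow> (LINT x|M. iexp (t * x))"
  proof (rule integral_dominated_convergence[where w="\<lambda>_. exp (\<bar>t\<bar> * \<bar>R\<bar>)"])
    show "AE x in M. (\<lambda>n. \<Sum>k<n. (\<i> * of_real (t * x)) ^ k /\<^sub>R fact k) \<longlonglongrightarrow> iexp (t * x)"
      using exp_converges by (intro AE_I2) (simp add: sums_def)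
    show "AE x in M. norm (\<Sum>k<n. (\<i> * of_real (t * x)) ^ k /\<^sub>R fact k) \<le> exp (\<bar>t\<bar> * \<bar>R\<bar>)" for n
      using bdd
    proof eventually_elim
      case (elim x)
      have "norm (\<Sum>k<n. (\<i> * of_real (t * x)) ^ k /\<^sub>R fact k) \<le> (\<Sum>k<n. \<bar>t * x\<bar> ^ k /\<^sub>R fact k)"
        by (rule order.trans[OF norm_sum]) (auto simp: norm_power norm_mult abs_mult intro!: sum_mono)
      also have "\<dots> \<le> exp \<bar>t * x\<bar>"
        unfolding exp_def by (rule sum_le_suminf) (auto intro: summable_exp)
      also have "\<dots> \<le> exp (\<bar>t\<bar> * \<bar>R\<bar>)"
        using elim by (auto simp: abs_mult intro!: mult_left_mono)
      finally show ?case .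
    qed
  qed auto
  have "(LINT x|M. (\<Sum>k<n. (\<i> * of_real (t * x)) ^ k /\<^sub>R fact k))
      = (\<Sum>k<n. (\<i> * of_real t) ^ k / of_real (fact k) * of_real (LINT x|M. x ^ k))" for n
  proof -
    have eq: "(\<i> * of_real (t * x)) ^ k /\<^sub>R fact k = (\<i> * of_real t) ^ k / of_real (fact k) * complex_of_real (x ^ k)" for x k
      by (simp add: scaleR_conv_of_real power_mult_distrib field_simps)
    have "integrable M (\<lambda>x. (\<i> * of_real t) ^ k / of_real (fact k) * complex_of_real (x ^ k))" for k
      by (intro integrable_mult_right integrable_of_real int)
    then show ?thesis
      unfolding eq by (subst Bochner_Integration.integral_sum)
        (auto simp del: of_real_power simp: integral_complex_of_real integral_mult_right_zero)
  qed
  then show ?thesis using lim unfolding sums_def char_def by (simp only:)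
qed

end

lemma real_distribution_eq_of_moments:
  assumes "real_distribution M1" "real_distribution M2"
    and "AE x in M1. \<bar>x\<bar> \<le> R" "AE x in M2. \<bar>x\<bar> \<le> R"
    and "\<And>k. (LINT x|M1. x ^ k) = (LINT x|M2. x ^ k)"
  shows "M1 = M2"
proof (rule Levy_uniqueness[OF assms(1,2)], rule ext)
  fix t
  show "char M1 t = char M2 t"
    using real_distribution.char_sums_moments[OF assms(1,3), of t]
      real_distribution.char_sums_moments[OF assms(2,4), of t] assms(5)
    by (auto dest: sums_unique2)
qed

text \<open>Weak convergence only covers bounded functions, and the laws \<open>\<nu> n\<close> need
  not have a common bounded support. Truncated even powers show that the limit has bounded support;
  afterwards x^k is replaced by a clamped power, with an error controlled by high moments.\<close>

lemma weak_limit_moments: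
  assumes \<nu>: "\<And>n. real_distribution (\<nu> n)" and N: "real_distribution N" and wc: "weak_conv_m \<nu> N"
    and int: "\<And>n k. integrable (\<nu> n) (\<lambda>x. x ^ k)"
    and mom: "\<And>k. (\<lambda>n. LINT x|\<nu> n. x ^ k) \<longlonglongrightarrow> m k"
    and le: "\<And>k. m (2 * k) \<le> A * B ^ (2 * k)" and B: "0 \<le> B" "B < R"
  shows "AE x in N. \<bar>x\<bar> \<le> R" and "(LINT x|N. x ^ k) = m k"
proof -
  interpret N: real_distribution N by fact
  interpret \<nu>: real_distribution "\<nu> n" for n by fact
  have R: "R > 0" using B by simp
  note portmanteau = weak_conv_imp_integral_bdd_continuous_conv[OF \<nu> N wc]
  \<comment> \<open>Only an inequality is available at this stage: the truncations at height c pass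
    to the weak limit and stay below m (2 k), then c grows.\<close>
  have 1: "integrable N (\<lambda>x. x ^ (2 * k)) \<and> (LINT x|N. x ^ (2 * k)) \<le> m (2 * k)" for k
  proof -
    define h where "h c x = min (x ^ (2 * k)) (real c)" for c :: nat and x :: real
    have h: "isCont (h c) x" "norm (h c x) \<le> real c" for c x
      unfolding h_def by (intro continuous_intros, auto simp: min_def)
    have hm [measurable]: "h c \<in> borel_measurable borel" for c unfolding h_def[abs_def] by measurable
    have hint: "integrable N (h c)" "integrable (\<nu> n) (h c)" for c n
      by (rule N.integrable_const_bound[where B="real c"], use h in auto,
          rule \<nu>.integrable_const_bound[where B="real c"], use h in auto)
    have h_le: "integral\<^sup>L N (h c) \<le> m (2 * k)" for c
    proof (rule LIMSEQ_le[OF portmanteau[of "h c" "real c"] mom])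
      show "\<exists>K. \<forall>n\<ge>K. integral\<^sup>L (\<nu> n) (h c) \<le> (LINT x|\<nu> n. x ^ (2 * k))"
        by (intro exI allI impI integral_mono hint int) (auto simp: h_def)
    qed (use h in auto)
    have inc: "incseq (\<lambda>c. integral\<^sup>L N (h c))"
      by (intro incseq_SucI integral_mono hint) (auto simp: h_def)
    have "bdd_above (range (\<lambda>c. integral\<^sup>L N (h c)))" using h_le by (intro bdd_aboveI2)
    then have lim: "(\<lambda>c. integral\<^sup>L N (h c)) \<longlonglongrightarrow> (SUP c. integral\<^sup>L N (h c))"
      using inc by (rule LIMSEQ_incseq_SUP)
    have pw: "AE x in N. (\<lambda>c. h c x) \<longlonglongrightarrow> x ^ (2 * k)"
    proof (intro AE_I2 tendsto_eventually)
      fix x :: real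
      obtain c0 :: nat where "x ^ (2 * k) \<le> real c0" using real_arch_simple by blast
      then show "\<forall>\<^sub>F c in sequentially. h c x = x ^ (2 * k)"
        unfolding h_def by (intro eventually_sequentiallyI[of c0]) auto
    qed
    note mc = integral_monotone_convergence_nonneg[OF hint(1) _ _ pw lim]
    have "integrable N (\<lambda>x. x ^ (2 * k))" "(LINT x|N. x ^ (2 * k)) = (SUP c. integral\<^sup>L N (h c))"
      by (rule mc; auto simp: h_def mono_def min_def)+
    moreover have "(SUP c. integral\<^sup>L N (h c)) \<le> m (2 * k)" using h_le by (intro cSUP_least) auto
    ultimately show ?thesis by simp
  qed
  show bdd: "AE x in N. \<bar>x\<bar> \<le> R"
    by (rule N.AE_bounded_of_moments[OF _ _ B]) (use 1 le order.trans in blast)+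
  \<comment> \<open>A bounded continuous function that agrees with x^k on [-R, R], hence almost
    everywhere for the limit law.\<close>
  define g where "g x = (max (- R) (min R x)) ^ k" for x :: real
  have g: "isCont g x" "norm (g x) \<le> R ^ k" for x
  proof -
    show "isCont g x" unfolding g_def by (intro continuous_intros)
    have "\<bar>max (- R) (min R x)\<bar> \<le> R" using R by (auto simp: max_def min_def)
    then show "norm (g x) \<le> R ^ k" unfolding g_def by (auto simp: power_abs intro: power_mono)
  qed
  have [measurable]: "g \<in> borel_measurable borel" unfolding g_def[abs_def] by measurable
  have gint: "integrable (\<nu> n) g" for n
    by (rule \<nu>.integrable_const_bound[where B="R ^ k"]) (use g in auto)
  have "(LINT x|N. x ^ k) = integral\<^sup>L N g"
    by (rule integral_cong_AE) (use bdd in \<open>auto elim!: eventually_mono simp: g_def max_def min_def\<close>)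
  moreover have "integral\<^sup>L N g = m k"
  proof -
    have g_diff: "\<bar>g x - x ^ k\<bar> \<le> x ^ (2 * j) * (R ^ k / R ^ (2 * j))" if "k \<le> j" for x j
    proof (cases "\<bar>x\<bar> \<le> R")
      case True
      then have "max (- R) (min R x) = x" by (auto simp: max_def min_def)
      then show ?thesis using R by (simp add: g_def)
    next
      case False
      define y where "y = max (- R) (min R x)"
      have y: "y = R * sgn x" using False R by (auto simp: y_def max_def min_def sgn_if)
      have "y ^ k = R ^ k * sgn x ^ k" unfolding y by (simp add: power_mult_distrib)
      moreover have "x ^ k = \<bar>x\<bar> ^ k * sgn x ^ k"
        by (simp flip: power_mult_distrib add: abs_mult_sgn)
      ultimately have "\<bar>g x - x ^ k\<bar> = \<bar>R ^ k - \<bar>x\<bar> ^ k\<bar> * \<bar>sgn x ^ k\<bar>"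
        unfolding g_def y_def[symmetric] by (simp flip: abs_mult add: left_diff_distrib)
      also have "\<dots> \<le> \<bar>x\<bar> ^ k"
      proof -
        have "x \<noteq> 0" using False R by auto
        then have "\<bar>sgn x ^ k\<bar> \<le> 1" by (simp add: power_abs abs_sgn_eq)
        moreover have "R ^ k \<le> \<bar>x\<bar> ^ k" using False R by (intro power_mono) auto
        ultimately have "\<bar>R ^ k - \<bar>x\<bar> ^ k\<bar> * \<bar>sgn x ^ k\<bar> \<le> \<bar>x\<bar> ^ k * 1"
          using R by (intro mult_mono) auto
        then show ?thesis by simp
      qed
      also have "\<bar>x\<bar> ^ k \<le> x ^ (2 * j) * (R ^ k / R ^ (2 * j))"
      proof -
        have 2: "2 * j = k + (2 * j - k)" using that by simp
        have "\<bar>x\<bar> ^ k * R ^ (2 * j - k) \<le> \<bar>x\<bar> ^ k * \<bar>x\<bar> ^ (2 * j - k)"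
          using False R by (intro mult_left_mono power_mono) auto
        also have "\<dots> = \<bar>x\<bar> ^ (2 * j)" using 2 by (metis power_add)
        also have "\<dots> = x ^ (2 * j)" by (simp add: power_mult)
        finally have "\<bar>x\<bar> ^ k \<le> x ^ (2 * j) / R ^ (2 * j - k)" using R by (simp add: pos_le_divide_eq)
        also have "\<dots> = x ^ (2 * j) * (R ^ k / R ^ (2 * j))"
        proof -
          have "R ^ (2 * j) = R ^ k * R ^ (2 * j - k)" by (metis 2 power_add)
          then show ?thesis using R by simp
        qed
        finally show ?thesis .
      qed
      finally show ?thesis .
    qed
    have "\<bar>integral\<^sup>L N g - m k\<bar> \<le> A * B ^ (2 * j) * (R ^ k / R ^ (2 * j))" if "k \<le> j" for j
    proof -
      have "(\<lambda>n. \<bar>integral\<^sup>L (\<nu> n) g - (LINT x|\<nu> n. x ^ k)\<bar>) \<longlonglongrightarrow> \<bar>integral\<^sup>L N g - m k\<bar>"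
        by (intro tendsto_intros mom portmanteau[OF g])
      moreover have "(\<lambda>n. (LINT x|\<nu> n. x ^ (2 * j)) * (R ^ k / R ^ (2 * j))) \<longlonglongrightarrow> m (2 * j) * (R ^ k / R ^ (2 * j))"
        by (intro tendsto_intros mom)
      moreover have "\<bar>integral\<^sup>L (\<nu> n) g - (LINT x|\<nu> n. x ^ k)\<bar> \<le> (LINT x|\<nu> n. x ^ (2 * j)) * (R ^ k / R ^ (2 * j))" for n
      proof -
        have "\<bar>integral\<^sup>L (\<nu> n) g - (LINT x|\<nu> n. x ^ k)\<bar> = \<bar>LINT x|\<nu> n. g x - x ^ k\<bar>"
          using gint int by simp
        also have "\<dots> \<le> (LINT x|\<nu> n. \<bar>g x - x ^ k\<bar>)" by (rule integral_abs_bound)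
        also have "\<dots> \<le> (LINT x|\<nu> n. x ^ (2 * j) * (R ^ k / R ^ (2 * j)))"
          by (intro integral_mono integrable_abs Bochner_Integration.integrable_diff integrable_mult_left gint int g_diff that)
        finally show ?thesis by simp
      qed
      ultimately have "\<bar>integral\<^sup>L N g - m k\<bar> \<le> m (2 * j) * (R ^ k / R ^ (2 * j))"
        by (intro LIMSEQ_le) auto
      also have "\<dots> \<le> A * B ^ (2 * j) * (R ^ k / R ^ (2 * j))"
        using le R by (intro mult_right_mono) auto
      finally show ?thesis .
    qed
    moreover have "(\<lambda>j. A * B ^ (2 * j) * (R ^ k / R ^ (2 * j))) \<longlonglongrightarrow> 0"
    proof -
      have "(B / R)\<^sup>2 < 1" using B R by (simp add: power_divide power_strict_mono)
      then have "(\<lambda>j. ((B / R)\<^sup>2) ^ j) \<longlonglongrightarrow> 0" by (intro LIMSEQ_realpow_zero) auto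
      from tendsto_mult[OF tendsto_const[of "A * R ^ k"] this]
      have "(\<lambda>j. A * R ^ k * ((B / R)\<^sup>2) ^ j) \<longlonglongrightarrow> 0" by (simp only: mult_zero_right)
      moreover have "A * B ^ (2 * j) * (R ^ k / R ^ (2 * j)) = A * R ^ k * ((B / R)\<^sup>2) ^ j" for j
        by (simp add: power_divide power_mult[symmetric])
      ultimately show ?thesis by (simp only:)
    qed
    ultimately have "\<bar>integral\<^sup>L N g - m k\<bar> \<le> 0"
      by (meson LIMSEQ_le_const)
    then show ?thesis by simp
  qed
  ultimately show "(LINT x|N. x ^ k) = m k" by simp
qed

text \<open>Bounded second moments give tightness; every subsequential limit has the moments
  \<open>m\<close> and bounded support, so all these limits coincide.\<close>

theorem method_of_moments:
  assumes \<nu>: "\<And>n. real_distribution (\<nu> n)"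
    and int: "\<And>n k. integrable (\<nu> n) (\<lambda>x. x ^ k)"
    and mom: "\<And>k. (\<lambda>n. LINT x|\<nu> n. x ^ k) \<longlonglongrightarrow> m k"
    and le: "\<And>k. m (2 * k) \<le> A * B ^ (2 * k)" and B: "0 \<le> B" "B < R"
  obtains N where "real_distribution N" "weak_conv_m \<nu> N" "AE x in N. \<bar>x\<bar> \<le> R"
    "\<And>k. (LINT x|N. x ^ k) = m k"
proof -
  interpret \<nu>: real_distribution "\<nu> n" for n by fact
  have "Bseq (\<lambda>n. LINT x|\<nu> n. x ^ 2)" using mom by (intro convergent_imp_Bseq) (auto simp: convergent_def)
  then obtain K where K: "K > 0" "\<And>n. norm (LINT x|\<nu> n. x ^ 2) \<le> K" by (auto simp: Bseq_def)
  have tight: "tight \<nu>"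
    unfolding tight_def
  proof (intro conjI allI impI \<nu>)
    fix \<epsilon> :: real assume \<epsilon>: "\<epsilon> > 0"
    \<comment> \<open>With this choice Chebyshev's bound K / c^2 is \<epsilon> / 2.\<close>
    define c where "c = sqrt (2 * K / \<epsilon>)"
    have c: "c > 0" "c\<^sup>2 = 2 * K / \<epsilon>" using K \<epsilon> by (auto simp: c_def)
    have "1 - \<epsilon> < measure (\<nu> n) {- c<..c}" for n
    proof -
      have "measure (\<nu> n) {x\<in>space (\<nu> n). c\<^sup>2 \<le> x\<^sup>2} \<le> (LINT x|\<nu> n. x\<^sup>2) / c\<^sup>2"
        by (rule integral_Markov_inequality_measure[where A="space (\<nu> n)"]) (use int \<open>c > 0\<close> in auto)
      also have "\<dots> \<le> K / c\<^sup>2" using K(2)[of n] by (intro divide_right_mono) auto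
      also have "\<dots> < \<epsilon>" using K \<epsilon> by (simp add: c)
      finally have 1: "measure (\<nu> n) {x\<in>space (\<nu> n). c\<^sup>2 \<le> x\<^sup>2} < \<epsilon>" .
      have "1 = measure (\<nu> n) ({x\<in>space (\<nu> n). c\<^sup>2 \<le> x\<^sup>2} \<union> {- c<..c})"
      proof -
        have "{x\<in>space (\<nu> n). c\<^sup>2 \<le> x\<^sup>2} \<union> {- c<..c} = space (\<nu> n)"
        proof -
          have "c\<^sup>2 \<le> x\<^sup>2 \<or> x \<in> {- c<..c}" for x
            unfolding abs_le_square_iff[symmetric] using c(1) by auto
          then show ?thesis by (auto simp del: greaterThanAtMost_iff)
        qed
        then show ?thesis using \<nu>.prob_space by simp
      qed
      also have "\<dots> \<le> measure (\<nu> n) {x\<in>space (\<nu> n). c\<^sup>2 \<le> x\<^sup>2} + measure (\<nu> n) {- c<..c}"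
        by (intro measure_Un_le) auto
      finally show ?thesis using 1 by simp
    qed
    then show "\<exists>a b. a < b \<and> (\<forall>n. 1 - \<epsilon> < measure (\<nu> n) {a<..b})"
      using c by (intro exI[of _ "- c"] exI[of _ c]) auto
  qed
  have sub: "AE x in N'. \<bar>x\<bar> \<le> R" "(LINT x|N'. x ^ k) = m k"
    if s: "strict_mono s" "real_distribution N'" "weak_conv_m (\<nu> \<circ> s) N'" for s N' k
    by (rule weak_limit_moments[OF _ that(2,3) _ _ le B];
        use \<nu> int LIMSEQ_subseq_LIMSEQ[OF mom s(1)] in \<open>simp add: o_def\<close>)+
  obtain r N where rN: "strict_mono r" "real_distribution N" "weak_conv_m (\<nu> \<circ> id \<circ> r) N"
    using tight_imp_convergent_subsubsequence[OF tight strict_mono_id] by blast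
  then have N: "AE x in N. \<bar>x\<bar> \<le> R" "\<And>k. (LINT x|N. x ^ k) = m k" using sub[of r N] by auto
  have "weak_conv_m \<nu> N"
  proof (rule tight_subseq_weak_converge[OF \<nu> rN(2) tight])
    fix s N' assume s: "strict_mono s" "real_distribution N'" "weak_conv_m (\<nu> \<circ> s) N'"
    have "N' = N"
      by (rule real_distribution_eq_of_moments[OF s(2) rN(2) sub(1)[OF s] N(1)]) (simp add: N(2) sub(2)[OF s])
    then show "weak_conv_m (\<nu> \<circ> s) N" using s by simp
  qed
  then show thesis using that rN N by blast
qed

subsection \<open>The Wick recursion for elliptic matrices\<close>

context prob_space
begin

text \<open>The second claim is Gaussian integration by parts applied to a power, here read off from
  the explicit moments. It is homogeneous in the variance and so includes the degenerate
  case.\<close>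

lemma gaussian_rv_moments:
  assumes Y: "gaussian_rv M Y" and mean: "expectation Y = 0"
  shows "integrable M (\<lambda>\<omega>. Y \<omega> ^ n)"
    and "expectation (\<lambda>\<omega>. Y \<omega> ^ (n + 2)) = (real n + 1) * expectation (\<lambda>\<omega>. (Y \<omega>)\<^sup>2) * expectation (\<lambda>\<omega>. Y \<omega> ^ n)"
proof -
  have [measurable]: "Y \<in> borel_measurable M" using Y by (simp add: gaussian_rv_def)
  have "(\<forall>n. integrable M (\<lambda>\<omega>. Y \<omega> ^ n)) \<and>
    (\<forall>n. expectation (\<lambda>\<omega>. Y \<omega> ^ (n + 2)) = (real n + 1) * expectation (\<lambda>\<omega>. (Y \<omega>)\<^sup>2) * expectation (\<lambda>\<omega>. Y \<omega> ^ n))"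
    using Y unfolding gaussian_rv_def
  proof (elim conjE disjE exE)
    fix \<mu> \<sigma> assume \<sigma>: "0 < \<sigma>" and D: "distributed M lborel Y (normal_density \<mu> \<sigma>)"
    have \<mu>: "\<mu> = 0" using normal_distributed_expectation[OF \<sigma> D] mean by simp
    note D = D[unfolded \<mu>]
    have eq: "expectation (\<lambda>\<omega>. Y \<omega> ^ n) = (LINT x|lborel. normal_density 0 \<sigma> x * x ^ n)" for n
      by (rule distributed_integral[OF D, symmetric]) auto
    have int: "integrable M (\<lambda>\<omega>. Y \<omega> ^ n)" for n
    proof -
      have "integrable lborel (\<lambda>x. normal_density 0 \<sigma> x * x ^ n)"
        using normal_moment_even[OF \<sigma>, of 0 "n div 2"] normal_moment_odd[OF \<sigma>, of 0 "n div 2"]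
        by (cases "even n") (auto simp: has_bochner_integral_iff elim!: evenE oddE)
      then show ?thesis
        using distributed_integrable[OF D, of "\<lambda>x. x ^ n"] by auto
    qed
    have even: "expectation (\<lambda>\<omega>. Y \<omega> ^ (2 * k)) = fact (2 * k) / ((2 / \<sigma>\<^sup>2) ^ k * fact k)" for k
      unfolding eq using integral_normal_moment_even[OF \<sigma>, of 0 k] by simp
    have odd: "expectation (\<lambda>\<omega>. Y \<omega> ^ (2 * k + 1)) = 0" for k
      unfolding eq using integral_normal_moment_odd[OF \<sigma>, of 0 k] by simp
    have "expectation (\<lambda>\<omega>. Y \<omega> ^ (n + 2)) = (real n + 1) * expectation (\<lambda>\<omega>. (Y \<omega>)\<^sup>2) * expectation (\<lambda>\<omega>. Y \<omega> ^ n)" for n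
    proof (cases "even n")
      case True
      then obtain k where n: "n = 2 * k" by (elim evenE)
      have 2: "expectation (\<lambda>\<omega>. (Y \<omega>)\<^sup>2) = \<sigma>\<^sup>2" using even[of 1] \<sigma> by simp
      have "expectation (\<lambda>\<omega>. Y \<omega> ^ (n + 2)) = fact (2 * Suc k) / ((2 / \<sigma>\<^sup>2) ^ Suc k * fact (Suc k))"
        unfolding n using even[of "Suc k"] by simp
      also have "\<dots> = (real n + 1) * \<sigma>\<^sup>2 * (fact (2 * k) / ((2 / \<sigma>\<^sup>2) ^ k * fact k))"
      proof -
        have "(fact (2 * Suc k) :: real) = (2 * real (Suc k)) * (2 * real k + 1) * fact (2 * k)" by simp
        moreover have "(fact (Suc k) :: real) = real (Suc k) * fact k" by simp
        ultimately show ?thesis using \<sigma> n by (simp add: field_simps del: fact_Suc of_nat_Suc)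
      qed
      finally show ?thesis unfolding 2 n even .
    next
      case False
      then obtain k where n: "n = 2 * k + 1" by (elim oddE)
      have n2: "n + 2 = 2 * Suc k + 1" using n by simp
      have "expectation (\<lambda>\<omega>. Y \<omega> ^ (n + 2)) = 0" unfolding n2 by (rule odd)
      moreover have "expectation (\<lambda>\<omega>. Y \<omega> ^ n) = 0" unfolding n by (rule odd)
      ultimately show ?thesis by (simp only: mult_zero_right)
    qed
    then show ?thesis using int by blast
  next
    \<comment> \<open>A constant variable with mean 0 vanishes almost surely, and both sides of the
      recursion are 0.\<close>
    fix c assume c: "AE \<omega> in M. Y \<omega> = c"
    have "expectation Y = c"
      using integral_cong_AE[of Y M "\<lambda>_. c"] c by (simp add: prob_space)
    then have c0: "AE \<omega> in M. Y \<omega> = 0" using c mean by simp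
    have "integrable M (\<lambda>\<omega>. Y \<omega> ^ n)" for n
      by (rule integrable_const_bound[where B=1]) (use c0 in \<open>auto elim!: eventually_mono simp: power_0_left\<close>)
    moreover have "expectation (\<lambda>\<omega>. Y \<omega> ^ Suc n) = 0" for n
      by (rule integral_eq_zero_AE) (use c0 in \<open>auto elim!: eventually_mono\<close>)
    note z = this
    have "expectation (\<lambda>\<omega>. (Y \<omega>)\<^sup>2) = 0" using z[of 1] by (simp only: numeral_2_eq_2 One_nat_def)
    moreover have "expectation (\<lambda>\<omega>. Y \<omega> ^ (n + 2)) = 0" for n using z[of "Suc n"] by (simp only: add_2_eq_Suc')
    ultimately show ?thesis by simp
  qed
  then show "integrable M (\<lambda>\<omega>. Y \<omega> ^ n)"
    and "expectation (\<lambda>\<omega>. Y \<omega> ^ (n + 2)) = (real n + 1) * expectation (\<lambda>\<omega>. (Y \<omega>)\<^sup>2) * expectation (\<lambda>\<omega>. Y \<omega> ^ n)"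
    by blast+
qed

lemma integrable_mult_powers:
  assumes [measurable]: "A \<in> borel_measurable M" "B \<in> borel_measurable M"
    and int: "\<And>n. integrable M (\<lambda>\<omega>. A \<omega> ^ n)" "\<And>n. integrable M (\<lambda>\<omega>. B \<omega> ^ n)"
  shows "integrable M (\<lambda>\<omega>. A \<omega> ^ a * B \<omega> ^ b :: real)"
proof (rule Bochner_Integration.integrable_bound)
  show "integrable M (\<lambda>\<omega>. A \<omega> ^ (2 * a) + B \<omega> ^ (2 * b))" using int by auto
  have "norm (x * y) \<le> norm (x\<^sup>2 + y\<^sup>2)" for x y :: real
    using sum_squares_bound[of "\<bar>x\<bar>" "\<bar>y\<bar>"] by (simp add: abs_mult) (use mult_nonneg_nonneg[of "\<bar>x\<bar>" "\<bar>y\<bar>"] in linarith)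
  from this[of "A \<omega> ^ a" "B \<omega> ^ b" for \<omega>]
  show "AE \<omega> in M. norm (A \<omega> ^ a * B \<omega> ^ b) \<le> norm (A \<omega> ^ (2 * a) + B \<omega> ^ (2 * b))"
    by (simp add: power_mult power_commutes flip: power_mult[of _ _ 2, unfolded mult.commute[of _ 2]])
qed auto

text \<open>The recursion for all powers of the linear combinations t * A + B is an identity of polynomials in t;
  its formal derivative, read off coefficientwise, is the Wick recursion.\<close>

lemma bivariate_wick:
  assumes Z: "\<And>s t. gaussian_rv M (\<lambda>\<omega>. s * A \<omega> + t * B \<omega>)"
    and mean: "expectation A = 0" "expectation B = 0"
    and int: "integrable M A" "integrable M B"
  shows "expectation (\<lambda>\<omega>. A \<omega> ^ Suc a * B \<omega> ^ b) =
    expectation (\<lambda>\<omega>. (A \<omega>)\<^sup>2) * real a * expectation (\<lambda>\<omega>. A \<omega> ^ (a - 1) * B \<omega> ^ b) +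
    expectation (\<lambda>\<omega>. A \<omega> * B \<omega>) * real b * expectation (\<lambda>\<omega>. A \<omega> ^ a * B \<omega> ^ (b - 1))"
proof -
  define p r s where "p = expectation (\<lambda>\<omega>. (A \<omega>)\<^sup>2)" "r = expectation (\<lambda>\<omega>. A \<omega> * B \<omega>)" "s = expectation (\<lambda>\<omega>. (B \<omega>)\<^sup>2)"
  define mon where "mon a b = expectation (\<lambda>\<omega>. A \<omega> ^ a * B \<omega> ^ b)" for a b
  have g: "gaussian_rv M A" "gaussian_rv M B" using Z[of 1 0] Z[of 0 1] by simp_all
  have [measurable]: "A \<in> borel_measurable M" "B \<in> borel_measurable M" using g by (auto simp: gaussian_rv_def)
  have intm: "integrable M (\<lambda>\<omega>. A \<omega> ^ a * B \<omega> ^ b)" for a b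
    by (rule integrable_mult_powers) (use gaussian_rv_moments(1) g mean in auto)
  \<comment> \<open>The moment of order n of t A + B as a polynomial in t; its coefficients carry
    the mixed moments.\<close>
  define H where "H n = (\<Sum>k\<le>n. monom (real (n choose k) * mon k (n - k)) k)" for n
  have coeff_H: "coeff (H n) k = real (n choose k) * mon k (n - k)" for n k
    by (simp add: H_def coeff_sum)
  have poly_H: "poly (H n) t = expectation (\<lambda>\<omega>. (t * A \<omega> + B \<omega>) ^ n)" for n t
  proof -
    have eq: "(t * A \<omega> + B \<omega>) ^ n = (\<Sum>k\<le>n. real (n choose k) * t ^ k * (A \<omega> ^ k * B \<omega> ^ (n - k)))" for \<omega>
      unfolding binomial_ring by (intro sum.cong) (auto simp: power_mult_distrib)
    show ?thesis
      unfolding eq by (subst Bochner_Integration.integral_sum)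
        (auto simp: intm H_def poly_sum poly_monom mon_def intro!: sum.cong)
  qed
  \<comment> \<open>The variance of t A + B as a polynomial in t.\<close>
  define Q where "Q = [:s, 2 * r, p:]"
  have Q: "expectation (\<lambda>\<omega>. (t * A \<omega> + B \<omega>)\<^sup>2) = poly Q t" for t
  proof -
    have eq: "(t * A \<omega> + B \<omega>)\<^sup>2 = t\<^sup>2 * (A \<omega> ^ 2 * B \<omega> ^ 0) + 2 * t * (A \<omega> ^ 1 * B \<omega> ^ 1) + A \<omega> ^ 0 * B \<omega> ^ 2" for \<omega>
      by (simp add: power2_eq_square algebra_simps)
    have I: "integrable M (\<lambda>\<omega>. c * (A \<omega> ^ a * B \<omega> ^ b))" for c a b
      by (intro integrable_mult_right intm)
    have "expectation (\<lambda>\<omega>. (t * A \<omega> + B \<omega>)\<^sup>2) = t\<^sup>2 * mon 2 0 + 2 * t * mon 1 1 + mon 0 2"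
      unfolding eq mon_def
      by (simp only: Bochner_Integration.integral_add Bochner_Integration.integrable_add I intm integral_mult_right_zero)
    then show ?thesis by (simp add: Q_def p_r_s_def mon_def algebra_simps power2_eq_square)
  qed
  have H2: "H (n + 2) = Polynomial.smult (real n + 1) (Q * H n)" for n
  proof -
    have "poly (H (n + 2)) t = poly (Polynomial.smult (real n + 1) (Q * H n)) t" for t
      using gaussian_rv_moments(2)[of "\<lambda>\<omega>. t * A \<omega> + B \<omega>" n] Z[of t 1] mean int
      by (simp add: poly_H Q)
    then show ?thesis by (simp add: poly_eq_poly_eq_iff[symmetric] fun_eq_iff)
  qed
  have H0: "H 0 = 1" by (simp add: H_def mon_def prob_space one_pCons monom_0)
  have H1: "H 1 = 0"
  proof -
    have "poly (H 1) t = poly 0 t" for t using mean int by (simp add: poly_H)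
    then show ?thesis by (simp add: poly_eq_poly_eq_iff[symmetric] fun_eq_iff)
  qed
  have dH: "2 * pderiv (H (n + 2)) = Polynomial.smult ((real n + 1) * (real n + 2)) (pderiv Q * H n)"
    if "2 * (Q * pderiv (H n)) = Polynomial.smult (real n) (pderiv Q * H n)" for n
  proof -
    have "2 * pderiv (H (n + 2)) = Polynomial.smult (real n + 1) (2 * (pderiv Q * H n) + 2 * (Q * pderiv (H n)))"
      unfolding H2 pderiv_smult pderiv_mult by (simp add: algebra_simps Polynomial.smult_add_right)
    also have "\<dots> = Polynomial.smult (real n + 1) (2 * (pderiv Q * H n) + Polynomial.smult (real n) (pderiv Q * H n))" unfolding that ..
    also have "2 * (pderiv Q * H n) = Polynomial.smult 2 (pderiv Q * H n)" by (simp add: numeral_poly)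
    finally show ?thesis by (simp add: Polynomial.smult_add_left[symmetric] algebra_simps)
  qed
  \<comment> \<open>Up to a constant, H n is Q^(n/2) for even n and 0 for odd n. This is the
    differential equation of that power without fractional exponents, proved by steps of
    two.\<close>
  have QH: "2 * (Q * pderiv (H n)) = Polynomial.smult (real n) (pderiv Q * H n)" for n
  proof (induction n rule: induct_nat_012)
    case 0
    then show ?case by (simp add: H0)
  next
    case 1
    then show ?case using H1 by simp
  next
    case (ge2 n)
    have "2 * (Q * pderiv (H (n + 2))) = Q * (2 * pderiv (H (n + 2)))" by (simp add: mult_ac)
    also have "\<dots> = Polynomial.smult (real n + 2) (pderiv Q * Polynomial.smult (real n + 1) (Q * H n))"
      unfolding dH[OF ge2(1)] by (simp add: mult_ac)
    finally show ?case unfolding H2[symmetric] by (simp add: add.commute)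
  qed
  show ?thesis
  proof (cases "a + b")
    case 0
    then show ?thesis using mean by simp
  next
    case (Suc n)
    \<comment> \<open>One factor A is peeled off from total degree n + 2, and the claim is the
      coefficient of t^a in the identity for the derivative of H (n + 2).\<close>
    have b: "b = Suc n - a" and a: "a \<le> Suc n" using Suc by auto
    have "2 * pderiv (H (n + 2)) = Polynomial.smult ((real n + 1) * (real n + 2)) (pderiv Q * H n)"
      by (rule dH[OF QH])
    then have "coeff (2 * pderiv (H (n + 2))) a = coeff (Polynomial.smult ((real n + 1) * (real n + 2)) (pderiv Q * H n)) a" by simp
    moreover have "pderiv Q = [:2 * r, 2 * p:]" by (simp add: Q_def pderiv_pCons)
    moreover have "coeff ([:2 * r, 2 * p:] * H n) a = 2 * r * coeff (H n) a + (if a = 0 then 0 else 2 * p * coeff (H n) (a - 1))"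
      by (cases a) simp_all
    moreover have "coeff (2 * pderiv (H (n + 2))) a = 2 * (real a + 1) * coeff (H (n + 2)) (Suc a)"
      by (simp add: numeral_poly coeff_pderiv algebra_simps)
    ultimately have "(real a + 1) * coeff (H (n + 2)) (Suc a) = (real n + 1) * (real n + 2) *
        (r * coeff (H n) a + (if a = 0 then 0 else p * coeff (H n) (a - 1)))"
      by (simp add: algebra_simps split: if_splits)
    \<comment> \<open>Absorption identities bring all terms to the common binomial n + 1 over a. For
      a = 0 or b = 0 the truncated exponents a - 1 and b - 1 are harmless, as their factors a and b
      vanish.\<close>
    moreover have "(real a + 1) * coeff (H (n + 2)) (Suc a) = (real n + 2) * (real (Suc n choose a) * mon (Suc a) b)"
    proof -
      have "real (Suc a) * real (Suc (Suc n) choose Suc a) = real (Suc (Suc n)) * real (Suc n choose a)"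
        using Suc_times_binomial_eq[of "Suc n" a] by (metis mult.commute of_nat_mult)
      moreover have "real (Suc a) = real a + 1" "real (Suc (Suc n)) = real n + 2" by simp_all
      ultimately have c: "(real a + 1) * real (Suc (Suc n) choose Suc a) = (real n + 2) * real (Suc n choose a)"
        by (simp only:)
      have "coeff (H (n + 2)) (Suc a) = real (Suc (Suc n) choose Suc a) * mon (Suc a) b"
        by (simp add: coeff_H b del: binomial_Suc_Suc)
      then show ?thesis using c by (simp only: mult.assoc[symmetric])
    qed
    moreover have "(real n + 1) * (r * coeff (H n) a) = real (Suc n choose a) * (r * real b * mon a (b - 1))"
    proof -
      have "(Suc n - a) * (Suc n choose a) = Suc n * (n choose a)"
        using binomial_absorb_comp[of "Suc n" a] by simp
      then have c: "(real n + 1) * real (n choose a) = real b * real (Suc n choose a)"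
        unfolding b by (metis of_nat_mult of_nat_Suc add.commute)
      have "coeff (H n) a = real (n choose a) * mon a (b - 1)" by (simp add: coeff_H b)
      then have "(real n + 1) * (r * coeff (H n) a) = r * ((real n + 1) * real (n choose a)) * mon a (b - 1)"
        by (simp only: mult_ac)
      then show ?thesis unfolding c by (simp only: mult_ac)
    qed
    moreover have "(real n + 1) * (if a = 0 then 0 else p * coeff (H n) (a - 1)) = real (Suc n choose a) * (p * real a * mon (a - 1) b)"
    proof (cases a)
      case (Suc k)
      have "real (Suc k) * real (Suc n choose Suc k) = real (Suc n) * real (n choose k)"
        using Suc_times_binomial_eq[of n k] by (metis mult.commute of_nat_mult)
      moreover have "real (Suc n) = real n + 1" by simp
      ultimately have c: "(real n + 1) * real (n choose k) = real a * real (Suc n choose a)"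
        unfolding Suc by (simp only:)
      have "coeff (H n) k = real (n choose k) * mon k b" by (simp add: coeff_H b Suc)
      then have "(real n + 1) * (p * coeff (H n) k) = p * ((real n + 1) * real (n choose k)) * mon k b"
        by (simp only: mult_ac)
      then show ?thesis unfolding c using Suc by (simp add: mult_ac del: binomial_Suc_Suc)
    qed auto
    moreover have "(real n + 2) * P = (real n + 2) * (c * (x + y))"
      if "w = (real n + 1) * (real n + 2) * (u + v)" "w = (real n + 2) * P"
        "(real n + 1) * u = c * y" "(real n + 1) * v = c * x" for w u v P c x y :: real
    proof -
      have "w = (real n + 2) * ((real n + 1) * u + (real n + 1) * v)" using that(1) by (simp add: algebra_simps)
      then show ?thesis using that(2) unfolding that(3,4) by (simp add: algebra_simps)
    qed
    ultimately have "(real n + 2) * (real (Suc n choose a) * mon (Suc a) b) =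
      (real n + 2) * (real (Suc n choose a) * (p * real a * mon (a - 1) b + r * real b * mon a (b - 1)))"
      by blast
    moreover have "real n + 2 \<noteq> 0" "real (Suc n choose a) \<noteq> 0" using a by auto
    ultimately show ?thesis by (simp add: mon_def p_r_s_def)
  qed
qed

end

section \<open>Independence of the entry pairs\<close>

definition entry_monomial :: "real mat \<Rightarrow> (nat \<times> nat) multiset \<Rightarrow> real" where
  "entry_monomial A es = (\<Prod>e\<in>#es. A $$ e)"

text \<open>The part of a monomial that lives on one independent pair of entries. A diagonal pair
  consists of the same entry twice, so its power is taken from one component only.\<close>

definition pair_factor :: "(nat \<times> nat) multiset \<Rightarrow> nat \<times> nat \<Rightarrow> real \<times> real \<Rightarrow> real" where
  "pair_factor es = (\<lambda>(i, j) (a, b). if i = j then a ^ count es (i, i) else a ^ count es (i, j) * b ^ count es (j, i))"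

definition unordered :: "nat \<times> nat \<Rightarrow> nat \<times> nat" where
  "unordered = (\<lambda>(i, j). (min i j, max i j))"

lemma pair_factor_add:
  assumes "i \<le> j"
  shows "pair_factor (add_mset e es) (i, j) (A $$ (i, j), A $$ (j, i)) =
    (if (i, j) = unordered e then A $$ e else 1) * pair_factor es (i, j) (A $$ (i, j), A $$ (j, i))"
  using assms by (cases e) (auto simp: pair_factor_def unordered_def min_def max_def)

lemma entry_monomial_factor:
  assumes "set_mset es \<subseteq> {..<N} \<times> {..<N}"
  shows "entry_monomial A es = (\<Prod>(i, j)\<in>{(i, j). i \<le> j \<and> j < N}. pair_factor es (i, j) (A $$ (i, j), A $$ (j, i)))"
proof -
  have fin: "finite {(i, j). i \<le> j \<and> j < N}"
    by (rule finite_subset[of _ "{..<N} \<times> {..<N}"]) auto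
  show ?thesis using assms
  proof (induction es)
    case empty
    have "(\<Prod>p\<in>{(i, j). i \<le> j \<and> j < N}. case p of (i, j) \<Rightarrow> pair_factor {#} (i, j) (A $$ (i, j), A $$ (j, i))) = 1"
      by (rule prod.neutral) (auto simp: pair_factor_def)
    then show ?case by (simp add: entry_monomial_def)
  next
    case (add e es)
    have "(\<Prod>(i, j)\<in>{(i, j). i \<le> j \<and> j < N}. pair_factor (add_mset e es) (i, j) (A $$ (i, j), A $$ (j, i)))
      = (\<Prod>p\<in>{(i, j). i \<le> j \<and> j < N}. (if p = unordered e then A $$ e else 1) *
           (case p of (i, j) \<Rightarrow> pair_factor es (i, j) (A $$ (i, j), A $$ (j, i))))"
    proof (intro prod.cong refl)
      fix p assume "p \<in> {(i, j). i \<le> j \<and> j < N}"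
      then obtain i j where p: "p = (i, j)" "i \<le> j" by auto
      show "(case p of (i, j) \<Rightarrow> pair_factor (add_mset e es) (i, j) (A $$ (i, j), A $$ (j, i))) =
        (if p = unordered e then A $$ e else 1) * (case p of (i, j) \<Rightarrow> pair_factor es (i, j) (A $$ (i, j), A $$ (j, i)))"
        unfolding p prod.case by (rule pair_factor_add[OF p(2)])
    qed
    also have "\<dots> = A $$ e * entry_monomial A es"
      using add fin by (auto simp: prod.distrib prod.delta unordered_def)
    finally show ?case by (simp add: entry_monomial_def)
  qed
qed

lemma sum_mset_pair:
  assumes "i < j"
  shows "(\<Sum>e'\<in>#filter_mset (\<lambda>e. unordered e = (i, j)) es. g e') =
    real (count es (i, j)) * g (i, j) + real (count es (j, i)) * g (j, i)"
  using assms by (induction es) (auto simp: unordered_def algebra_simps min_def max_def split: if_splits)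

lemma sum_mset_diag:
  "(\<Sum>e'\<in>#filter_mset (\<lambda>e. unordered e = (i, i)) es. g e') = real (count es (i, i)) * g (i, i)"
  by (induction es) (auto simp: unordered_def algebra_simps min_def max_def split: if_splits)

lemma elliptic_cov_eq_0: "unordered e \<noteq> unordered e' \<Longrightarrow> elliptic_cov \<rho> e e' = 0"
  by (cases e; cases e') (auto simp: elliptic_cov_def unordered_def min_def max_def split: if_splits)

lemma pair_factor_diff:
  assumes "unordered e' \<noteq> (i, j)" "i \<le> j"
  shows "pair_factor (es - {#e'#}) (i, j) = pair_factor es (i, j)"
proof -
  have "e' \<noteq> (i, j)" "e' \<noteq> (j, i)" using assms by (auto simp: unordered_def)
  then show ?thesis by (cases "i = j") (auto simp: pair_factor_def fun_eq_iff)
qed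

context
  fixes M :: "'a measure" and N :: nat and \<rho> :: real and X :: "'a \<Rightarrow> real mat"
  assumes ell: "gaussian_elliptic M N \<rho> X"
begin

interpretation prob_space M using ell by (simp add: gaussian_elliptic_def)

abbreviation "upper \<equiv> {(i, j). i \<le> j \<and> j < N}"

lemma ell_gaussian: "i \<le> j \<Longrightarrow> j < N \<Longrightarrow> gaussian_rv M (\<lambda>\<omega>. s * X \<omega> $$ (i, j) + t * X \<omega> $$ (j, i))"
  using ell by (simp add: gaussian_elliptic_def gaussian_vector2_def)

lemma ell_gaussian_entry: "i < N \<Longrightarrow> j < N \<Longrightarrow> gaussian_rv M (\<lambda>\<omega>. X \<omega> $$ (i, j))"
  using ell_gaussian[of i j 1 0] ell_gaussian[of j i 0 1] by (cases "i \<le> j") auto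

lemma ell_measurable [measurable]: "i < N \<Longrightarrow> j < N \<Longrightarrow> (\<lambda>\<omega>. X \<omega> $$ (i, j)) \<in> borel_measurable M"
  using ell_gaussian_entry by (simp add: gaussian_rv_def)

lemma ell_mean: "i < N \<Longrightarrow> j < N \<Longrightarrow> expectation (\<lambda>\<omega>. X \<omega> $$ (i, j)) = 0"
  and ell_var: "i < N \<Longrightarrow> j < N \<Longrightarrow> expectation (\<lambda>\<omega>. (X \<omega> $$ (i, j))\<^sup>2) = 1"
  and ell_cov: "i < N \<Longrightarrow> j < N \<Longrightarrow> i \<noteq> j \<Longrightarrow> expectation (\<lambda>\<omega>. X \<omega> $$ (i, j) * X \<omega> $$ (j, i)) = \<rho>"
  using ell unfolding gaussian_elliptic_def by blast+

lemma ell_integrable_power: "i < N \<Longrightarrow> j < N \<Longrightarrow> integrable M (\<lambda>\<omega>. X \<omega> $$ (i, j) ^ n)"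
  using gaussian_rv_moments(1)[OF ell_gaussian_entry ell_mean] .

definition factor_mean :: "(nat \<times> nat) multiset \<Rightarrow> nat \<times> nat \<Rightarrow> real" where
  "factor_mean es = (\<lambda>(i, j). expectation (\<lambda>\<omega>. pair_factor es (i, j) (X \<omega> $$ (i, j), X \<omega> $$ (j, i))))"

lemma ell_integrable_factor:
  assumes "i \<le> j" "j < N"
  shows "integrable M (\<lambda>\<omega>. pair_factor es (i, j) (X \<omega> $$ (i, j), X \<omega> $$ (j, i)))"
  unfolding pair_factor_def using assms
  by (cases "i = j") (auto intro!: integrable_mult_powers ell_integrable_power)

text \<open>Grouped by unordered index pairs, a monomial is a product of functions of independent
  vectors, so integrability and the mean factorise.\<close>

lemma ell_monomial:
  assumes "N \<ge> 1" "set_mset es \<subseteq> {..<N} \<times> {..<N}"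
  shows "integrable M (\<lambda>\<omega>. entry_monomial (X \<omega>) es)"
    and "expectation (\<lambda>\<omega>. entry_monomial (X \<omega>) es) = (\<Prod>p\<in>upper. factor_mean es p)"
proof -
  have fin: "finite upper"
    by (rule finite_subset[of _ "{..<N} \<times> {..<N}"]) auto
  have "indep_vars (\<lambda>_. borel) (\<lambda>(i, j) \<omega>. (X \<omega> $$ (i, j), X \<omega> $$ (j, i))) upper"
    using ell by (simp add: gaussian_elliptic_def)
  then have ind: "indep_vars (\<lambda>_. borel) (\<lambda>p \<omega>. pair_factor es p ((\<lambda>(i, j) \<omega>. (X \<omega> $$ (i, j), X \<omega> $$ (j, i))) p \<omega>)) upper"
  proof (rule indep_vars_compose2)
    fix p :: "nat \<times> nat"
    show "pair_factor es p \<in> borel_measurable borel"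
      unfolding pair_factor_def borel_prod[symmetric] by (cases p) (simp, measurable)
  qed
  have int: "integrable M (\<lambda>\<omega>. pair_factor es p ((\<lambda>(i, j) \<omega>. (X \<omega> $$ (i, j), X \<omega> $$ (j, i))) p \<omega>))" if "p \<in> upper" for p
    using ell_integrable_factor that by (cases p) auto
  have eq: "entry_monomial (X \<omega>) es = (\<Prod>p\<in>upper. pair_factor es p ((\<lambda>(i, j) \<omega>. (X \<omega> $$ (i, j), X \<omega> $$ (j, i))) p \<omega>))" for \<omega>
    unfolding entry_monomial_factor[OF assms(2)] by (intro prod.cong) auto
  show "integrable M (\<lambda>\<omega>. entry_monomial (X \<omega>) es)"
    unfolding eq by (rule indep_vars_integrable[OF fin ind int])
  show "expectation (\<lambda>\<omega>. entry_monomial (X \<omega>) es) = (\<Prod>p\<in>upper. factor_mean es p)"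
    unfolding eq
    by (rule trans[OF indep_vars_lebesgue_integral[OF fin ind int]]) (auto simp: factor_mean_def intro!: prod.cong)
qed

text \<open>The Wick recursion within one independent block: univariate on the diagonal, bivariate
  off it. Multiplicities of equal edges turn into the integer factors of these recursions.\<close>

lemma factor_mean_wick:
  assumes e: "e \<in> {..<N} \<times> {..<N}"
  shows "factor_mean (add_mset e es) (unordered e) =
    (\<Sum>e'\<in>#filter_mset (\<lambda>e'. unordered e' = unordered e) es. elliptic_cov \<rho> e e' * factor_mean (es - {#e'#}) (unordered e))"
proof -
  obtain i j where ij: "unordered e = (i, j)" "i \<le> j" "j < N"
    using e by (cases e) (auto simp: unordered_def)
  have e_cases: "e = (i, j) \<or> e = (j, i)" using ij by (cases e) (auto simp: unordered_def min_def max_def split: if_splits)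
  show ?thesis
  proof (cases "i = j")
    case True
    then have e': "e = (i, i)" using e_cases by auto
    have N: "i < N" using ij True by simp
    define c where "c = count es (i, i)"
    have "gaussian_rv M (\<lambda>\<omega>. X \<omega> $$ (i, i))" by (rule ell_gaussian_entry) (use N in auto)
    note gm = gaussian_rv_moments(2)[OF this ell_mean[OF N N]]
    have "expectation (\<lambda>\<omega>. X \<omega> $$ (i, i) ^ Suc c) = real c * expectation (\<lambda>\<omega>. X \<omega> $$ (i, i) ^ (c - 1))"
      using gm[of "c - 1"] ell_mean[OF N N] ell_var[OF N N] by (cases c) simp_all
    then show ?thesis
      unfolding ij(1) using True e' sum_mset_diag[where i=i and es=es and g="\<lambda>e'. elliptic_cov \<rho> e e' * factor_mean (es - {#e'#}) (i, j)"]
      by (simp add: factor_mean_def pair_factor_def elliptic_cov_def c_def)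
  next
    case False
    then have lt: "i < j" and N: "i < N" "j < N" using ij by auto
    let ?A = "\<lambda>\<omega>. X \<omega> $$ (i, j)" and ?B = "\<lambda>\<omega>. X \<omega> $$ (j, i)"
    have int: "integrable M ?A" "integrable M ?B"
      using ell_integrable_power[of i j 1] ell_integrable_power[of j i 1] N by simp_all
    have g: "gaussian_rv M (\<lambda>\<omega>. s * ?A \<omega> + t * ?B \<omega>)" "gaussian_rv M (\<lambda>\<omega>. s * ?B \<omega> + t * ?A \<omega>)" for s t
      using ell_gaussian[of i j s t] ell_gaussian[of i j t s] ij by (simp_all add: add.commute)
    have W: "expectation (\<lambda>\<omega>. ?A \<omega> ^ Suc a * ?B \<omega> ^ b) =
        real a * expectation (\<lambda>\<omega>. ?A \<omega> ^ (a - 1) * ?B \<omega> ^ b) + \<rho> * real b * expectation (\<lambda>\<omega>. ?A \<omega> ^ a * ?B \<omega> ^ (b - 1))" for a b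
      using bivariate_wick[OF g(1) _ _ int, of a b] ell_mean N ell_var[of i j] ell_cov[of i j] False by simp
    have W': "expectation (\<lambda>\<omega>. ?A \<omega> ^ b * ?B \<omega> ^ Suc a) =
        real a * expectation (\<lambda>\<omega>. ?A \<omega> ^ b * ?B \<omega> ^ (a - 1)) + \<rho> * real b * expectation (\<lambda>\<omega>. ?A \<omega> ^ (b - 1) * ?B \<omega> ^ a)" for a b
      using bivariate_wick[OF g(2) _ _ int(2,1), of a b] ell_mean N ell_var[of j i] ell_cov[of j i] False
      by (simp add: mult.commute)
    show ?thesis
      unfolding ij(1) sum_mset_pair[OF lt] using e_cases
    proof
      assume "e = (i, j)"
      then show "factor_mean (add_mset e es) (i, j) =
        real (count es (i, j)) * (elliptic_cov \<rho> e (i, j) * factor_mean (es - {#(i, j)#}) (i, j)) +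
        real (count es (j, i)) * (elliptic_cov \<rho> e (j, i) * factor_mean (es - {#(j, i)#}) (i, j))"
        using False W[of "count es (i, j)" "count es (j, i)"]
        by (simp add: factor_mean_def pair_factor_def elliptic_cov_def)
    next
      assume "e = (j, i)"
      then show "factor_mean (add_mset e es) (i, j) =
        real (count es (i, j)) * (elliptic_cov \<rho> e (i, j) * factor_mean (es - {#(i, j)#}) (i, j)) +
        real (count es (j, i)) * (elliptic_cov \<rho> e (j, i) * factor_mean (es - {#(j, i)#}) (i, j))"
        using False W'[of "count es (i, j)" "count es (j, i)"]
        by (simp add: factor_mean_def pair_factor_def elliptic_cov_def)
    qed
  qed
qed

text \<open>Only the block of \<open>e\<close> changes. Partners in that block come from
  \<open>factor_mean_wick\<close>, and the other blocks stay as common factors.\<close>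

lemma ell_wick:
  assumes N: "N \<ge> 1" and e: "e \<in> {..<N} \<times> {..<N}" and es: "set_mset es \<subseteq> {..<N} \<times> {..<N}"
  shows "expectation (\<lambda>\<omega>. entry_monomial (X \<omega>) (add_mset e es)) =
    (\<Sum>e'\<in>#es. elliptic_cov \<rho> e e' * expectation (\<lambda>\<omega>. entry_monomial (X \<omega>) (es - {#e'#})))"
proof -
  have fin: "finite upper"
    by (rule finite_subset[of _ "{..<N} \<times> {..<N}"]) auto
  define p where "p = unordered e"
  have p: "p \<in> upper" using e by (cases e) (auto simp: p_def unordered_def)
  define R where "R = (\<Prod>q\<in>upper - {p}. factor_mean es q)"
  have split: "expectation (\<lambda>\<omega>. entry_monomial (X \<omega>) es') = factor_mean es' p * (\<Prod>q\<in>upper - {p}. factor_mean es' q)"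
    if "set_mset es' \<subseteq> {..<N} \<times> {..<N}" for es'
    unfolding ell_monomial(2)[OF N that] by (rule prod.remove[OF fin p])
  have R1: "(\<Prod>q\<in>upper - {p}. factor_mean (add_mset e es) q) = R"
    unfolding R_def
    by (intro prod.cong refl) (auto simp: factor_mean_def pair_factor_add p_def)
  have R2: "(\<Prod>q\<in>upper - {p}. factor_mean (es - {#e'#}) q) = R" if "unordered e' = p" for e'
    unfolding R_def using that
    by (intro prod.cong refl) (auto simp: factor_mean_def pair_factor_diff)
  have "expectation (\<lambda>\<omega>. entry_monomial (X \<omega>) (add_mset e es)) = factor_mean (add_mset e es) p * R"
    using split[of "add_mset e es"] e es by (simp add: R1)
  also have "\<dots> = (\<Sum>e'\<in>#filter_mset (\<lambda>e'. unordered e' = p) es. elliptic_cov \<rho> e e' * factor_mean (es - {#e'#}) p) * R"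
    unfolding p_def factor_mean_wick[OF e] ..
  also have "\<dots> = (\<Sum>e'\<in>#filter_mset (\<lambda>e'. unordered e' = p) es. elliptic_cov \<rho> e e' * expectation (\<lambda>\<omega>. entry_monomial (X \<omega>) (es - {#e'#})))"
    unfolding sum_mset_distrib_right
  proof (intro arg_cong[of _ _ sum_mset] image_mset_cong)
    fix e' assume "e' \<in># filter_mset (\<lambda>e'. unordered e' = p) es"
    moreover have "set_mset (es - {#e'#}) \<subseteq> {..<N} \<times> {..<N}" using es by (auto dest: in_diffD)
    ultimately show "elliptic_cov \<rho> e e' * factor_mean (es - {#e'#}) p * R = elliptic_cov \<rho> e e' * expectation (\<lambda>\<omega>. entry_monomial (X \<omega>) (es - {#e'#}))"
      using split[of "es - {#e'#}"] R2[of e'] by simp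
  qed
  also have "\<dots> = (\<Sum>e'\<in>#es. if unordered e' = p then elliptic_cov \<rho> e e' * expectation (\<lambda>\<omega>. entry_monomial (X \<omega>) (es - {#e'#})) else 0)"
  proof -
    have "(\<Sum>e'\<in>#filter_mset P K. f e') = (\<Sum>e'\<in>#K. if P e' then f e' else 0)" for P K and f :: "nat \<times> nat \<Rightarrow> real"
      by (induction K) auto
    then show ?thesis .
  qed
  also have "\<dots> = (\<Sum>e'\<in>#es. elliptic_cov \<rho> e e' * expectation (\<lambda>\<omega>. entry_monomial (X \<omega>) (es - {#e'#})))"
    \<comment> \<open>Partners in other blocks are uncorrelated with \<open>e\<close>, so the sum
      may be extended to all of \<open>es\<close>.\<close>
    by (intro arg_cong[of _ _ sum_mset] image_mset_cong) (auto simp: p_def elliptic_cov_eq_0)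
  finally show ?thesis .
qed

end

subsection \<open>Eigenvalues of random symmetric matrices\<close>

definition mat_trace :: "'a::comm_monoid_add mat \<Rightarrow> 'a" where
  "mat_trace A = (\<Sum>i<dim_row A. A $$ (i, i))"

lemma mult_mat_entry:
  assumes "A \<in> carrier_mat n n" "B \<in> carrier_mat n n" "i < n" "j < n"
  shows "(A * B) $$ (i, j) = (\<Sum>k<n. A $$ (i, k) * B $$ (k, j))"
proof -
  have "(A * B) $$ (i, j) = (\<Sum>k = 0..<n. A $$ (i, k) * B $$ (k, j))"
    using assms by (auto simp: scalar_prod_def intro!: sum.cong)
  then show ?thesis by (simp only: atLeast0LessThan)
qed

lemma mat_trace_mult_commute:
  fixes A B :: "'a::comm_semiring_0 mat"
  assumes "A \<in> carrier_mat n n" "B \<in> carrier_mat n n"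
  shows "mat_trace (A * B) = mat_trace (B * A)"
proof -
  have "mat_trace (A * B) = (\<Sum>i<n. \<Sum>k<n. A $$ (i, k) * B $$ (k, i))"
    unfolding mat_trace_def using assms by (intro sum.cong) (auto simp: mult_mat_entry[OF assms] simp del: index_mult_mat(1))
  also have "\<dots> = (\<Sum>k<n. \<Sum>i<n. A $$ (i, k) * B $$ (k, i))" by (rule sum.swap)
  also have "\<dots> = mat_trace (B * A)"
    unfolding mat_trace_def using assms
    by (intro sum.cong) (auto simp: mult_mat_entry[OF assms(2,1)] mult.commute simp del: index_mult_mat(1))
  finally show ?thesis .
qed

lemma mat_trace_similar:
  fixes A B :: "'a::comm_ring_1 mat"
  assumes "similar_mat_wit A B P Q" "A \<in> carrier_mat n n"
  shows "mat_trace A = mat_trace B"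
proof -
  note w = similar_mat_witD2[OF assms(2,1)]
  have "mat_trace A = mat_trace (P * (B * Q))" using w by (simp add: assoc_mult_mat[of _ n n _ n _ n])
  also have "\<dots> = mat_trace (B * Q * P)" using w by (intro mat_trace_mult_commute[of _ n]) auto
  also have "B * Q * P = B" using w by (simp add: assoc_mult_mat[of _ n n _ n _ n])
  finally show ?thesis .
qed

lemma upper_triangular_mult:
  fixes A B :: "'a::comm_ring_1 mat"
  assumes A: "A \<in> carrier_mat n n" "upper_triangular A" and B: "B \<in> carrier_mat n n" "upper_triangular B"
  shows "upper_triangular (A * B)" and "i < n \<Longrightarrow> (A * B) $$ (i, i) = A $$ (i, i) * B $$ (i, i)"
proof -
  have z: "A $$ (i, j) = 0" "B $$ (i, j) = 0" if "j < i" "i < n" for i j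
    using upper_triangularD[OF A(2), of j i] upper_triangularD[OF B(2), of j i] A(1) B(1) that by auto
  show "upper_triangular (A * B)"
  proof (rule upper_triangularI)
    fix i j assume ij: "j < i" "i < dim_row (A * B)"
    then have n: "i < n" "j < n" using A by auto
    show "(A * B) $$ (i, j) = 0"
      unfolding mult_mat_entry[OF A(1) B(1) n]
    proof (intro sum.neutral ballI)
      fix k assume "k \<in> {..<n}"
      then show "A $$ (i, k) * B $$ (k, j) = 0" using z(1)[of k i] z(2)[of j k] ij n by (cases "k < i") auto
    qed
  qed
  assume i: "i < n"
  have "(A * B) $$ (i, i) = (\<Sum>k<n. if k = i then A $$ (i, i) * B $$ (i, i) else 0)"
    unfolding mult_mat_entry[OF A(1) B(1) i i]
  proof (intro sum.cong refl)
    fix k assume "k \<in> {..<n}"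
    then show "A $$ (i, k) * B $$ (k, i) = (if k = i then A $$ (i, i) * B $$ (i, i) else 0)"
      using z(1)[of k i] z(2)[of i k] i by (cases k i rule: linorder_cases) auto
  qed
  then show "(A * B) $$ (i, i) = A $$ (i, i) * B $$ (i, i)" using i by simp
qed

lemma upper_triangular_pow:
  fixes A :: "'a::comm_ring_1 mat"
  assumes A: "A \<in> carrier_mat n n" "upper_triangular A"
  shows "upper_triangular (A ^\<^sub>m k) \<and> (\<forall>i<n. (A ^\<^sub>m k) $$ (i, i) = A $$ (i, i) ^ k)"
proof (induction k)
  case 0
  then show ?case using A by (auto intro!: upper_triangularI)
next
  case (Suc k)
  have "A ^\<^sub>m k \<in> carrier_mat n n" using A by (rule_tac pow_carrier_mat)
  then show ?case using Suc A upper_triangular_mult[of "A ^\<^sub>m k" n A] by (simp add: mult.commute del: index_mult_mat(1))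
qed

lemma proots_linear_factors: "proots (\<Prod>e\<leftarrow>es. [:- e, 1:]) = mset (es :: 'a::field list)"
proof (induction es)
  case (Cons a es)
  have "(\<Prod>e\<leftarrow>es. [:- e, 1:]) \<noteq> 0" by (auto simp: prod_list_zero_iff)
  then have "proots ([:- a, 1:] * (\<Prod>e\<leftarrow>es. [:- e, 1:])) = proots [:- a, 1:] + proots (\<Prod>e\<leftarrow>es. [:- e, 1:])"
    by (intro proots_mult) auto
  then show ?case using Cons by simp
qed simp

text \<open>The split characteristic polynomial permits a Schur triangularisation over the given
  field. Powers of a triangular matrix have the powers of its diagonal on theirs, and that diagonal
  lists the roots.\<close>

lemma mat_trace_pow_char_poly:
  fixes A :: "'a::conjugatable_ordered_field mat"
  assumes A: "A \<in> carrier_mat n n" and cp: "char_poly A = (\<Prod>e\<leftarrow>es. [:- e, 1:])"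
  shows "mat_trace (A ^\<^sub>m k) = (\<Sum>e\<leftarrow>es. e ^ k)"
proof -
  obtain B where B: "B \<in> carrier_mat n n" "upper_triangular B" "similar_mat A B"
    using schur_decomposition_exists[OF A cp] by blast
  obtain P Q where "similar_mat_wit A B P Q" using B(3) by (auto simp: similar_mat_def)
  then have "similar_mat_wit (A ^\<^sub>m k) (B ^\<^sub>m k) P Q" by (rule similar_mat_wit_pow)
  then have "mat_trace (A ^\<^sub>m k) = mat_trace (B ^\<^sub>m k)"
    using A by (intro mat_trace_similar[of _ _ P Q n]) auto
  also have "\<dots> = (\<Sum>i<n. B $$ (i, i) ^ k)"
    unfolding mat_trace_def using upper_triangular_pow[OF B(1,2), of k] B(1) by (intro sum.cong) auto
  also have "\<dots> = (\<Sum>e\<leftarrow>diag_mat B. e ^ k)"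
    using B(1) by (simp add: diag_mat_def sum_list_sum_nth atLeast0LessThan o_def)
  also have "\<dots> = (\<Sum>e\<in>#mset (diag_mat B). e ^ k)"
    by (metis mset_map sum_mset_sum_list)
  also have "mset (diag_mat B) = proots (char_poly B)"
    unfolding char_poly_upper_triangular[OF B(1,2)] by (rule proots_linear_factors[symmetric])
  also have "char_poly B = char_poly A" using char_poly_similar[OF B(3)] by simp
  also have "proots (char_poly A) = mset es"
    unfolding cp by (rule proots_linear_factors)
  finally show ?thesis by (metis mset_map sum_mset_sum_list)
qed

text \<open>The Hermitian form \<open>s\<close> at an eigenvector is real by symmetry and equals k
  times the positive squared norm \<open>q\<close>.\<close>

lemma eigenvalue_symmetric_real:
  fixes A :: "real mat"
  assumes A: "A \<in> carrier_mat n n" and sym: "\<And>i j. i < n \<Longrightarrow> j < n \<Longrightarrow> A $$ (i, j) = A $$ (j, i)"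
    and ev: "eigenvalue (map_mat complex_of_real A) k"
  shows "k \<in> \<real>"
proof -
  let ?B = "map_mat complex_of_real A"
  obtain v where v: "v \<in> carrier_vec n" "v \<noteq> 0\<^sub>v n" "?B *\<^sub>v v = k \<cdot>\<^sub>v v"
    using ev A by (auto simp: eigenvalue_def eigenvector_def)
  have Bv: "(\<Sum>j<n. of_real (A $$ (i, j)) * v $ j) = k * v $ i" if "i < n" for i
  proof -
    have "(?B *\<^sub>v v) $ i = (\<Sum>j = 0..<n. of_real (A $$ (i, j)) * v $ j)"
      using A v(1) that by (auto simp: scalar_prod_def intro!: sum.cong)
    moreover have "(?B *\<^sub>v v) $ i = k * v $ i" unfolding v(3) using v(1) that by simp
    ultimately show ?thesis by (simp add: atLeast0LessThan)
  qed
  define s where "s = (\<Sum>i<n. \<Sum>j<n. cnj (v $ i) * (of_real (A $$ (i, j)) * v $ j))"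
  define q where "q = (\<Sum>i<n. (cmod (v $ i))\<^sup>2)"
  have "s = (\<Sum>i<n. cnj (v $ i) * (k * v $ i))"
    unfolding s_def by (intro sum.cong refl) (simp add: sum_distrib_left[symmetric] Bv)
  also have "\<dots> = k * of_real q"
    unfolding q_def of_real_sum complex_norm_square by (simp add: sum_distrib_left mult_ac)
  finally have s: "s = k * of_real q" .
  have "cnj s = (\<Sum>i<n. \<Sum>j<n. v $ i * (of_real (A $$ (i, j)) * cnj (v $ j)))"
    by (simp add: s_def)
  also have "\<dots> = (\<Sum>j<n. \<Sum>i<n. v $ i * (of_real (A $$ (i, j)) * cnj (v $ j)))" by (rule sum.swap)
  also have "\<dots> = s"
    unfolding s_def by (intro sum.cong refl) (use sym in \<open>auto simp: mult_ac\<close>)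
  finally have "s \<in> \<real>" by (simp add: Reals_cnj_iff)
  have "q \<noteq> 0"
  proof
    assume "q = 0"
    then have "\<forall>i<n. v $ i = 0" unfolding q_def by (subst (asm) sum_nonneg_eq_0_iff) auto
    then show False using v by (auto simp: vec_eq_iff)
  qed
  then have "k = s / of_real q" using s by simp
  then show ?thesis using \<open>s \<in> \<real>\<close> by simp
qed

text \<open>Over the complex numbers the polynomial factors; its roots are real, and the embedding
  of real polynomials is injective.\<close>

lemma char_poly_symmetric_splits:
  fixes A :: "real mat"
  assumes A: "A \<in> carrier_mat n n" and sym: "\<And>i j. i < n \<Longrightarrow> j < n \<Longrightarrow> A $$ (i, j) = A $$ (j, i)"
  obtains es where "char_poly A = (\<Prod>e\<leftarrow>es. [:- e, 1:])" "length es = n"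
proof -
  let ?B = "map_mat complex_of_real A"
  have B: "?B \<in> carrier_mat n n" using A by simp
  obtain as where as: "char_poly ?B = (\<Prod>a\<leftarrow>as. [:- a, 1:])" "length as = n"
    using char_poly_factorized[OF B] by blast
  have real: "a \<in> \<real>" if "a \<in> set as" for a
  proof -
    have "poly (char_poly ?B) a = 0" unfolding as(1) using that by (auto simp: poly_prod_list prod_list_zero_iff)
    then show ?thesis
      using eigenvalue_symmetric_real[OF A sym] eigenvalue_root_char_poly[OF B] by blast
  qed
  define es where "es = map Re as"
  have as_es: "as = map complex_of_real es" unfolding es_def using real
    by (induction as) auto
  interpret h: map_poly_inj_idom_hom complex_of_real ..
  have "map_poly complex_of_real (char_poly A) = map_poly complex_of_real (\<Prod>e\<leftarrow>es. [:- e, 1:])"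
  proof -
    have "map_poly complex_of_real (char_poly A) = char_poly ?B"
      by (rule of_real_hom.char_poly_hom[OF A, symmetric])
    also have "\<dots> = map_poly complex_of_real (\<Prod>e\<leftarrow>es. [:- e, 1:])"
      unfolding as(1) as_es by (simp add: h.hom_prod_list o_def)
    finally show ?thesis .
  qed
  then have "char_poly A = (\<Prod>e\<leftarrow>es. [:- e, 1:])" by simp
  then show thesis by (rule that) (use as(2) in \<open>simp add: es_def\<close>)
qed

section \<open>Ordered eigenvalues and their measurability\<close>

definition eigvals :: "real mat \<Rightarrow> real list" where
  "eigvals A = sorted_list_of_multiset (proots (char_poly A))"

lemma eigvals_symmetric:
  fixes A :: "real mat"
  assumes A: "A \<in> carrier_mat n n" and sym: "\<And>i j. i < n \<Longrightarrow> j < n \<Longrightarrow> A $$ (i, j) = A $$ (j, i)"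
  shows "length (eigvals A) = n" and "sorted (eigvals A)"
    and "mat_trace (A ^\<^sub>m k) = (\<Sum>i<n. eigvals A ! i ^ k)"
    and "size {# l \<in># proots (char_poly A). l \<le> x #} = card {i. i < n \<and> eigvals A ! i \<le> x}"
proof -
  obtain es where es: "char_poly A = (\<Prod>e\<leftarrow>es. [:- e, 1:])" "length es = n"
    using char_poly_symmetric_splits[OF A sym] by blast
  have pr: "proots (char_poly A) = mset es"
    unfolding es(1) by (rule proots_linear_factors)
  have eg: "eigvals A = sort es" by (simp add: eigvals_def pr sorted_list_of_multiset_mset)
  show len: "length (eigvals A) = n" "sorted (eigvals A)" using es(2) by (simp_all add: eg)
  have "mat_trace (A ^\<^sub>m k) = (\<Sum>e\<in>#mset es. e ^ k)"
    using mat_trace_pow_char_poly[OF A es(1)] by (metis mset_map sum_mset_sum_list)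
  also have "mset es = mset (eigvals A)" by (simp add: eg)
  also have "(\<Sum>e\<in>#mset (eigvals A). e ^ k) = (\<Sum>e\<leftarrow>eigvals A. e ^ k)" by (metis mset_map sum_mset_sum_list)
  also have "\<dots> = (\<Sum>i<n. eigvals A ! i ^ k)" using len by (simp add: sum_list_sum_nth atLeast0LessThan)
  finally show "mat_trace (A ^\<^sub>m k) = (\<Sum>i<n. eigvals A ! i ^ k)" .
  have "{# l \<in># proots (char_poly A). l \<le> x #} = mset (filter (\<lambda>l. l \<le> x) (eigvals A))"
    by (simp add: pr eg)
  then have "size {# l \<in># proots (char_poly A). l \<le> x #} = length (filter (\<lambda>l. l \<le> x) (eigvals A))"
    by (metis size_mset)
  then show "size {# l \<in># proots (char_poly A). l \<le> x #} = card {i. i < n \<and> eigvals A ! i \<le> x}"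
    using len by (simp add: length_filter_conv_card)
qed

text \<open>Order statistics are determined by counts; this carries measurability over from the
  counting function to single eigenvalues.\<close>

lemma sorted_nth_le_iff_card:
  fixes xs :: "'a::linorder list"
  assumes "sorted xs" "i < length xs"
  shows "xs ! i \<le> x \<longleftrightarrow> Suc i \<le> card {j. j < length xs \<and> xs ! j \<le> x}"
proof
  assume "xs ! i \<le> x"
  then have "{..i} \<subseteq> {j. j < length xs \<and> xs ! j \<le> x}"
    using assms sorted_nth_mono[OF assms(1)] by (auto intro: order.trans)
  from card_mono[OF _ this] show "Suc i \<le> card {j. j < length xs \<and> xs ! j \<le> x}" by simp
next
  assume c: "Suc i \<le> card {j. j < length xs \<and> xs ! j \<le> x}"
  show "xs ! i \<le> x"
  proof (rule ccontr)
    assume n: "\<not> xs ! i \<le> x"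
    have "{j. j < length xs \<and> xs ! j \<le> x} \<subseteq> {..<i}"
    proof
      fix j assume j: "j \<in> {j. j < length xs \<and> xs ! j \<le> x}"
      show "j \<in> {..<i}"
      proof (rule ccontr)
        assume "j \<notin> {..<i}"
        then have "xs ! i \<le> xs ! j" using j sorted_nth_mono[OF assms(1)] by auto
        then show False using j n by auto
      qed
    qed
    from card_mono[OF _ this] show False using c by simp
  qed
qed

text \<open>Pointwise convergence is enough, so Weierstrass approximation may be used on the growing
  intervals [-n, n] with error 1 / (n + 1).\<close>

lemma polynomials_tendsto_indicator:
  fixes x :: real
  obtains p :: "nat \<Rightarrow> real poly" where "\<And>y. (\<lambda>n. poly (p n) y) \<longlonglongrightarrow> indicator {..x} y"
proof -
  \<comment> \<open>Continuous ramps: 1 up to x, then linear, and 0 from x + 1 / n on.\<close>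
  define f where "f n y = max 0 (min 1 (1 - real n * (y - x)))" for n y
  have "\<exists>p :: real poly. \<forall>y\<in>{- real n..real n}. \<bar>f n y - poly p y\<bar> < 1 / real (Suc n)" for n
  proof -
    have "continuous_on {- real n..real n} (f n)" unfolding f_def by (intro continuous_intros)
    then obtain g where g: "real_polynomial_function g" "\<And>y. y \<in> {- real n..real n} \<Longrightarrow> \<bar>f n y - g y\<bar> < 1 / real (Suc n)"
      using Stone_Weierstrass_real_polynomial_function[of "{- real n..real n}" "f n" "1 / real (Suc n)"] by auto
    obtain a m where "g = (\<lambda>y. \<Sum>i\<le>m. a i * y ^ i)" using g(1) real_polynomial_function_iff_sum by blast
    then have "g = poly (\<Sum>i\<le>m. monom (a i) i)" by (simp add: poly_sum poly_monom fun_eq_iff)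
    then show ?thesis using g(2) by blast
  qed
  then obtain p where p: "\<And>n y. y \<in> {- real n..real n} \<Longrightarrow> \<bar>f n y - poly (p n) y\<bar> < 1 / real (Suc n)"
    by metis
  have "(\<lambda>n. poly (p n) y) \<longlonglongrightarrow> indicator {..x} y" for y
  proof -
    obtain n0 where n0: "\<bar>y\<bar> \<le> real n0" using real_arch_simple by blast
    have "(\<lambda>n. f n y - poly (p n) y) \<longlonglongrightarrow> 0"
    proof (rule Lim_null_comparison)
      show "\<forall>\<^sub>F n in sequentially. norm (f n y - poly (p n) y) \<le> 1 / real (Suc n)"
      proof (intro eventually_sequentiallyI[of n0])
        fix n assume "n0 \<le> n"
        then have "real n0 \<le> real n" by simp
        then have "y \<in> {- real n..real n}" using n0 by auto
        from p[OF this] show "norm (f n y - poly (p n) y) \<le> 1 / real (Suc n)" by simp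
      qed
      show "(\<lambda>n. 1 / real (Suc n)) \<longlonglongrightarrow> 0"
        using LIMSEQ_inverse_real_of_nat by (simp add: inverse_eq_divide)
    qed
    moreover have "(\<lambda>n. f n y) \<longlonglongrightarrow> indicator {..x} y"
    proof (rule tendsto_eventually)
      show "\<forall>\<^sub>F n in sequentially. f n y = indicator {..x} y"
      proof (cases "y \<le> x")
        case True
        have "f n y = 1" for n using True by (simp add: f_def max_def min_def mult_nonneg_nonpos)
        then show ?thesis using True by simp
      next
        case False
        obtain n1 where n1: "1 / (y - x) \<le> real n1" using real_arch_simple by blast
        have "f n y = 0" if "n \<ge> n1" for n
        proof -
          have "1 / (y - x) \<le> real n" using n1 that by linarith
          then have "1 \<le> real n * (y - x)" using False by (simp add: divide_le_eq)
          then show ?thesis by (simp add: f_def)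
        qed
        then show ?thesis using False by (intro eventually_sequentiallyI[of n1]) auto
      qed
    qed
    ultimately have "(\<lambda>n. f n y - (f n y - poly (p n) y)) \<longlonglongrightarrow> indicator {..x} y - 0" by (intro tendsto_diff)
    then show ?thesis by simp
  qed
  then show thesis using that by blast
qed

text \<open>The eigenvalue counts are limits of traces of polynomials of the matrix, and hence measurable.\<close>

lemma eigvals_measurable:
  fixes A :: "'a \<Rightarrow> real mat"
  assumes A: "\<And>\<omega>. \<omega> \<in> space M \<Longrightarrow> A \<omega> \<in> carrier_mat n n"
    and sym: "\<And>\<omega> i j. \<omega> \<in> space M \<Longrightarrow> i < n \<Longrightarrow> j < n \<Longrightarrow> A \<omega> $$ (i, j) = A \<omega> $$ (j, i)"
    and meas: "\<And>k. (\<lambda>\<omega>. mat_trace (A \<omega> ^\<^sub>m k)) \<in> borel_measurable M"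
    and i: "i < n"
  shows "(\<lambda>\<omega>. eigvals (A \<omega>) ! i) \<in> borel_measurable M"
proof -
  have poly_meas: "(\<lambda>\<omega>. \<Sum>i<n. poly p (eigvals (A \<omega>) ! i)) \<in> borel_measurable M" for p
  proof -
    have "(\<lambda>\<omega>. \<Sum>k\<le>degree p. coeff p k * mat_trace (A \<omega> ^\<^sub>m k)) \<in> borel_measurable M"
      using meas by measurable
    moreover have "(\<Sum>k\<le>degree p. coeff p k * mat_trace (A \<omega> ^\<^sub>m k)) = (\<Sum>i<n. poly p (eigvals (A \<omega>) ! i))"
      if "\<omega> \<in> space M" for \<omega>
    proof -
      have "mat_trace (A \<omega> ^\<^sub>m k) = (\<Sum>i<n. eigvals (A \<omega>) ! i ^ k)" for k
        by (rule eigvals_symmetric(3)[OF A[OF that] sym[OF that]])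
      then show ?thesis by (simp only: poly_altdef sum_distrib_left) (rule sum.swap)
    qed
    ultimately show ?thesis by (simp cong: measurable_cong)
  qed
  have count_meas: "(\<lambda>\<omega>. real (card {j. j < n \<and> eigvals (A \<omega>) ! j \<le> x})) \<in> borel_measurable M" for x
  proof -
    obtain p where p: "\<And>y. (\<lambda>m. poly (p m) y) \<longlonglongrightarrow> indicator {..x} (y::real)"
      using polynomials_tendsto_indicator by blast
    show ?thesis
    proof (rule borel_measurable_LIMSEQ_real[OF _ poly_meas])
      fix \<omega>
      have "(\<lambda>m. \<Sum>i<n. poly (p m) (eigvals (A \<omega>) ! i)) \<longlonglongrightarrow> (\<Sum>i<n. indicator {..x} (eigvals (A \<omega>) ! i))"
        by (intro tendsto_sum p)
      also have "(\<Sum>i<n. indicator {..x} (eigvals (A \<omega>) ! i)) = real (card {j. j < n \<and> eigvals (A \<omega>) ! j \<le> x})"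
      proof -
        have "(\<Sum>i<n. indicator {..x} (eigvals (A \<omega>) ! i)) = (\<Sum>i\<in>{..<n}. if eigvals (A \<omega>) ! i \<le> x then 1 else 0 :: real)"
          by (intro sum.cong) (auto simp: indicator_def)
        also have "\<dots> = real (card ({..<n} \<inter> {j. eigvals (A \<omega>) ! j \<le> x}))"
          by (simp add: sum.If_cases)
        also have "{..<n} \<inter> {j. eigvals (A \<omega>) ! j \<le> x} = {j. j < n \<and> eigvals (A \<omega>) ! j \<le> x}" by auto
        finally show ?thesis .
      qed
      finally show "(\<lambda>m. \<Sum>i<n. poly (p m) (eigvals (A \<omega>) ! i)) \<longlonglongrightarrow> real (card {j. j < n \<and> eigvals (A \<omega>) ! j \<le> x})" .
    qed
  qed
  show ?thesis
    unfolding borel_measurable_iff_le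
  proof
    fix x
    have "{\<omega> \<in> space M. eigvals (A \<omega>) ! i \<le> x} = {\<omega> \<in> space M. real (Suc i) \<le> real (card {j. j < n \<and> eigvals (A \<omega>) ! j \<le> x})}"
      using sorted_nth_le_iff_card[of "eigvals (A \<omega>)" i x for \<omega>] eigvals_symmetric(1,2)[OF A sym] i by auto
    also have "\<dots> \<in> sets M" using count_meas[of x] by measurable
    finally show "{\<omega> \<in> space M. eigvals (A \<omega>) ! i \<le> x} \<in> sets M" .
  qed
qed

text \<open>The law of f I, where I is uniform on {0..<n} and independent of the sample point of M.\<close>

definition mixture :: "'a measure \<Rightarrow> nat \<Rightarrow> (nat \<Rightarrow> 'a \<Rightarrow> real) \<Rightarrow> real measure" where
  "mixture M n f = distr (uniform_count_measure {..<n} \<Otimes>\<^sub>M M) borel (\<lambda>(i, \<omega>). f i \<omega>)"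

lemma mixture:
  fixes g :: "real \<Rightarrow> real"
  assumes M: "prob_space M" and n: "n \<ge> 1" and f: "\<And>i. i < n \<Longrightarrow> f i \<in> borel_measurable M"
  shows "real_distribution (mixture M n f)"
    and "g \<in> borel_measurable borel \<Longrightarrow> (\<And>i. i < n \<Longrightarrow> integrable M (\<lambda>\<omega>. g (f i \<omega>))) \<Longrightarrow> integrable (mixture M n f) g"
    and "g \<in> borel_measurable borel \<Longrightarrow> (\<And>i. i < n \<Longrightarrow> integrable M (\<lambda>\<omega>. g (f i \<omega>))) \<Longrightarrow>
      integral\<^sup>L (mixture M n f) g = (\<Sum>i<n. LINT \<omega>|M. g (f i \<omega>)) / real n"
proof -
  let ?U = "uniform_count_measure {..<n}"
  interpret M: prob_space M by fact
  interpret U: prob_space ?U using n by (intro prob_space_uniform_count_measure) (auto simp: lessThan_empty_iff)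
  interpret P: pair_prob_space ?U M ..
  have fm: "(\<lambda>(i, \<omega>). f i \<omega>) \<in> borel_measurable (?U \<Otimes>\<^sub>M M)"
  proof -
    have "(\<lambda>(i, \<omega>). f i \<omega>) \<in> borel_measurable (count_space {..<n} \<Otimes>\<^sub>M M)"
      by (rule measurable_pair_measure_countable1) (use f in auto)
    also have "borel_measurable (count_space {..<n} \<Otimes>\<^sub>M M) = borel_measurable (?U \<Otimes>\<^sub>M M)"
      by (intro measurable_cong_sets sets_pair_measure_cong) (auto simp: sets_uniform_count_measure)
    finally show ?thesis .
  qed
  show "real_distribution (mixture M n f)"
    unfolding mixture_def using fm by (rule P.real_distribution_distr)
  assume g: "g \<in> borel_measurable borel" and int: "\<And>i. i < n \<Longrightarrow> integrable M (\<lambda>\<omega>. g (f i \<omega>))"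
  have gf: "(\<lambda>(i, \<omega>). g (f i \<omega>)) \<in> borel_measurable (?U \<Otimes>\<^sub>M M)"
    using measurable_compose[OF fm g] by (simp add: case_prod_unfold)
  have intU: "integrable ?U h" for h :: "nat \<Rightarrow> real"
    unfolding uniform_count_measure_def by (rule integrable_point_measure_finite) simp
  have "integrable (?U \<Otimes>\<^sub>M M) (\<lambda>(i, \<omega>). g (f i \<omega>))"
    by (rule P.Fubini_integrable[OF gf intU]) (use int in \<open>auto simp: space_uniform_count_measure\<close>)
  note I = this
  then show "integrable (mixture M n f) g"
    unfolding mixture_def using fm g by (subst integrable_distr_eq) (auto simp: case_prod_unfold)
  have "integral\<^sup>L (mixture M n f) g = integral\<^sup>L (?U \<Otimes>\<^sub>M M) (\<lambda>(i, \<omega>). g (f i \<omega>))"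
    unfolding mixture_def using fm g by (subst integral_distr) (auto simp: case_prod_unfold)
  also have "\<dots> = (LINT i|?U. LINT \<omega>|M. g (f i \<omega>))"
    using P.integral_fst'[OF I] by simp
  also have "\<dots> = (\<Sum>i<n. LINT \<omega>|M. g (f i \<omega>)) / real n"
    by (simp add: integral_uniform_count_measure)
  finally show "integral\<^sup>L (mixture M n f) g = (\<Sum>i<n. LINT \<omega>|M. g (f i \<omega>)) / real n" .
qed

subsection \<open>Convergence of the spectral distribution\<close>

fun word_mat :: "nat \<Rightarrow> real mat \<Rightarrow> bool list \<Rightarrow> real mat" where
  "word_mat N A [] = 1\<^sub>m N"
| "word_mat N A (l # w) = (if l then A else transpose_mat A) * word_mat N A w"

lemma word_mat_carrier [simp]: "A \<in> carrier_mat N N \<Longrightarrow> word_mat N A w \<in> carrier_mat N N"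
  by (induction w) (auto intro!: mult_carrier_mat)

lemma word_mat_append:
  assumes "A \<in> carrier_mat N N"
  shows "word_mat N A (v @ w) = word_mat N A v * word_mat N A w"
proof (induction v)
  case (Cons l v)
  have "(if l then A else transpose_mat A) \<in> carrier_mat N N" using assms by simp
  then show ?case using Cons assms by (simp add: assoc_mult_mat[of _ N N _ N _ N])
qed (simp add: left_mult_one_mat[OF word_mat_carrier[OF assms]])

definition path_maps :: "nat \<Rightarrow> 'v list \<Rightarrow> nat \<Rightarrow> nat \<Rightarrow> ('v \<Rightarrow> nat) set" where
  "path_maps N p a b = {f \<in> set p \<rightarrow>\<^sub>E {..<N}. f (hd p) = a \<and> f (last p) = b}"

text \<open>The summation indices of the matrix product are the labels of the inner vertices of a
  path; its vertices are distinct, so these labels are independent.\<close>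

lemma word_mat_entry:
  assumes A: "A \<in> carrier_mat N N" and p: "distinct p" "length p = Suc (length w)" and ab: "a < N" "b < N"
  shows "word_mat N A w $$ (a, b) = (\<Sum>f\<in>path_maps N p a b. entry_monomial A (image_mset (map_prod f f) (path_edges p w)))"
  using p ab
proof (induction w arbitrary: p a)
  case Nil
  then obtain u where u: "p = [u]" by (cases p) auto
  have "path_maps N p a b = (if a = b then {\<lambda>x\<in>{u}. a} else {})"
    using Nil by (auto simp: path_maps_def u PiE_iff extensional_def fun_eq_iff)
  then show ?case using Nil by (simp add: u entry_monomial_def)
next
  case (Cons l w)
  then obtain u q where p: "p = u # q" and q: "distinct q" "length q = Suc (length w)" "u \<notin> set q"
    by (cases p) auto
  have ne: "q \<noteq> []" using q by auto
  let ?L = "if l then A else transpose_mat A"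
  \<comment> \<open>Labellings of the tail with only the right end prescribed. The label of the head
    of the tail is the summation index c.\<close>
  define D where "D = {g \<in> set q \<rightarrow>\<^sub>E {..<N}. g (last q) = b}"
  define h where "h g = A $$ orient l a (g (hd q)) * entry_monomial A (image_mset (map_prod g g) (path_edges q w))" for g
  have finD: "finite D" unfolding D_def by (intro finite_Collect_conjI disjI1) (auto simp: finite_PiE)
  have L: "?L \<in> carrier_mat N N" "\<And>c. c < N \<Longrightarrow> ?L $$ (a, c) = A $$ orient l a c"
    using A Cons.prems by (auto simp: orient_def)
  have "word_mat N A (l # w) $$ (a, b) = (\<Sum>c<N. ?L $$ (a, c) * word_mat N A w $$ (c, b))"
    unfolding word_mat.simps by (rule mult_mat_entry[OF L(1)]) (use A Cons.prems in auto)
  also have "\<dots> = (\<Sum>c<N. \<Sum>g | g \<in> D \<and> g (hd q) = c. h g)"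
  proof (intro sum.cong refl)
    fix c assume c: "c \<in> {..<N}"
    have "{g. g \<in> D \<and> g (hd q) = c} = path_maps N q c b" by (auto simp: D_def path_maps_def)
    then show "?L $$ (a, c) * word_mat N A w $$ (c, b) = (\<Sum>g | g \<in> D \<and> g (hd q) = c. h g)"
      using c L(2)[of c] Cons.IH[OF q(1,2), of c] Cons.prems
      by (auto simp: h_def path_maps_def sum_distrib_left intro!: sum.cong)
  qed
  also have "\<dots> = sum h D"
    by (rule sum.group[OF finD]) (use ne in \<open>auto simp: D_def\<close>)
  also have "\<dots> = (\<Sum>f\<in>path_maps N p a b. entry_monomial A (image_mset (map_prod f f) (path_edges p (l # w))))"
  proof (rule sum.reindex_bij_witness[where i="\<lambda>f. restrict f (set q)" and j="\<lambda>g. g(u := a)"])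
    fix g assume g: "g \<in> D"
    show "restrict (g(u := a)) (set q) = g"
      using g q(3) by (auto simp: D_def fun_eq_iff restrict_def PiE_iff extensional_def)
    have last: "last q \<in> set q" using ne by simp
    then have last': "last q \<noteq> u" using q(3) by blast
    have hd: "hd q \<in> set q" using ne by simp
    then have hd': "hd q \<noteq> u" using q(3) by blast
    show "g(u := a) \<in> path_maps N p a b"
      using g ne last last' Cons.prems by (auto simp: p D_def path_maps_def PiE_iff extensional_def)
    have "image_mset (map_prod (g(u := a)) (g(u := a))) (path_edges q w) = image_mset (map_prod g g) (path_edges q w)"
      using path_edges_subset[of q w] q(3) by (intro image_mset_cong) auto
    then show "entry_monomial A (image_mset (map_prod (g(u := a)) (g(u := a))) (path_edges p (l # w))) = h g"
      using ne hd' by (simp add: p path_edges_Cons h_def entry_monomial_def map_prod_orient)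
  next
    fix f assume f: "f \<in> path_maps N p a b"
    show "(restrict f (set q))(u := a) = f"
      using f by (auto simp: p path_maps_def fun_eq_iff restrict_def PiE_iff extensional_def)
    show "restrict f (set q) \<in> D"
      using f ne by (auto simp: p path_maps_def D_def)
  qed
  finally show ?case .
qed

text \<open>The trace equates the two end labels of the path and sums over their common
  value.\<close>

lemma mat_trace_word_mat:
  assumes A: "A \<in> carrier_mat N N" and p: "distinct p" "length p = Suc (length w)"
  shows "mat_trace (word_mat N A w) =
    (\<Sum>f\<in>constrained N (set p) {(hd p, last p)}. entry_monomial A (image_mset (map_prod f f) (path_edges p w)))"
proof -
  let ?C = "constrained N (set p) {(hd p, last p)}"
  let ?h = "\<lambda>f. entry_monomial A (image_mset (map_prod f f) (path_edges p w))"
  have ne: "p \<noteq> []" using p by auto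
  have "mat_trace (word_mat N A w) = (\<Sum>a<N. word_mat N A w $$ (a, a))"
    unfolding mat_trace_def using word_mat_carrier[OF A, of w] by (simp only: carrier_matD)
  also have "\<dots> = (\<Sum>a<N. \<Sum>f | f \<in> ?C \<and> f (hd p) = a. ?h f)"
  proof (intro sum.cong refl)
    fix a assume "a \<in> {..<N}"
    then have "word_mat N A w $$ (a, a) = (\<Sum>f\<in>path_maps N p a a. ?h f)"
      using word_mat_entry[OF A p] by simp
    also have "path_maps N p a a = {f. f \<in> ?C \<and> f (hd p) = a}" by (auto simp: path_maps_def constrained_def)
    finally show "word_mat N A w $$ (a, a) = (\<Sum>f | f \<in> ?C \<and> f (hd p) = a. ?h f)" .
  qed
  also have "\<dots> = sum ?h ?C"
    by (rule sum.group[OF finite_constrained]) (use ne in \<open>auto simp: constrained_def\<close>)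
  finally show ?thesis .
qed

lemma W_mat_word:
  assumes A: "A \<in> carrier_mat N N"
  shows "W_mat N A = (1 / (real N)\<^sup>2) \<cdot>\<^sub>m word_mat N A [True, True, False, False]"
proof -
  have "A ^\<^sub>m 2 = A * A" "transpose_mat A ^\<^sub>m 2 = transpose_mat A * transpose_mat A"
    using A by (simp_all add: numeral_2_eq_2)
  then show ?thesis
    unfolding W_mat_def using A by (simp add: assoc_mult_mat[of _ N N _ N _ N])
qed

lemma W_mat_carrier: "A \<in> carrier_mat N N \<Longrightarrow> W_mat N A \<in> carrier_mat N N"
  unfolding W_mat_word by (intro smult_carrier_mat word_mat_carrier)

lemma W_mat_symmetric:
  assumes A: "A \<in> carrier_mat N N" and ij: "i < N" "j < N"
  shows "W_mat N A $$ (i, j) = W_mat N A $$ (j, i)"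
proof -
  define B where "B = A * A"
  have B: "B \<in> carrier_mat N N" "transpose_mat B \<in> carrier_mat N N" using A by (auto simp: B_def)
  have "transpose_mat A * transpose_mat A = transpose_mat B"
    unfolding B_def using transpose_mult[OF A A] by simp
  moreover have "A ^\<^sub>m 2 = A * A" "transpose_mat A ^\<^sub>m 2 = transpose_mat A * transpose_mat A"
    using A by (simp_all add: numeral_2_eq_2)
  ultimately have W: "W_mat N A = (1 / (real N)\<^sup>2) \<cdot>\<^sub>m (B * transpose_mat B)"
    by (simp add: W_mat_def B_def)
  have "(B * transpose_mat B) $$ (i, j) = (B * transpose_mat B) $$ (j, i)"
    unfolding mult_mat_entry[OF B ij] mult_mat_entry[OF B ij(2,1)]
    using B ij by (intro sum.cong) auto
  then show ?thesis unfolding W using B ij by simp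
qed

lemma block_word_Suc_Suc:
  "block_word True (2 * Suc k) = block_word True (2 * k) @ [True, True, False, False]"
  by (induction k) (simp_all add: numeral_2_eq_2)

lemma W_mat_pow:
  assumes A: "A \<in> carrier_mat N N"
  shows "W_mat N A ^\<^sub>m k = (1 / (real N)\<^sup>2) ^ k \<cdot>\<^sub>m word_mat N A (block_word True (2 * k))"
proof (induction k)
  case 0
  then show ?case using W_mat_carrier[OF A] by auto
next
  case (Suc k)
  let ?c = "1 / (real N)\<^sup>2" and ?u = "word_mat N A (block_word True (2 * k))" and ?v = "word_mat N A [True, True, False, False]"
  have u: "?u \<in> carrier_mat N N" and v: "?v \<in> carrier_mat N N" using A word_mat_carrier by blast+
  have "W_mat N A ^\<^sub>m Suc k = W_mat N A ^\<^sub>m k * W_mat N A" by simp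
  also have "\<dots> = (?c ^ k \<cdot>\<^sub>m ?u) * W_mat N A" unfolding Suc ..
  also have "\<dots> = (?c ^ k \<cdot>\<^sub>m ?u) * (?c \<cdot>\<^sub>m ?v)" unfolding W_mat_word[OF A] ..
  also have "\<dots> = ?c ^ k \<cdot>\<^sub>m (?u * (?c \<cdot>\<^sub>m ?v))"
    by (rule mult_smult_assoc_mat[OF u]) (rule smult_carrier_mat[OF v])
  also have "?u * (?c \<cdot>\<^sub>m ?v) = ?c \<cdot>\<^sub>m (?u * ?v)" by (rule mult_smult_distrib[OF u v])
  also have "?u * ?v = word_mat N A (block_word True (2 * Suc k))"
    unfolding block_word_Suc_Suc word_mat_append[OF A] ..
  also have "?c ^ k \<cdot>\<^sub>m (?c \<cdot>\<^sub>m word_mat N A (block_word True (2 * Suc k))) = ?c ^ Suc k \<cdot>\<^sub>m word_mat N A (block_word True (2 * Suc k))"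
    by (rule eq_matI) auto
  finally show ?case .
qed

lemma mat_trace_W_mat_pow:
  assumes A: "A \<in> carrier_mat N N"
  shows "mat_trace (W_mat N A ^\<^sub>m k) = (1 / (real N)\<^sup>2) ^ k * mat_trace (word_mat N A (block_word True (2 * k)))"
  using carrier_matD[OF word_mat_carrier[OF A, of "block_word True (2 * k)"]]
  unfolding W_mat_pow[OF A] mat_trace_def by (simp add: sum_distrib_left)

lemma elliptic_trace:
  assumes ell: "gaussian_elliptic M N \<rho> X" and N: "N \<ge> 1" and p: "distinct p" "length p = Suc (length w)"
  shows "integrable M (\<lambda>\<omega>. mat_trace (word_mat N (X \<omega>) w))"
    and "(LINT \<omega>|M. mat_trace (word_mat N (X \<omega>) w)) =
      (\<Sum>f\<in>constrained N (set p) {(hd p, last p)}. LINT \<omega>|M. entry_monomial (X \<omega>) (image_mset (map_prod f f) (path_edges p w)))"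
proof -
  let ?C = "constrained N (set p) {(hd p, last p)}"
  let ?h = "\<lambda>f \<omega>. entry_monomial (X \<omega>) (image_mset (map_prod f f) (path_edges p w))"
  have X: "X \<omega> \<in> carrier_mat N N" if "\<omega> \<in> space M" for \<omega> using ell that by (simp add: gaussian_elliptic_def)
  have int: "integrable M (?h f)" if "f \<in> ?C" for f
    by (rule ell_monomial(1)[OF ell N])
      (use that path_edges_subset[of p w] in \<open>auto simp: constrained_def PiE_iff\<close>)
  have eq: "mat_trace (word_mat N (X \<omega>) w) = (\<Sum>f\<in>?C. ?h f \<omega>)" if "\<omega> \<in> space M" for \<omega>
    by (rule mat_trace_word_mat[OF X[OF that] p])
  have "integrable M (\<lambda>\<omega>. \<Sum>f\<in>?C. ?h f \<omega>)" by (intro Bochner_Integration.integrable_sum int)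
  then show "integrable M (\<lambda>\<omega>. mat_trace (word_mat N (X \<omega>) w))"
    by (subst Bochner_Integration.integrable_cong[OF refl eq]) auto
  have "(LINT \<omega>|M. mat_trace (word_mat N (X \<omega>) w)) = (LINT \<omega>|M. (\<Sum>f\<in>?C. ?h f \<omega>))"
    by (intro Bochner_Integration.integral_cong refl eq)
  also have "\<dots> = (\<Sum>f\<in>?C. LINT \<omega>|M. ?h f \<omega>)"
    by (intro Bochner_Integration.integral_sum int)
  finally show "(LINT \<omega>|M. mat_trace (word_mat N (X \<omega>) w)) = (\<Sum>f\<in>?C. LINT \<omega>|M. ?h f \<omega>)" .
qed

lemma W_mat_trace_integrable:
  assumes ell: "gaussian_elliptic M N \<rho> X" and N: "N \<ge> 1"
  shows "integrable M (\<lambda>\<omega>. mat_trace (W_mat N (X \<omega>) ^\<^sub>m k))"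
proof -
  have "integrable M (\<lambda>\<omega>. (1 / (real N)\<^sup>2) ^ k * mat_trace (word_mat N (X \<omega>) (block_word True (2 * k))))"
    by (intro integrable_mult_right elliptic_trace(1)[OF ell N, of "[0..<Suc (4 * k)]"]) auto
  then show ?thesis
    by (subst Bochner_Integration.integrable_cong[OF refl mat_trace_W_mat_pow])
      (use ell in \<open>auto simp: gaussian_elliptic_def\<close>)
qed

text \<open>The mean trace is the sum of a single loop carrying the word of 4 k letters.\<close>

lemma W_mat_moment_limit:
  assumes ell: "\<And>N. N \<ge> 1 \<Longrightarrow> gaussian_elliptic (M N) N \<rho> (X N)"
  shows "(\<lambda>N. (LINT \<omega>|M N. mat_trace (W_mat N (X N \<omega>) ^\<^sub>m k)) / real N) \<longlonglongrightarrow> poly (U_poly (2 * k)) \<rho>"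
proof -
  \<comment> \<open>The matrix of size N may live on its own probability space; only the means,
    indexed by N, enter the Wick functional.\<close>
  define EE where "EE N es = (LINT \<omega>|M N. entry_monomial (X N \<omega>) es)" for N es
  interpret wick_functional \<rho> EE
  proof
    fix N :: nat assume N: "N \<ge> 1"
    interpret prob_space "M N" using ell[OF N] by (simp add: gaussian_elliptic_def)
    show "EE N {#} = 1" by (simp add: EE_def entry_monomial_def prob_space)
    fix e es assume "e \<in> {..<N} \<times> {..<N}" "set_mset es \<subseteq> {..<N} \<times> {..<N}"
    then show "EE N (add_mset e es) = (\<Sum>e'\<in>#es. elliptic_cov \<rho> e e' * EE N (es - {#e'#}))"
      unfolding EE_def by (rule ell_wick[OF ell[OF N] N])
  qed
  define w where "w = block_word True (2 * k)"
  define p where "p = [0..<Suc (4 * k)]"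
  have p: "distinct p" "length p = Suc (length w)" by (simp_all add: p_def w_def)
  let ?L = "[(p, w)]"
  have valid: "valid_loops ?L" using p by (simp add: valid_loops_def)
  have size: "size (loop_edges ?L) = 4 * k"
    by (simp add: loop_edges_def size_path_edges[OF p(2)]) (simp add: w_def)
  have "(\<lambda>N. loop_sum N ?L / real N powr (size (loop_edges ?L) / 2 + length ?L)) \<longlonglongrightarrow> nc_weight \<rho> w"
    using loop_sum_limit[OF valid] by simp
  then have lim: "(\<lambda>N. loop_sum N ?L / real N powr (size (loop_edges ?L) / 2 + length ?L)) \<longlonglongrightarrow> poly (U_poly (2 * k)) \<rho>"
    unfolding w_def by (simp only: nc_weight_words)
  show ?thesis
  proof (rule Lim_transform_eventually[OF lim], rule eventually_mono[OF eventually_ge_at_top[of 1]])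
    fix N :: nat assume N: "1 \<le> N"
    have X: "X N \<omega> \<in> carrier_mat N N" if "\<omega> \<in> space (M N)" for \<omega>
      using ell[OF N] that by (simp add: gaussian_elliptic_def)
    have "(LINT \<omega>|M N. mat_trace (W_mat N (X N \<omega>) ^\<^sub>m k)) =
        (LINT \<omega>|M N. (1 / (real N)\<^sup>2) ^ k * mat_trace (word_mat N (X N \<omega>) w))"
      unfolding w_def by (intro Bochner_Integration.integral_cong refl mat_trace_W_mat_pow X)
    also have "\<dots> = (1 / (real N)\<^sup>2) ^ k * (LINT \<omega>|M N. mat_trace (word_mat N (X N \<omega>) w))"
      by (rule integral_mult_right_zero)
    also have "(LINT \<omega>|M N. mat_trace (word_mat N (X N \<omega>) w)) = loop_sum N ?L"
      unfolding elliptic_trace(2)[OF ell[OF N] N p] loop_sum_def graph_sum_def EE_def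
      by (simp add: loop_verts_def loop_eqs_def loop_edges_def)
    finally have "(LINT \<omega>|M N. mat_trace (W_mat N (X N \<omega>) ^\<^sub>m k)) / real N = (1 / (real N)\<^sup>2) ^ k * loop_sum N ?L / real N"
      by simp
    \<comment> \<open>The normalisations agree: N^(-2k) from the scaling of W and 1 / N from the
      trace, against 4 k / 2 + 1 from edges and loops.\<close>
    moreover have "real N powr (size (loop_edges ?L) / 2 + length ?L) = real N ^ (2 * k + 1)"
    proof -
      have "size (loop_edges ?L) / 2 + length ?L = real (2 * k + 1)" unfolding size by simp
      then show ?thesis using N by (simp only: powr_realpow)
    qed
    ultimately show "loop_sum N ?L / real N powr (size (loop_edges ?L) / 2 + length ?L) =
      (LINT \<omega>|M N. mat_trace (W_mat N (X N \<omega>) ^\<^sub>m k)) / real N"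
      by (simp add: power_divide power_mult[symmetric])
  qed
qed

text \<open>The law of a uniformly chosen eigenvalue of the random matrix has the expected spectral
  distribution function as its distribution function and the normalised mean traces as its
  moments.\<close>

lemma expected_spectral_distribution:
  fixes X :: "'a \<Rightarrow> real mat"
  assumes ell: "gaussian_elliptic M N \<rho> X" and N: "N \<ge> 1"
  obtains \<nu> where "real_distribution \<nu>" "\<And>x. cdf \<nu> x = expected_esd M (\<lambda>\<omega>. W_mat N (X \<omega>)) x"
    "\<And>k. integrable \<nu> (\<lambda>x. x ^ k)" "\<And>k. (LINT x|\<nu>. x ^ k) = (LINT \<omega>|M. mat_trace (W_mat N (X \<omega>) ^\<^sub>m k)) / real N"
proof -
  interpret prob_space M using ell by (simp add: gaussian_elliptic_def)
  have X: "X \<omega> \<in> carrier_mat N N" if "\<omega> \<in> space M" for \<omega> using ell that by (simp add: gaussian_elliptic_def)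
  define A where "A \<omega> = W_mat N (X \<omega>)" for \<omega>
  have A: "A \<omega> \<in> carrier_mat N N" if "\<omega> \<in> space M" for \<omega> unfolding A_def by (rule W_mat_carrier[OF X[OF that]])
  have sym: "A \<omega> $$ (i, j) = A \<omega> $$ (j, i)" if "\<omega> \<in> space M" "i < N" "j < N" for \<omega> i j
    unfolding A_def by (rule W_mat_symmetric[OF X[OF that(1)] that(2,3)])
  have tr: "integrable M (\<lambda>\<omega>. mat_trace (A \<omega> ^\<^sub>m k))" for k
    unfolding A_def by (rule W_mat_trace_integrable[OF ell N])
  define ev where "ev i \<omega> = eigvals (A \<omega>) ! i" for i \<omega>
  have ev: "ev i \<in> borel_measurable M" if "i < N" for i
    unfolding ev_def by (rule eigvals_measurable[OF A sym _ that]) (use tr in auto)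
  have tr_ev: "mat_trace (A \<omega> ^\<^sub>m k) = (\<Sum>i<N. ev i \<omega> ^ k)" if "\<omega> \<in> space M" for \<omega> k
    unfolding ev_def by (rule eigvals_symmetric(3)[OF A[OF that] sym[OF that]])
  \<comment> \<open>All summands of the trace of an even power are nonnegative, so each is dominated
    by the integrable trace.\<close>
  have int_even: "integrable M (\<lambda>\<omega>. ev i \<omega> ^ (2 * k))" if i: "i < N" for i k
  proof (rule Bochner_Integration.integrable_bound[OF tr[of "2 * k"]])
    show "AE \<omega> in M. norm (ev i \<omega> ^ (2 * k)) \<le> norm (mat_trace (A \<omega> ^\<^sub>m (2 * k)))"
    proof (intro AE_I2)
      fix \<omega> assume \<omega>: "\<omega> \<in> space M"
      have nn: "0 \<le> x ^ (2 * k)" for x :: real by (simp add: power_mult)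
      have "ev i \<omega> ^ (2 * k) \<le> (\<Sum>i<N. ev i \<omega> ^ (2 * k))"
        using i by (intro member_le_sum nn) auto
      then show "norm (ev i \<omega> ^ (2 * k)) \<le> norm (mat_trace (A \<omega> ^\<^sub>m (2 * k)))"
        unfolding tr_ev[OF \<omega>] using nn[of "ev i \<omega>"] by simp
    qed
  qed (use ev[OF i] in measurable)
  have int: "integrable M (\<lambda>\<omega>. ev i \<omega> ^ k)" if i: "i < N" for i k
  proof (rule Bochner_Integration.integrable_bound)
    show "integrable M (\<lambda>\<omega>. 1 + ev i \<omega> ^ (2 * k))" using int_even[OF i] by simp
    have "\<bar>x\<bar> \<le> \<bar>1 + x\<^sup>2\<bar>" for x :: real
      using sum_squares_bound[of 1 "\<bar>x\<bar>"] by (simp add: abs_of_nonneg)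
    from this[of "ev i \<omega> ^ k" for \<omega>]
    show "AE \<omega> in M. norm (ev i \<omega> ^ k) \<le> norm (1 + ev i \<omega> ^ (2 * k))"
      by (simp add: power_mult power_commutes mult.commute[of 2] flip: power_mult)
  qed (use ev[OF i] in measurable)
  define \<nu> where "\<nu> = mixture M N ev"
  note mix = mixture[where f=ev and M=M and n=N, OF prob_space_axioms N ev, folded \<nu>_def]
  interpret \<nu>: real_distribution \<nu> by (rule mix(1))
  show thesis
  proof (rule that)
    show "real_distribution \<nu>" by (rule mix(1))
    show "integrable \<nu> (\<lambda>x. x ^ k)" for k by (rule mix(2)) (use int in auto)
    show "(LINT x|\<nu>. x ^ k) = (LINT \<omega>|M. mat_trace (W_mat N (X \<omega>) ^\<^sub>m k)) / real N" for k
    proof -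
      have "(LINT x|\<nu>. x ^ k) = (\<Sum>i<N. LINT \<omega>|M. ev i \<omega> ^ k) / real N"
        by (rule mix(3)) (use int in auto)
      also have "(\<Sum>i<N. LINT \<omega>|M. ev i \<omega> ^ k) = (LINT \<omega>|M. (\<Sum>i<N. ev i \<omega> ^ k))"
        using int by (intro Bochner_Integration.integral_sum[symmetric]) auto
      also have "\<dots> = (LINT \<omega>|M. mat_trace (W_mat N (X \<omega>) ^\<^sub>m k))"
        by (intro Bochner_Integration.integral_cong refl tr_ev[symmetric, unfolded A_def])
      finally show ?thesis .
    qed
    show "cdf \<nu> x = expected_esd M (\<lambda>\<omega>. W_mat N (X \<omega>)) x" for x
    proof -
      have ind: "integrable M (\<lambda>\<omega>. indicator {..x} (ev i \<omega>) :: real)" if "i < N" for i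
        by (rule integrable_const_bound[where B=1]) (use ev[OF that] in \<open>auto simp: indicator_def\<close>)
      have "cdf \<nu> x = (LINT y|\<nu>. indicator {..x} y)" by (simp add: cdf_def)
      also have "\<dots> = (\<Sum>i<N. LINT \<omega>|M. indicator {..x} (ev i \<omega>)) / real N"
        by (rule mix(3)) (use ind in auto)
      also have "\<dots> = (LINT \<omega>|M. (\<Sum>i<N. indicator {..x} (ev i \<omega>)) / real N)"
        using ind by (simp add: Bochner_Integration.integral_sum)
      also have "\<dots> = (LINT \<omega>|M. esd (A \<omega>) x)"
      proof (intro Bochner_Integration.integral_cong refl)
        fix \<omega> assume \<omega>: "\<omega> \<in> space M"
        have "(\<Sum>i<N. indicator {..x} (ev i \<omega>)) = (\<Sum>i\<in>{..<N}. if ev i \<omega> \<le> x then 1 else 0 :: real)"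
          by (intro sum.cong) (auto simp: indicator_def)
        also have "\<dots> = real (card ({..<N} \<inter> {i. ev i \<omega> \<le> x}))" by (simp add: sum.If_cases)
        also have "{..<N} \<inter> {i. ev i \<omega> \<le> x} = {i. i < N \<and> eigvals (A \<omega>) ! i \<le> x}" by (auto simp: ev_def)
        also have "card \<dots> = size {# l \<in># proots (char_poly (A \<omega>)). l \<le> x #}"
          by (rule eigvals_symmetric(4)[OF A[OF \<omega>] sym[OF \<omega>], symmetric])
        finally show "(\<Sum>i<N. indicator {..x} (ev i \<omega>)) / real N = esd (A \<omega>) x"
          using A[OF \<omega>] by (simp add: esd_def)
      qed
      finally show ?thesis by (simp add: expected_esd_def A_def)
    qed
  qed
qed

theorem theorem1p1:
  fixes \<rho> :: real
    and M :: "nat \<Rightarrow> 'a measure"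
    and X :: "nat \<Rightarrow> 'a \<Rightarrow> real mat"
  assumes "-1 < \<rho>" and "\<rho> < 1"
    and "\<And>N. N \<ge> 1 \<Longrightarrow> gaussian_elliptic (M N) N \<rho> (X N)"
  shows "\<exists>\<mu>. real_distribution \<mu> \<and>
    (\<forall>x. (\<lambda>N. expected_esd (M N) (\<lambda>\<omega>. W_mat N (X N \<omega>)) x) \<longlonglongrightarrow> cdf \<mu> x) \<and>
    (\<forall>k::nat. integrable \<mu> (\<lambda>x. x ^ k) \<and>
       (LINT x|\<mu>. x ^ k) = poly (U_poly (2 * k)) \<rho>) \<and>
    (\<forall>\<nu>. real_distribution \<nu> \<and>
       (\<forall>k::nat. integrable \<nu> (\<lambda>x. x ^ k) \<and> (LINT x|\<nu>. x ^ k) = (LINT x|\<mu>. x ^ k))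
       \<longrightarrow> cdf \<nu> = cdf \<mu>)"
proof -
  have \<rho>: "\<bar>\<rho>\<bar> < 1" using assms(1,2) by simp
  define m where "m k = poly (U_poly (2 * k)) \<rho>" for k
  \<comment> \<open>\<open>m (2 * k)\<close> is the value of U at index 4 k, and 4^(4k) = 16^(2k).
    The support bound 17 below is a number above 16.\<close>
  have m_le: "m (2 * k) \<le> 2 * 16 ^ (2 * k)" for k
  proof -
    have "m (2 * k) \<le> 2 * 4 ^ (2 * (2 * k))" using abs_poly_U_le[of \<rho> "2 * (2 * k)"] \<rho> by (simp add: m_def)
    then show ?thesis by (simp add: power_mult)
  qed
  \<comment> \<open>The sequence starts at size 1, hence the shift to \<open>Suc n\<close>, undone
    when the convergence is stated.\<close>
  have "\<exists>\<nu>. real_distribution \<nu> \<and> (\<forall>x. cdf \<nu> x = expected_esd (M (Suc n)) (\<lambda>\<omega>. W_mat (Suc n) (X (Suc n) \<omega>)) x) \<and>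
    (\<forall>k. integrable \<nu> (\<lambda>x. x ^ k)) \<and>
    (\<forall>k. (LINT x|\<nu>. x ^ k) = (LINT \<omega>|M (Suc n). mat_trace (W_mat (Suc n) (X (Suc n) \<omega>) ^\<^sub>m k)) / real (Suc n))" for n
    using expected_spectral_distribution[OF assms(3), of "Suc n"] by (metis le_add1 plus_1_eq_Suc)
  then obtain \<nu> where \<nu>: "\<And>n. real_distribution (\<nu> n)"
    "\<And>n x. cdf (\<nu> n) x = expected_esd (M (Suc n)) (\<lambda>\<omega>. W_mat (Suc n) (X (Suc n) \<omega>)) x"
    "\<And>n k. integrable (\<nu> n) (\<lambda>x. x ^ k)"
    "\<And>n k. (LINT x|\<nu> n. x ^ k) = (LINT \<omega>|M (Suc n). mat_trace (W_mat (Suc n) (X (Suc n) \<omega>) ^\<^sub>m k)) / real (Suc n)"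
    by metis
  have mom: "(\<lambda>n. LINT x|\<nu> n. x ^ k) \<longlonglongrightarrow> m k" for k
    unfolding \<nu>(4) m_def
    by (rule LIMSEQ_Suc[OF W_mat_moment_limit]) (rule assms(3))
  obtain \<mu> where \<mu>: "real_distribution \<mu>" "weak_conv_m \<nu> \<mu>" "AE x in \<mu>. \<bar>x\<bar> \<le> 17" "\<And>k. (LINT x|\<mu>. x ^ k) = m k"
    using method_of_moments[OF \<nu>(1,3) mom m_le, of 17] by auto
  interpret \<mu>: real_distribution \<mu> by fact
  have atomless: "measure \<mu> {x} = 0" for x
    by (rule \<mu>.atomless_of_moments[OF \<mu>(3) _ \<rho>]) (use \<mu>(4) in \<open>auto simp: m_def\<close>)
  \<comment> \<open>Without atoms every x is a continuity point of the limit, so weak convergence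
    gives convergence at every x.\<close>
  have "(\<lambda>n. cdf (\<nu> n) x) \<longlonglongrightarrow> cdf \<mu> x" for x
    using \<mu>(2) \<mu>.isCont_cdf[of x] atomless[of x] by (auto simp: weak_conv_m_def weak_conv_def)
  then have conv: "(\<lambda>N. expected_esd (M N) (\<lambda>\<omega>. W_mat N (X N \<omega>)) x) \<longlonglongrightarrow> cdf \<mu> x" for x
    unfolding \<nu>(2) by (rule LIMSEQ_imp_Suc)
  have unique: "cdf \<nu>' = cdf \<mu>" if \<nu>': "real_distribution \<nu>'"
    and int: "\<And>k. integrable \<nu>' (\<lambda>x. x ^ k)" and eq: "\<And>k. (LINT x|\<nu>'. x ^ k) = (LINT x|\<mu>. x ^ k)" for \<nu>'
  proof -
    \<comment> \<open>Bounded support of the competitor follows from its even moments alone.\<close>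
    have "AE x in \<nu>'. \<bar>x\<bar> \<le> 17"
      by (rule real_distribution.AE_bounded_of_moments[OF \<nu>' int, of 2 16])
        (use m_le in \<open>auto simp: eq \<mu>(4)\<close>)
    then show ?thesis
      using real_distribution_eq_of_moments[OF \<nu>' \<mu>(1) _ \<mu>(3) eq] by simp
  qed
  show ?thesis
  proof (intro exI[of _ \<mu>] conjI allI impI)
    show "integrable \<mu> (\<lambda>x. x ^ k)" for k by (rule \<mu>.integrable_power_of_AE_bounded[OF \<mu>(3)])
    show "(LINT x|\<mu>. x ^ k) = poly (U_poly (2 * k)) \<rho>" for k using \<mu>(4) by (simp add: m_def)
  qed (use \<mu>(1) conv unique in blast)+
qed

end
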